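(* Let $G$ be a semisimple Lie group over $\mathbb{R}$ or $\mathbb{C}$, and let $\Gamma<G$ be a cocompact lattice. Let $g_t$ be the flow on $G/\Gamma$ generated by a vector field $X\in\mathrm{Lie}(G)$, i.e. $g_t(x)=\exp(tX)x$. Assume that $g_t$ is partially hyperbolic. Let $\tau:G/\Gamma\to\mathbb{R}$ be a smooth positive function, and let $g^\tau_t$ be the time change generated by $\tau^{-1}X$. Then $g_t^\tau$ is partially hyperbolic and center bunched.
   Context: The time change is the flow $g^\tau_t(x)=g_{\alpha(x,t)}(x)$, where $\alpha(x,t)$ is given by $\int_0^{\alpha(x,t)}\tau(g_s x)\,ds=t$. A flow $\phi_t$ on a compact manifold $M$ is (uniformly) partially hyperbolic if there is a $D\phi_t$-invariant splitting $TM=E^s\oplus E^c\oplus E^u$ (with $E^s,E^u$ nonzero), a Riemannian metric, and positive numbers $a,b,A,B,C$ with $a<B$ and $b<A$ such that for all $t>0$: $\|D\phi_t v\|\le Ce^{-Bt}\|v\|$ for $v\in E^s$; $C^{-1}e^{-at}\|v\|\le\|D\phi_t v\|\le Ce^{bt}\|v\|$ for $v\in E^c$; and $C^{-1}e^{At}\|v\|\le\|D\phi_t v\|$ for $v\in E^u$. It is (uniformly) center bunched if in addition $a+b<A$ and $a+b<B$. For the homogeneous flow $g_t$, partial hyperbolicity is equivalent to $\mathrm{Ad}(\exp X)$ having at least one eigenvalue of modulus different from one. *)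

theory Defs
  imports "HOL-Analysis.Analysis" "HOL-Algebra.Left_Coset"
begin

section \<open>Smooth manifolds\<close>

text \<open>Only used on open sets \<open>S\<close>.\<close>

fun Ck_on :: "nat \<Rightarrow> 'a::real_normed_vector set \<Rightarrow> ('a \<Rightarrow> 'b::real_normed_vector) \<Rightarrow> bool" where
  "Ck_on 0 S f \<longleftrightarrow> continuous_on S f"
| "Ck_on (Suc n) S f \<longleftrightarrow>
     (\<forall>x\<in>S. f differentiable (at x)) \<and>
     (\<forall>v. Ck_on n S (\<lambda>x. frechet_derivative f (at x) v))"

definition smooth_on :: "'a::real_normed_vector set \<Rightarrow> ('a \<Rightarrow> 'b::real_normed_vector) \<Rightarrow> bool" where
  "smooth_on S f \<longleftrightarrow> (\<forall>n. Ck_on n S f)"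

type_synonym ('a, 'e) chart = "'a set \<times> ('a \<Rightarrow> 'e)"

record ('a, 'e) manifold =
  mtop :: "'a topology"
  atlas :: "('a, 'e) chart set"

text \<open>The inverse of a chart, meaningful on its image.\<close>

definition chart_inv :: "('a, 'e) chart \<Rightarrow> 'e \<Rightarrow> 'a" where
  "chart_inv c = inv_into (fst c) (snd c)"

definition smooth_manifold :: "('a, 'e::euclidean_space) manifold \<Rightarrow> bool" where
  "smooth_manifold M \<longleftrightarrow>
     Hausdorff_space (mtop M) \<and> second_countable (mtop M) \<and>
     topspace (mtop M) = (\<Union>c\<in>atlas M. fst c) \<and>
     (\<forall>c\<in>atlas M. openin (mtop M) (fst c) \<and> open (snd c ` fst c) \<and>
        homeomorphic_map (subtopology (mtop M) (fst c)) (top_of_set (snd c ` fst c)) (snd c)) \<and>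
     (\<forall>c\<in>atlas M. \<forall>d\<in>atlas M.
        smooth_on (snd c ` (fst c \<inter> fst d)) (snd d \<circ> chart_inv c))"

definition smooth_map ::
  "('a, 'e::euclidean_space) manifold \<Rightarrow> ('b, 'f::euclidean_space) manifold \<Rightarrow> ('a \<Rightarrow> 'b) \<Rightarrow> bool"
  where
  "smooth_map M N f \<longleftrightarrow>
     continuous_map (mtop M) (mtop N) f \<and>
     (\<forall>c\<in>atlas M. \<forall>d\<in>atlas N.
        smooth_on (snd c ` {x \<in> fst c. f x \<in> fst d}) (snd d \<circ> f \<circ> chart_inv c))"

definition euclidean_manifold :: "('e::euclidean_space, 'e) manifold" where
  "euclidean_manifold = \<lparr>mtop = euclidean, atlas = {(UNIV, id)}\<rparr>"

definition prod_manifold ::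
  "('a, 'e) manifold \<Rightarrow> ('b, 'f) manifold \<Rightarrow> ('a \<times> 'b, 'e \<times> 'f) manifold" where
  "prod_manifold M N =
     \<lparr>mtop = prod_topology (mtop M) (mtop N),
      atlas = {(fst c \<times> fst d, map_prod (snd c) (snd d)) | c d. c \<in> atlas M \<and> d \<in> atlas N}\<rparr>"


section \<open>Tangent spaces and derivatives\<close>

text \<open>
  Every point is assigned a preferred chart, and the tangent space at \<open>x\<close> is the model space
  \<open>'e\<close>, a vector standing for the tangent vector with these coordinates in the preferred
  chart at \<open>x\<close>.  The preferred chart need not vary continuously with the point, so continuity
  or smoothness of vector fields, subbundles and metrics has to be expressed through
  \<open>coord_change\<close> to or from a fixed chart.
\<close>

definition chart_at :: "('a, 'e) manifold \<Rightarrow> 'a \<Rightarrow> ('a, 'e) chart" where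
  "chart_at M x = (SOME c. c \<in> atlas M \<and> x \<in> fst c)"

definition coord_change ::
  "('a, 'e::euclidean_space) chart \<Rightarrow> ('a, 'e) chart \<Rightarrow> 'a \<Rightarrow> 'e \<Rightarrow> 'e" where
  "coord_change c d x = frechet_derivative (snd d \<circ> chart_inv c) (at (snd c x))"

definition mderiv ::
  "('a, 'e::euclidean_space) manifold \<Rightarrow> ('b, 'f::euclidean_space) manifold \<Rightarrow> ('a \<Rightarrow> 'b)
    \<Rightarrow> 'a \<Rightarrow> 'e \<Rightarrow> 'f" where
  "mderiv M N f x =
     frechet_derivative (snd (chart_at N (f x)) \<circ> f \<circ> chart_inv (chart_at M x))
       (at (snd (chart_at M x) x))"

definition continuous_section ::
  "('a, 'e::euclidean_space) manifold \<Rightarrow> 'a set \<Rightarrow> ('a \<Rightarrow> 'e) \<Rightarrow> bool" where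
  "continuous_section M U s \<longleftrightarrow>
     (\<forall>c\<in>atlas M. continuous_map (subtopology (mtop M) (U \<inter> fst c)) euclidean
        (\<lambda>x. coord_change (chart_at M x) c x (s x)))"

definition subbundle ::
  "('a, 'e::euclidean_space) manifold \<Rightarrow> ('a \<Rightarrow> 'e set) \<Rightarrow> bool" where
  "subbundle M E \<longleftrightarrow>
     (\<forall>x0\<in>topspace (mtop M). \<exists>U (k::nat) (s :: nat \<Rightarrow> 'a \<Rightarrow> 'e).
        openin (mtop M) U \<and> x0 \<in> U \<and>
        (\<forall>i<k. continuous_section M U (s i)) \<and>
        (\<forall>x\<in>U. inj_on (\<lambda>i. s i x) {..<k} \<and> independent ((\<lambda>i. s i x) ` {..<k}) \<and>
                span ((\<lambda>i. s i x) ` {..<k}) = E x))"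

definition riemannian_metric ::
  "('a, 'e::euclidean_space) manifold \<Rightarrow> ('a \<Rightarrow> 'e \<Rightarrow> 'e \<Rightarrow> real) \<Rightarrow> bool" where
  "riemannian_metric M g \<longleftrightarrow>
     (\<forall>x\<in>topspace (mtop M).
        bilinear (g x) \<and> (\<forall>v w. g x v w = g x w v) \<and> (\<forall>v. v \<noteq> 0 \<longrightarrow> g x v v > 0)) \<and>
     (\<forall>c\<in>atlas M. \<forall>v w. smooth_on (snd c ` fst c)
        (\<lambda>y. let x = chart_inv c y in
           g x (coord_change c (chart_at M x) x v) (coord_change c (chart_at M x) x w)))"

definition metric_norm :: "('a \<Rightarrow> 'e \<Rightarrow> 'e \<Rightarrow> real) \<Rightarrow> 'a \<Rightarrow> 'e \<Rightarrow> real" where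
  "metric_norm g x v = sqrt (g x v v)"


section \<open>Partially hyperbolic flows\<close>

definition smooth_flow ::
  "('a, 'e::euclidean_space) manifold \<Rightarrow> (real \<Rightarrow> 'a \<Rightarrow> 'a) \<Rightarrow> bool" where
  "smooth_flow M \<phi> \<longleftrightarrow>
     smooth_map (prod_manifold euclidean_manifold M) M (\<lambda>(t, x). \<phi> t x) \<and>
     (\<forall>x\<in>topspace (mtop M). \<phi> 0 x = x \<and> (\<forall>s t. \<phi> (s + t) x = \<phi> s (\<phi> t x)))"

definition invariant_splitting ::
  "('a, 'e::euclidean_space) manifold \<Rightarrow> (real \<Rightarrow> 'a \<Rightarrow> 'a)
    \<Rightarrow> ('a \<Rightarrow> 'e set) \<Rightarrow> ('a \<Rightarrow> 'e set) \<Rightarrow> ('a \<Rightarrow> 'e set) \<Rightarrow> bool" where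
  "invariant_splitting M \<phi> Es Ec Eu \<longleftrightarrow>
     subbundle M Es \<and> subbundle M Ec \<and> subbundle M Eu \<and>
     (\<forall>x\<in>topspace (mtop M).
        (\<forall>v. \<exists>!p. fst p \<in> Es x \<and> fst (snd p) \<in> Ec x \<and> snd (snd p) \<in> Eu x \<and>
                  v = fst p + fst (snd p) + snd (snd p)) \<and>
        (\<forall>t. mderiv M M (\<phi> t) x ` Es x = Es (\<phi> t x) \<and>
             mderiv M M (\<phi> t) x ` Ec x = Ec (\<phi> t x) \<and>
             mderiv M M (\<phi> t) x ` Eu x = Eu (\<phi> t x)))"

definition hyperbolicity_estimates ::
  "('a, 'e::euclidean_space) manifold \<Rightarrow> (real \<Rightarrow> 'a \<Rightarrow> 'a)
    \<Rightarrow> ('a \<Rightarrow> 'e set) \<Rightarrow> ('a \<Rightarrow> 'e set) \<Rightarrow> ('a \<Rightarrow> 'e set) \<Rightarrow> ('a \<Rightarrow> 'e \<Rightarrow> 'e \<Rightarrow> real)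
    \<Rightarrow> real \<Rightarrow> real \<Rightarrow> real \<Rightarrow> real \<Rightarrow> real \<Rightarrow> bool" where
  "hyperbolicity_estimates M \<phi> Es Ec Eu g a b A B C \<longleftrightarrow>
     (\<forall>t>0. \<forall>x\<in>topspace (mtop M).
        (\<forall>v\<in>Es x. metric_norm g (\<phi> t x) (mderiv M M (\<phi> t) x v)
                     \<le> C * exp (- B * t) * metric_norm g x v) \<and>
        (\<forall>v\<in>Ec x. inverse C * exp (- a * t) * metric_norm g x v
                     \<le> metric_norm g (\<phi> t x) (mderiv M M (\<phi> t) x v) \<and>
                   metric_norm g (\<phi> t x) (mderiv M M (\<phi> t) x v)
                     \<le> C * exp (b * t) * metric_norm g x v) \<and>
        (\<forall>v\<in>Eu x. inverse C * exp (A * t) * metric_norm g x v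
                     \<le> metric_norm g (\<phi> t x) (mderiv M M (\<phi> t) x v)))"

definition partially_hyperbolic_with ::
  "('a, 'e::euclidean_space) manifold \<Rightarrow> (real \<Rightarrow> 'a \<Rightarrow> 'a)
    \<Rightarrow> real \<Rightarrow> real \<Rightarrow> real \<Rightarrow> real \<Rightarrow> real \<Rightarrow> bool" where
  "partially_hyperbolic_with M \<phi> a b A B C \<longleftrightarrow>
     smooth_manifold M \<and> compact_space (mtop M) \<and> smooth_flow M \<phi> \<and>
     0 < a \<and> 0 < b \<and> 0 < A \<and> 0 < B \<and> 0 < C \<and> a < B \<and> b < A \<and>
     (\<exists>Es Ec Eu g.
        invariant_splitting M \<phi> Es Ec Eu \<and>
        (\<forall>x\<in>topspace (mtop M). Es x \<noteq> {0} \<and> Eu x \<noteq> {0}) \<and>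
        riemannian_metric M g \<and>
        hyperbolicity_estimates M \<phi> Es Ec Eu g a b A B C)"

definition partially_hyperbolic ::
  "('a, 'e::euclidean_space) manifold \<Rightarrow> (real \<Rightarrow> 'a \<Rightarrow> 'a) \<Rightarrow> bool" where
  "partially_hyperbolic M \<phi> \<longleftrightarrow> (\<exists>a b A B C. partially_hyperbolic_with M \<phi> a b A B C)"

definition center_bunched ::
  "('a, 'e::euclidean_space) manifold \<Rightarrow> (real \<Rightarrow> 'a \<Rightarrow> 'a) \<Rightarrow> bool" where
  "center_bunched M \<phi> \<longleftrightarrow>
     (\<exists>a b A B C. partially_hyperbolic_with M \<phi> a b A B C \<and> a + b < A \<and> a + b < B)"


section \<open>Lie groups\<close>

definition lie_group :: "'g monoid \<Rightarrow> ('g, 'e::euclidean_space) manifold \<Rightarrow> bool" where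
  "lie_group G M \<longleftrightarrow>
     group G \<and> smooth_manifold M \<and> carrier G = topspace (mtop M) \<and>
     smooth_map (prod_manifold M M) M (\<lambda>(x, y). x \<otimes>\<^bsub>G\<^esub> y) \<and>
     smooth_map M M (\<lambda>x. inv\<^bsub>G\<^esub> x)"

text \<open>
  A complex Lie group is described by its underlying real Lie group and a complex structure
  \<open>J\<close> on the model space (multiplication by the imaginary unit) for which the coordinate
  changes and the group operations are holomorphic, i.e. have complex linear derivatives.
\<close>

definition complex_lie_group ::
  "('e \<Rightarrow> 'e) \<Rightarrow> 'g monoid \<Rightarrow> ('g, 'e::euclidean_space) manifold \<Rightarrow> bool" where
  "complex_lie_group J G M \<longleftrightarrow>
     lie_group G M \<and> linear J \<and> (\<forall>v. J (J v) = - v) \<and>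
     (\<forall>c\<in>atlas M. \<forall>d\<in>atlas M. \<forall>x\<in>fst c \<inter> fst d. \<forall>v.
        coord_change c d x (J v) = J (coord_change c d x v)) \<and>
     (\<forall>x\<in>carrier G. \<forall>y\<in>carrier G. \<forall>v w.
        mderiv (prod_manifold M M) M (\<lambda>(x, y). x \<otimes>\<^bsub>G\<^esub> y) (x, y) (J v, J w) =
        J (mderiv (prod_manifold M M) M (\<lambda>(x, y). x \<otimes>\<^bsub>G\<^esub> y) (x, y) (v, w))) \<and>
     (\<forall>x\<in>carrier G. \<forall>v.
        mderiv M M (\<lambda>x. inv\<^bsub>G\<^esub> x) x (J v) = J (mderiv M M (\<lambda>x. inv\<^bsub>G\<^esub> x) x v))"

text \<open>
  The Lie algebra is the tangent space at \<open>\<one>\<close>, i.e. the model space \<open>'e\<close>, with the bracket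
  given by the derivative at \<open>\<one>\<close> of the adjoint representation.
\<close>

definition Ad :: "'g monoid \<Rightarrow> ('g, 'e::euclidean_space) manifold \<Rightarrow> 'g \<Rightarrow> 'e \<Rightarrow> 'e" where
  "Ad G M x = mderiv M M (\<lambda>y. x \<otimes>\<^bsub>G\<^esub> y \<otimes>\<^bsub>G\<^esub> inv\<^bsub>G\<^esub> x) \<one>\<^bsub>G\<^esub>"

definition lie_bracket ::
  "'g monoid \<Rightarrow> ('g, 'e::euclidean_space) manifold \<Rightarrow> 'e \<Rightarrow> 'e \<Rightarrow> 'e" where
  "lie_bracket G M X Y = mderiv M euclidean_manifold (\<lambda>x. Ad G M x Y) \<one>\<^bsub>G\<^esub> X"

definition lie_ideal :: "('e::real_vector \<Rightarrow> 'e \<Rightarrow> 'e) \<Rightarrow> 'e set \<Rightarrow> bool" where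
  "lie_ideal br I \<longleftrightarrow> subspace I \<and> (\<forall>X. \<forall>Y\<in>I. br X Y \<in> I)"

primrec derived_series :: "('e::real_vector \<Rightarrow> 'e \<Rightarrow> 'e) \<Rightarrow> 'e set \<Rightarrow> nat \<Rightarrow> 'e set" where
  "derived_series br I 0 = I"
| "derived_series br I (Suc n) =
     span {br X Y | X Y. X \<in> derived_series br I n \<and> Y \<in> derived_series br I n}"

definition lie_solvable :: "('e::real_vector \<Rightarrow> 'e \<Rightarrow> 'e) \<Rightarrow> 'e set \<Rightarrow> bool" where
  "lie_solvable br I \<longleftrightarrow> (\<exists>n. derived_series br I n = {0})"

definition real_semisimple_lie_group ::
  "'g monoid \<Rightarrow> ('g, 'e::euclidean_space) manifold \<Rightarrow> bool" where
  "real_semisimple_lie_group G M \<longleftrightarrow>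
     lie_group G M \<and>
     (\<forall>I. lie_ideal (lie_bracket G M) I \<and> lie_solvable (lie_bracket G M) I \<longrightarrow> I = {0})"

definition complex_semisimple_lie_group ::
  "'g monoid \<Rightarrow> ('g, 'e::euclidean_space) manifold \<Rightarrow> bool" where
  "complex_semisimple_lie_group G M \<longleftrightarrow>
     (\<exists>J. complex_lie_group J G M \<and>
        (\<forall>I. lie_ideal (lie_bracket G M) I \<and> J ` I \<subseteq> I \<and> lie_solvable (lie_bracket G M) I
          \<longrightarrow> I = {0}))"

definition one_parameter_subgroup ::
  "'g monoid \<Rightarrow> ('g, 'e::euclidean_space) manifold \<Rightarrow> 'e \<Rightarrow> (real \<Rightarrow> 'g) \<Rightarrow> bool" where
  "one_parameter_subgroup G M X \<gamma> \<longleftrightarrow>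
     smooth_map euclidean_manifold M \<gamma> \<and>
     (\<forall>s t. \<gamma> (s + t) = \<gamma> s \<otimes>\<^bsub>G\<^esub> \<gamma> t) \<and>
     mderiv euclidean_manifold M \<gamma> 0 1 = X"

definition lie_exp :: "'g monoid \<Rightarrow> ('g, 'e::euclidean_space) manifold \<Rightarrow> 'e \<Rightarrow> 'g" where
  "lie_exp G M X = (THE \<gamma>. one_parameter_subgroup G M X \<gamma>) 1"


section \<open>Homogeneous spaces\<close>

definition quotient_topology :: "'a topology \<Rightarrow> ('a \<Rightarrow> 'b) \<Rightarrow> 'b topology" where
  "quotient_topology T q =
     topology (\<lambda>U. U \<subseteq> q ` topspace T \<and> openin T {x \<in> topspace T. q x \<in> U})"

lemma openin_quotient_topology:
  "openin (quotient_topology T q) U \<longleftrightarrow>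
     U \<subseteq> q ` topspace T \<and> openin T {x \<in> topspace T. q x \<in> U}"
proof -
  have "istopology (\<lambda>U. U \<subseteq> q ` topspace T \<and> openin T {x \<in> topspace T. q x \<in> U})"
    unfolding istopology_def
  proof (intro conjI allI impI)
    fix S S' assume S: "S \<subseteq> q ` topspace T \<and> openin T {x \<in> topspace T. q x \<in> S}"
      and S': "S' \<subseteq> q ` topspace T \<and> openin T {x \<in> topspace T. q x \<in> S'}"
    show "S \<inter> S' \<subseteq> q ` topspace T" using S by blast
    have "{x \<in> topspace T. q x \<in> S \<inter> S'}
        = {x \<in> topspace T. q x \<in> S} \<inter> {x \<in> topspace T. q x \<in> S'}" by blast
    then show "openin T {x \<in> topspace T. q x \<in> S \<inter> S'}" using S S' by auto
  next
    fix K assume K: "\<forall>S\<in>K. S \<subseteq> q ` topspace T \<and> openin T {x \<in> topspace T. q x \<in> S}"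
    show "\<Union>K \<subseteq> q ` topspace T" using K by blast
    have "{x \<in> topspace T. q x \<in> \<Union>K} = (\<Union>S\<in>K. {x \<in> topspace T. q x \<in> S})" by blast
    then show "openin T {x \<in> topspace T. q x \<in> \<Union>K}" using K by auto
  qed
  then show ?thesis by (simp add: quotient_topology_def)
qed

lemma quotient_map_quotient_topology: "quotient_map T (quotient_topology T q) q"
proof -
  have "topspace (quotient_topology T q) = q ` topspace T"
  proof (rule antisym)
    show "topspace (quotient_topology T q) \<subseteq> q ` topspace T"
      using openin_topspace[of "quotient_topology T q"]
      unfolding openin_quotient_topology by blast
    have "{x \<in> topspace T. q x \<in> q ` topspace T} = topspace T" by blast
    then have "openin (quotient_topology T q) (q ` topspace T)"
      by (simp add: openin_quotient_topology)
    then show "q ` topspace T \<subseteq> topspace (quotient_topology T q)"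
      by (rule openin_subset)
  qed
  then show ?thesis by (auto simp: quotient_map_def openin_quotient_topology)
qed

text \<open>
  The points are the left cosets \<open>x\<Gamma>\<close>.  The charts are the charts of \<open>G\<close> restricted to
  open sets \<open>V\<close> on which the projection is injective, pushed forward by the projection;
  for a discrete subgroup these form an atlas, making the projection a local diffeomorphism.
\<close>

definition quotient_manifold ::
  "'g monoid \<Rightarrow> ('g, 'e) manifold \<Rightarrow> 'g set \<Rightarrow> ('g set, 'e) manifold" where
  "quotient_manifold G M \<Gamma> =
     (let q = (\<lambda>x. x <#\<^bsub>G\<^esub> \<Gamma>) in
      \<lparr>mtop = quotient_topology (mtop M) q,
       atlas = {(q ` V, snd c \<circ> inv_into V q) | c V.
                  c \<in> atlas M \<and> V \<subseteq> fst c \<and> openin (mtop M) V \<and> inj_on q V}\<rparr>)"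

text \<open>
  A discrete subgroup with compact quotient automatically has finite covolume, so no
  invariant measure is needed to define cocompact lattices.
\<close>

definition cocompact_lattice :: "'g monoid \<Rightarrow> ('g, 'e) manifold \<Rightarrow> 'g set \<Rightarrow> bool" where
  "cocompact_lattice G M \<Gamma> \<longleftrightarrow>
     subgroup \<Gamma> G \<and> subtopology (mtop M) \<Gamma> = discrete_topology \<Gamma> \<and>
     compact_space (mtop (quotient_manifold G M \<Gamma>))"

definition homogeneous_flow ::
  "'g monoid \<Rightarrow> ('g, 'e::euclidean_space) manifold \<Rightarrow> 'e \<Rightarrow> real \<Rightarrow> 'g set \<Rightarrow> 'g set" where
  "homogeneous_flow G M X t x = lie_exp G M (t *\<^sub>R X) <#\<^bsub>G\<^esub> x"


section \<open>Time changes\<close>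

text \<open>The interval integral is oriented, so negative times are covered as well.\<close>

definition time_change_param :: "(real \<Rightarrow> 'a \<Rightarrow> 'a) \<Rightarrow> ('a \<Rightarrow> real) \<Rightarrow> 'a \<Rightarrow> real \<Rightarrow> real" where
  "time_change_param \<phi> \<tau> x t =
     (THE a. (LBINT s=ereal 0..ereal a. \<tau> (\<phi> s x)) = t)"

definition time_change :: "(real \<Rightarrow> 'a \<Rightarrow> 'a) \<Rightarrow> ('a \<Rightarrow> real) \<Rightarrow> real \<Rightarrow> 'a \<Rightarrow> 'a" where
  "time_change \<phi> \<tau> t x = \<phi> (time_change_param \<phi> \<tau> x t) x"

end

theory Submission
  imports Defs "HOL-Computational_Algebra.Fundamental_Theorem_Algebra"
begin

text \<open>
  Right translation trivialises the tangent bundle of \<open>G / \<Gamma>\<close>: the derivatives \<open>\<theta> x\<close> at the unit of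
  the orbit maps \<open>y \<mapsto> y x\<close> form a continuous frame in which \<open>g\<^sub>t\<close> acts by the one-parameter group
  \<open>L\<^sub>t = Ad (exp (t X))\<close>, independently of the point.  Sorting the eigenvalues of \<open>L\<^sub>1\<close> by modulus
  gives an \<open>L\<close>-invariant splitting of the Lie algebra into vectors that are contracted, grow
  subexponentially in both time directions, or are expanded.  Partial hyperbolicity makes the two
  outer spaces nontrivial.  The generator of the flow has bounded orbits, so it is a central
  direction.

  With \<open>F a x = \<integral>\<^sub>0\<^sup>a \<tau> (g\<^sub>s x) ds\<close>, the derivative of the time change is that of \<open>g\<^sub>a\<close>, \<open>a = \<alpha> x t\<close>,
  plus a multiple of the generator given by the cocycle \<open>\<kappa> x a v = D (F a) (\<theta> x v)\<close>.  On central
  vectors the cocycle grows subexponentially, hence the centre of \<open>g\<^sub>t\<close> is invariant under the time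
  change and grows subexponentially there as well.  On stable vectors \<open>\<kappa> x a v\<close> converges as
  \<open>a \<rightarrow> \<infinity>\<close>, and shearing the stable vectors along the generator by the limit yields a bundle which
  is invariant under the time change and contracted at an exponential rate; the unstable bundle
  is obtained in the same way from \<open>a \<rightarrow> -\<infinity>\<close>.  As the central rates are arbitrarily small, the
  time change is centre bunched.
\<close>

section \<open>Calculus of \<open>C\<^sup>k\<close> functions\<close>

text \<open>The obstacle is that the derivative of the time change differs from that of the flow by
  a multiple of the generator, so the stable and unstable bundles of the flow need not survive.
  Write a tangent vector as \<open>\<theta> x v + c *\<^sub>R Z x\<close>. With
  \<open>a = \<alpha> x t\<close>, the time change turns the coefficient \<open>c\<close> into
  \<open>(c * \<tau> x - \<kappa> x a v) / \<tau> (\<psi> t x)\<close>. Vectors with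
  \<open>c = \<zeta> x v / \<tau> x\<close> are therefore mapped to vectors of the same form as soon
  as \<open>\<zeta>\<close> solves the linear cohomological equation
  \<open>\<zeta> (\<phi> a x) (L a v) = \<zeta> x v - \<kappa> x a v\<close>, and the limit of
  \<open>\<kappa>\<close> in the contracting direction of time is a solution. The center absorbs the
  extra term because it contains the generator. Exponential rates survive since, for positive
  \<open>t\<close>, \<open>\<alpha> x t\<close> lies between two positive multiples of
  \<open>t\<close>. The spectral splitting is read off from linear recurrences satisfied by orbits,
  which replaces complexification and normal forms of \<open>Ad\<close>.\<close>

lemma Ck_on_cong:
  assumes "open S" "\<And>x. x \<in> S \<Longrightarrow> f x = g x" "Ck_on n S f"
  shows "Ck_on n S g"
  using assms(2,3)
proof (induction n arbitrary: f g)
  case 0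
  then show ?case by (simp cong: continuous_on_cong)
next
  case (Suc n)
  have der: "(g has_derivative frechet_derivative f (at x)) (at x)" if "x \<in> S" for x
  proof (rule has_derivative_transform_within_open[OF _ \<open>open S\<close> that])
    show "(f has_derivative frechet_derivative f (at x)) (at x)"
      using Suc.prems(2) that frechet_derivative_works by auto
  qed (use Suc.prems(1) in auto)
  have eq: "frechet_derivative f (at x) = frechet_derivative g (at x)" if "x \<in> S" for x
    using frechet_derivative_at[OF der[OF that]] .
  have "Ck_on n S (\<lambda>x. frechet_derivative g (at x) v)" for v
    by (rule Suc.IH[of "\<lambda>x. frechet_derivative f (at x) v"]) (use eq Suc.prems(2) in auto)
  then show ?case using der by (auto simp: differentiable_def)
qed

text \<open>Derivatives are unique on open sets, so an explicit formula \<open>f'\<close> may stand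
  in for \<open>frechet_derivative\<close>, in which \<open>Ck_on\<close> is phrased.\<close>

lemma Ck_on_SucI:
  assumes "open S" "\<And>x. x \<in> S \<Longrightarrow> (f has_derivative f' x) (at x)"
    and "\<And>v. Ck_on n S (\<lambda>x. f' x v)"
  shows "Ck_on (Suc n) S f"
proof -
  have "Ck_on n S (\<lambda>x. frechet_derivative f (at x) v)" for v
    by (rule Ck_on_cong[OF assms(1) _ assms(3)[of v]])
       (use frechet_derivative_at[OF assms(2)] in auto)
  then show ?thesis using assms(2) by (auto simp: differentiable_def)
qed

lemma Ck_on_Suc_has_derivative:
  "Ck_on (Suc n) S f \<Longrightarrow> x \<in> S \<Longrightarrow> (f has_derivative frechet_derivative f (at x)) (at x)"
  using frechet_derivative_works by auto

lemma Ck_on_Suc_derivative: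
  "Ck_on (Suc n) S f \<Longrightarrow> Ck_on n S (\<lambda>x. frechet_derivative f (at x) v)"
  unfolding Ck_on.simps by blast

lemma Ck_on_subset: "Ck_on n S f \<Longrightarrow> T \<subseteq> S \<Longrightarrow> Ck_on n T f"
  by (induction n arbitrary: f) (auto intro: continuous_on_subset)

lemma Ck_on_SucD: "Ck_on (Suc n) S f \<Longrightarrow> Ck_on n S f"
proof (induction n arbitrary: f)
  case 0
  then show ?case
    by (auto intro!: continuous_at_imp_continuous_on differentiable_imp_continuous_within)
next
  case (Suc n)
  then show ?case by auto
qed

lemma Ck_on_mono: "Ck_on n S f \<Longrightarrow> m \<le> n \<Longrightarrow> Ck_on m S f"
proof (induction n)
  case (Suc n)
  then show ?case using Ck_on_SucD le_Suc_eq by metis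
qed simp

lemma Ck_on_continuous_on: "Ck_on n S f \<Longrightarrow> continuous_on S f"
  using Ck_on_mono[of n S f 0] by simp

text \<open>This glues smoothness obtained in different charts, for instance along an orbit that
  leaves every single chart.\<close>

lemma Ck_on_local:
  assumes "\<And>x. x \<in> S \<Longrightarrow> \<exists>U. open U \<and> x \<in> U \<and> Ck_on n U f"
  shows "Ck_on n S f"
  using assms
proof (induction n arbitrary: f)
  case 0
  show ?case
    unfolding Ck_on.simps
  proof (rule continuous_at_imp_continuous_on, rule ballI)
    fix x assume "x \<in> S"
    from 0[OF this] obtain U where "open U" "x \<in> U" "continuous_on U f" by auto
    then show "isCont f x" by (simp add: continuous_on_eq_continuous_at)
  qed
next
  case (Suc n)
  have "f differentiable at x" if "x \<in> S" for x
    using Suc.prems[OF that] by auto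
  moreover have "Ck_on n S (\<lambda>x. frechet_derivative f (at x) v)" for v
  proof (rule Suc.IH)
    fix x assume "x \<in> S"
    from Suc.prems[OF this] obtain U where "open U" "x \<in> U" "Ck_on (Suc n) U f" by blast
    then show "\<exists>U. open U \<and> x \<in> U \<and> Ck_on n U (\<lambda>x. frechet_derivative f (at x) v)" by auto
  qed
  ultimately show ?case by simp
qed

lemma Ck_on_const: "open S \<Longrightarrow> Ck_on n S (\<lambda>x. c)"
  by (induction n arbitrary: c) (auto intro!: Ck_on_SucI[where f' = "\<lambda>x v. 0"])

lemma Ck_on_bounded_linear_compose:
  assumes "open S" "bounded_linear l" "Ck_on n S g"
  shows "Ck_on n S (\<lambda>x. l (g x))"
  using assms(3)
proof (induction n arbitrary: g)
  case 0
  then show ?case using assms(2) by (auto intro: bounded_linear.continuous_on)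
next
  case (Suc n)
  show ?case
  proof (rule Ck_on_SucI[OF \<open>open S\<close>])
    show "((\<lambda>x. l (g x)) has_derivative (\<lambda>v. l (frechet_derivative g (at x) v))) (at x)"
      if "x \<in> S" for x
      using Ck_on_Suc_has_derivative[OF Suc.prems that] assms(2)
      by (rule bounded_linear.has_derivative[rotated])
    show "Ck_on n S (\<lambda>x. l (frechet_derivative g (at x) v))" for v
      using Suc by auto
  qed
qed

lemma Ck_on_id: "open S \<Longrightarrow> Ck_on n S (\<lambda>x. x)"
  by (cases n) (auto intro!: Ck_on_SucI[where f' = "\<lambda>x v. v"] Ck_on_const)

lemma Ck_on_bounded_linear: "open S \<Longrightarrow> bounded_linear l \<Longrightarrow> Ck_on n S l"
  using Ck_on_bounded_linear_compose[OF _ _ Ck_on_id] by blast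

lemma Ck_on_add:
  assumes "open S" "Ck_on n S f" "Ck_on n S g"
  shows "Ck_on n S (\<lambda>x. f x + g x)"
  using assms(2,3)
proof (induction n arbitrary: f g)
  case 0
  then show ?case by (auto intro: continuous_intros)
next
  case (Suc n)
  show ?case
    by (rule Ck_on_SucI[OF \<open>open S\<close>,
          where f' = "\<lambda>x v. frechet_derivative f (at x) v + frechet_derivative g (at x) v"])
       (use Suc in \<open>auto intro!: has_derivative_add Ck_on_Suc_has_derivative\<close>)
qed

lemma Ck_on_sum:
  assumes "open S" "\<And>i. i \<in> I \<Longrightarrow> Ck_on n S (f i)"
  shows "Ck_on n S (\<lambda>x. \<Sum>i\<in>I. f i x)"
  using assms(2)
  by (induction I rule: infinite_finite_induct) (auto intro!: Ck_on_add Ck_on_const assms(1))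

lemma Ck_on_bilinear:
  assumes "open S" "bounded_bilinear pr" "Ck_on n S f" "Ck_on n S g"
  shows "Ck_on n S (\<lambda>x. pr (f x) (g x))"
  using assms(3,4)
proof (induction n arbitrary: f g)
  case 0
  then show ?case using assms(2) by (auto intro: bounded_bilinear.continuous_on)
next
  case (Suc n)
  show ?case
  proof (rule Ck_on_SucI[OF \<open>open S\<close>])
    show "((\<lambda>x. pr (f x) (g x)) has_derivative
           (\<lambda>v. pr (f x) (frechet_derivative g (at x) v)
              + pr (frechet_derivative f (at x) v) (g x))) (at x)"
      if "x \<in> S" for x
      using bounded_bilinear.FDERIV[OF assms(2)]
        Ck_on_Suc_has_derivative[OF Suc.prems(1) that]
        Ck_on_Suc_has_derivative[OF Suc.prems(2) that] by blast
    show "Ck_on n S (\<lambda>x. pr (f x) (frechet_derivative g (at x) v)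
              + pr (frechet_derivative f (at x) v) (g x))" for v
      using Suc.prems Ck_on_SucD[OF Suc.prems(1)] Ck_on_SucD[OF Suc.prems(2)]
      by (intro Ck_on_add[OF assms(1)] Suc.IH) auto
  qed
qed

lemmas Ck_on_scaleR = Ck_on_bilinear[OF _ bounded_bilinear_scaleR]
lemmas Ck_on_mult = Ck_on_bilinear[OF _ bounded_bilinear_mult]

lemma Ck_on_Pair:
  assumes "open S" "Ck_on n S f" "Ck_on n S g"
  shows "Ck_on n S (\<lambda>x. (f x, g x))"
proof -
  have 1: "bounded_linear (\<lambda>a. (a, 0))"
    by (rule bounded_linear_Pair[OF bounded_linear_ident bounded_linear_zero])
  have 2: "bounded_linear (\<lambda>b. (0, b))"
    by (rule bounded_linear_Pair[OF bounded_linear_zero bounded_linear_ident])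
  have "Ck_on n S (\<lambda>x. (f x, 0) + (0, g x))"
    using Ck_on_bounded_linear_compose[OF assms(1) 1 assms(2)]
      Ck_on_bounded_linear_compose[OF assms(1) 2 assms(3)]
    by (intro Ck_on_add[OF assms(1)])
  then show ?thesis by simp
qed

lemma Ck_on_snd: "open S \<Longrightarrow> Ck_on n S snd"
  by (rule Ck_on_bounded_linear[OF _ bounded_linear_snd])

lemma Ck_on_inverse:
  fixes f :: "'a::real_normed_vector \<Rightarrow> real"
  assumes "open S" "Ck_on n S f" "\<And>x. x \<in> S \<Longrightarrow> f x \<noteq> 0"
  shows "Ck_on n S (\<lambda>x. inverse (f x))"
  using assms(2)
proof (induction n)
  case 0
  then show ?case using assms(3) by (auto intro!: continuous_intros)
next
  case (Suc n)
  show ?case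
  proof (rule Ck_on_SucI[OF \<open>open S\<close>])
    show "((\<lambda>x. inverse (f x)) has_derivative
           (\<lambda>v. - (inverse (f x) * frechet_derivative f (at x) v * inverse (f x)))) (at x)"
      if "x \<in> S" for x
      by (rule Deriv.has_derivative_inverse)
         (use assms(3) that Ck_on_Suc_has_derivative[OF Suc.prems that] in auto)
    have "Ck_on n S (\<lambda>x. (-1) * (inverse (f x) * frechet_derivative f (at x) v * inverse (f x)))" for v
      using Suc.IH[OF Ck_on_SucD[OF Suc.prems]] Suc.prems
      by (intro Ck_on_mult[OF assms(1)] Ck_on_const[OF assms(1)]) auto
    then show "Ck_on n S (\<lambda>x. - (inverse (f x) * frechet_derivative f (at x) v * inverse (f x)))" for v
      by simp
  qed
qed

lemma linear_sum_Basis: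
  fixes f :: "'a::euclidean_space \<Rightarrow> 'b::real_vector"
  assumes "linear f"
  shows "f v = (\<Sum>b\<in>Basis. (v \<bullet> b) *\<^sub>R f b)"
proof -
  have "f v = f (\<Sum>b\<in>Basis. (v \<bullet> b) *\<^sub>R b)" by (simp add: euclidean_representation)
  then show ?thesis using assms by (simp add: linear_sum linear_cmul)
qed

lemma Ck_on_compose:
  fixes g :: "'a::real_normed_vector \<Rightarrow> 'b::euclidean_space"
  assumes "open S" "Ck_on n T f" "Ck_on n S g" "g ` S \<subseteq> T"
  shows "Ck_on n S (\<lambda>x. f (g x))"
  using assms(2,3)
proof (induction n arbitrary: f)
  case 0
  then show ?case using assms(4) by (auto intro: continuous_on_compose2)
next
  case (Suc n)
  let ?f' = "\<lambda>x. frechet_derivative f (at x)" and ?g' = "\<lambda>x. frechet_derivative g (at x)"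
  have d1: "(f has_derivative ?f' (g x)) (at (g x))" if "x \<in> S" for x
    using Ck_on_Suc_has_derivative[OF Suc.prems(1)] that assms(4) by blast
  have d2: "(g has_derivative ?g' x) (at x)" if "x \<in> S" for x
    using Ck_on_Suc_has_derivative[OF Suc.prems(2) that] .
  show ?case
  proof (rule Ck_on_SucI[OF \<open>open S\<close>])
    \<comment> \<open>\<open>Ck_on\<close> controls the derivative of \<open>f\<close> only in fixed
      directions, whereas the chain rule evaluates it at the varying vector \<open>?g' x v\<close>.
      Expanding that vector in the basis leaves fixed directions with smooth coefficients.\<close>
    show "((\<lambda>x. f (g x)) has_derivative
        (\<lambda>v. \<Sum>b\<in>Basis. (?g' x v \<bullet> b) *\<^sub>R ?f' (g x) b)) (at x)" if "x \<in> S" for x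
    proof -
      have "((\<lambda>x. f (g x)) has_derivative (\<lambda>v. ?f' (g x) (?g' x v))) (at x)"
        using has_derivative_compose[OF d2[OF that] d1[OF that]] .
      moreover have "?f' (g x) (?g' x v) = (\<Sum>b\<in>Basis. (?g' x v \<bullet> b) *\<^sub>R ?f' (g x) b)" for v
        by (rule linear_sum_Basis[OF has_derivative_linear[OF d1[OF that]]])
      ultimately show ?thesis by simp
    qed
    show "Ck_on n S (\<lambda>x. \<Sum>b\<in>Basis. (?g' x v \<bullet> b) *\<^sub>R ?f' (g x) b)" for v
    proof (intro Ck_on_sum Ck_on_scaleR assms(1))
      fix b :: 'b
      show "Ck_on n S (\<lambda>x. ?g' x v \<bullet> b)"
        by (rule Ck_on_bounded_linear_compose[OF assms(1) bounded_linear_inner_left])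
           (use Suc.prems(2) in auto)
      show "Ck_on n S (\<lambda>x. ?f' (g x) b)"
        by (rule Suc.IH) (use Suc.prems Ck_on_SucD in auto)
    qed
  qed
qed

section \<open>Differentiation under the integral sign\<close>

lemma Ck_on_frechet_derivative_blinfun:
  fixes f :: "'a::euclidean_space \<Rightarrow> 'b::real_normed_vector"
  assumes "Ck_on (Suc n) S f"
  shows "x \<in> S \<Longrightarrow> (f has_derivative blinfun_apply (Blinfun (frechet_derivative f (at x)))) (at x)"
    and "continuous_on S (\<lambda>x. Blinfun (frechet_derivative f (at x)))"
    and "x \<in> S \<Longrightarrow> blinfun_apply (Blinfun (frechet_derivative f (at x))) = frechet_derivative f (at x)"
proof -
  have eq: "blinfun_apply (Blinfun (frechet_derivative f (at x))) = frechet_derivative f (at x)"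
    if "x \<in> S" for x
    using has_derivative_bounded_linear[OF Ck_on_Suc_has_derivative[OF assms that]]
    by (rule bounded_linear_Blinfun_apply)
  then show "x \<in> S \<Longrightarrow> blinfun_apply (Blinfun (frechet_derivative f (at x))) = frechet_derivative f (at x)" .
  show "x \<in> S \<Longrightarrow> (f has_derivative blinfun_apply (Blinfun (frechet_derivative f (at x)))) (at x)"
    using Ck_on_Suc_has_derivative[OF assms] eq by simp
  \<comment> \<open>In finite dimension, continuity on each fixed vector gives continuity in
    operator norm. This converts the directional form of \<open>Ck_on\<close> into the form that
    \<open>leibniz_rule\<close> expects.\<close>
  have "continuous_on S (\<lambda>x. blinfun_apply (Blinfun (frechet_derivative f (at x))) i)" for i
    using Ck_on_continuous_on[of n S "\<lambda>x. frechet_derivative f (at x) i"] assms eq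
    by (auto cong: continuous_on_cong)
  then show "continuous_on S (\<lambda>x. Blinfun (frechet_derivative f (at x)))"
    by (intro continuous_on_blinfun_componentwise) auto
qed

lemma has_derivative_integral_parameter:
  fixes h :: "real \<times> 'a::euclidean_space \<Rightarrow> 'b::euclidean_space"
  assumes "open W" "Ck_on (Suc n) (UNIV \<times> W) h" "z \<in> W"
  shows "((\<lambda>z. integral {0..1} (\<lambda>s. h (s, z))) has_derivative
          (\<lambda>v. integral {0..1} (\<lambda>s. frechet_derivative h (at (s, z)) (0, v)))) (at z)"
proof -
  \<comment> \<open>\<open>leibniz_rule\<close> works on a convex parameter set; a ball is convex,
    and since it is open the derivative within it is the full derivative.\<close>
  obtain r where r: "r > 0" "ball z r \<subseteq> W"
    using assms(1,3) open_contains_ball by blast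
  let ?D = "\<lambda>p. Blinfun (frechet_derivative h (at p))"
  have inc: "bounded_linear (\<lambda>v::'a. (0::real, v))"
    by (rule bounded_linear_Pair[OF bounded_linear_zero bounded_linear_ident])
  let ?fx = "\<lambda>z s. ?D (s, z) o\<^sub>L Blinfun (\<lambda>v. (0, v))"
  have app: "blinfun_apply (?fx z s) v = frechet_derivative h (at (s, z)) (0, v)" if "z \<in> W" for z s v
    using that Ck_on_frechet_derivative_blinfun(3)[OF assms(2), of "(s, z)"]
    by (simp add: bounded_linear_Blinfun_apply[OF inc])
  have hd: "(h has_derivative frechet_derivative h (at (s, z))) (at (s, z))" if "z \<in> W" for s z
    using Ck_on_Suc_has_derivative[OF assms(2), of "(s, z)"] that by auto
  have contfx: "continuous_on (W \<times> UNIV) (\<lambda>(z, s). ?fx z s)"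
  proof -
    have "continuous_on (W \<times> UNIV) (\<lambda>p. ?D (snd p, fst p))"
      by (rule continuous_on_compose2[OF Ck_on_frechet_derivative_blinfun(2)[OF assms(2)]])
         (auto intro!: continuous_intros)
    then show ?thesis
      by (auto simp: case_prod_unfold intro!: continuous_intros)
  qed
  have conth: "continuous_on (UNIV \<times> W) h"
    using Ck_on_continuous_on[OF assms(2)] .
  have "((\<lambda>z. integral (cbox 0 1) (\<lambda>s. h (s, z))) has_derivative
          blinfun_apply (integral (cbox 0 1) (?fx z))) (at z within ball z r)"
  proof (rule leibniz_rule)
    fix x and t :: real assume x: "x \<in> ball z r"
    have "((\<lambda>x. h (t, x)) has_derivative (\<lambda>v. frechet_derivative h (at (t, x)) (0, v))) (at x)"
      by (rule has_derivative_compose[of "\<lambda>x. (t, x)" "\<lambda>v. (0, v)"])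
         (use hd x r in \<open>auto intro!: derivative_eq_intros\<close>)
    moreover have "blinfun_apply (?fx x t) = (\<lambda>v. frechet_derivative h (at (t, x)) (0, v))"
      using app x r by blast
    ultimately show "((\<lambda>x. h (t, x)) has_derivative blinfun_apply (?fx x t)) (at x within ball z r)"
      using has_derivative_at_withinI by metis
  next
    fix x assume x: "x \<in> ball z r"
    show "(\<lambda>s. h (s, x)) integrable_on cbox 0 1"
      by (rule integrable_continuous, rule continuous_on_compose2[OF conth])
         (use x r in \<open>auto intro!: continuous_intros\<close>)
  next
    show "continuous_on (ball z r \<times> cbox 0 1) (\<lambda>(x, t). ?fx x t)"
      by (rule continuous_on_subset[OF contfx]) (use r in auto)
  qed (use r in auto)
  moreover have "blinfun_apply (integral (cbox 0 1) (?fx z)) v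
      = integral {0..1} (\<lambda>s. frechet_derivative h (at (s, z)) (0, v))" for v
  proof -
    have "?fx z integrable_on cbox 0 1"
    proof (rule integrable_continuous)
      have "continuous_on (cbox 0 1) (\<lambda>s. (\<lambda>(z, s). ?fx z s) (z, s))"
        by (rule continuous_on_compose2[OF contfx]) (use assms(3) in \<open>auto intro!: continuous_intros\<close>)
      then show "continuous_on (cbox 0 1) (?fx z)" by simp
    qed
    then have "blinfun_apply (integral (cbox 0 1) (?fx z)) v
       = integral (cbox 0 1) (\<lambda>s. blinfun_apply (?fx z s) v)"
      by (rule blinfun_apply_integral)
    then show ?thesis using app[OF assms(3)] by (simp add: cbox_interval)
  qed
  then have "blinfun_apply (integral (cbox 0 1) (?fx z))
      = (\<lambda>v. integral {0..1} (\<lambda>s. frechet_derivative h (at (s, z)) (0, v)))" ..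
  ultimately show ?thesis
    using r at_within_open[of z "ball z r"] by (simp only: cbox_interval centre_in_ball open_ball)
qed

text \<open>Each directional derivative is again a parameter integral, with integrand
  \<open>frechet_derivative h (at p) (0, v)\<close>, so induction over arbitrary \<open>h\<close>
  applies.\<close>

lemma Ck_on_integral_parameter:
  fixes h :: "real \<times> 'a::euclidean_space \<Rightarrow> 'b::euclidean_space"
  assumes "open W" "Ck_on n (UNIV \<times> W) h"
  shows "Ck_on n W (\<lambda>z. integral {0..1} (\<lambda>s. h (s, z)))"
  using assms(2)
proof (induction n arbitrary: h)
  case 0
  have "continuous_on W (\<lambda>z. integral (cbox 0 1) (\<lambda>s. h (s, z)))"
  proof (rule integral_continuous_on_param)
    show "continuous_on (W \<times> cbox 0 1) (\<lambda>(z, s). h (s, z))"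
      unfolding case_prod_unfold
      by (rule continuous_on_compose2[OF 0[unfolded Ck_on.simps]])
         (auto intro!: continuous_intros)
  qed
  then show ?case by (simp add: cbox_interval)
next
  case (Suc n)
  show ?case
    by (rule Ck_on_SucI[OF \<open>open W\<close> has_derivative_integral_parameter[OF \<open>open W\<close> Suc.prems]])
       (use Suc.IH[of "\<lambda>p. frechet_derivative h (at p) (0, v)" for v] Suc.prems in auto)
qed

section \<open>Implicit functions of a strictly increasing variable\<close>

lemma isCont_implicit_monotone:
  fixes H :: "real \<times> 'a::t2_space \<Rightarrow> real" and A :: "real \<times> 'a \<Rightarrow> real"
  assumes "open W" "continuous_on (UNIV \<times> W) H" "\<And>u. u \<in> W \<Longrightarrow> strict_mono (\<lambda>a. H (a, u))"
    and sol: "\<And>t u. u \<in> W \<Longrightarrow> H (A (t, u), u) = t" and "u0 \<in> W"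
  shows "isCont A (t0, u0)"
proof -
  have contH: "((\<lambda>u. H (a, u)) \<longlongrightarrow> H (a, u0)) (nhds u0)" for a
  proof -
    have "continuous_on W (\<lambda>u. H (a, u))"
      by (rule continuous_on_compose2[OF assms(2)]) (auto intro!: continuous_intros)
    then have "((\<lambda>u. H (a, u)) \<longlongrightarrow> H (a, u0)) (at u0)"
      using assms(1,5) by (simp add: continuous_on_eq_continuous_at isCont_def)
    then show ?thesis using tendsto_at_iff_tendsto_nhds[of "\<lambda>u. H (a, u)" u0] by simp
  qed
  define a0 where "a0 = A (t0, u0)"
  have H0: "H (a0, u0) = t0" using sol[OF assms(5)] a0_def by simp
  have W: "\<forall>\<^sub>F p in nhds (t0, u0). snd p \<in> W"
    unfolding nhds_prod
    by (rule eventually_prodI[where P = "\<lambda>_. True" and Q = "\<lambda>u. u \<in> W", simplified, THEN eventually_mono])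
       (use assms(1,5) eventually_nhds in auto)
  have lim: "((\<lambda>p. H (a, snd p) - fst p) \<longlongrightarrow> H (a, u0) - t0) (nhds (t0, u0))" for a
    unfolding nhds_prod
    by (intro tendsto_diff filterlim_compose[OF contH filterlim_snd] filterlim_fst)
  \<comment> \<open>Monotonicity turns a comparison of \<open>A p\<close> with a fixed
    \<open>a\<close> into the sign of \<open>H (a, snd p) - fst p\<close>, which depends
    continuously on \<open>p\<close>. Continuity of \<open>A\<close> is thus a pure order
    argument.\<close>
  have less: "A p < a \<longleftrightarrow> H (a, snd p) - fst p > 0" "a < A p \<longleftrightarrow> H (a, snd p) - fst p < 0"
    if "snd p \<in> W" for p a
    using strict_mono_less[OF assms(3)[OF that], of "A p" a] strict_mono_less[OF assms(3)[OF that], of a "A p"]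
      sol[OF that, of "fst p"] by auto
  have less0: "H (a, u0) - t0 > 0 \<longleftrightarrow> a0 < a" "H (a, u0) - t0 < 0 \<longleftrightarrow> a < a0" for a
    using strict_mono_less[OF assms(3)[OF assms(5)], of a0 a] strict_mono_less[OF assms(3)[OF assms(5)], of a a0]
      H0 by auto
  have up: "\<forall>\<^sub>F p in nhds (t0, u0). A p < a" if "a0 < a" for a
    using eventually_conj[OF W order_tendstoD(1)[OF lim that[folded less0(1)]]]
    by (rule eventually_mono) (use less(1) in blast)
  have lo: "\<forall>\<^sub>F p in nhds (t0, u0). a < A p" if "a < a0" for a
    using eventually_conj[OF W order_tendstoD(2)[OF lim that[folded less0(2)]]]
    by (rule eventually_mono) (use less(2) in blast)
  have "(A \<longlongrightarrow> a0) (nhds (t0, u0))"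
    by (rule order_tendstoI) (use up lo in auto)
  then show ?thesis using tendsto_at_iff_tendsto_nhds[of A "(t0, u0)"] by (simp add: isCont_def a0_def)
qed

text \<open>A global implicit function theorem with one real unknown. The solution \<open>A\<close>
  is given and continuous by monotonicity, so \<open>(t, u) \<mapsto> (A (t, u), u)\<close> is
  differentiable as the inverse of \<open>(a, u) \<mapsto> (H (a, u), u)\<close>. The resulting
  formula expresses the derivative of \<open>A\<close> through \<open>A\<close> and derivatives of
  \<open>H\<close>, which drives the induction on the order of smoothness.\<close>

lemma
  fixes H :: "real \<times> 'a::euclidean_space \<Rightarrow> real" and A :: "real \<times> 'a \<Rightarrow> real"
  assumes "open W" and CkH: "\<And>n. Ck_on n (UNIV \<times> W) H"
    and pos: "\<And>a u. u \<in> W \<Longrightarrow> frechet_derivative H (at (a, u)) (1, 0) > 0"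
    and sol: "\<And>t u. u \<in> W \<Longrightarrow> H (A (t, u), u) = t"
  shows has_derivative_implicit_monotone: "u \<in> W \<Longrightarrow> (A has_derivative
      (\<lambda>(dt, du). (dt - frechet_derivative H (at (A (t, u), u)) (0, du))
        * inverse (frechet_derivative H (at (A (t, u), u)) (1, 0)))) (at (t, u))"
    and Ck_on_implicit_monotone: "Ck_on n (UNIV \<times> W) A"
proof -
  have open': "open ((UNIV :: real set) \<times> W)" by (simp add: open_Times assms(1))
  have hd: "(H has_derivative frechet_derivative H (at (a, u))) (at (a, u))" if "u \<in> W" for a u
    using Ck_on_Suc_has_derivative[OF CkH, of "(a, u)"] that by auto
  have mono: "strict_mono (\<lambda>a. H (a, u))" if "u \<in> W" for u
  proof (rule strict_monoI)
    fix a b :: real assume "a < b"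
    have "((\<lambda>a. H (a, u)) has_real_derivative frechet_derivative H (at (a, u)) (1, 0)) (at a)" for a
    proof -
      have "((\<lambda>a. H (a, u)) has_derivative (\<lambda>h. frechet_derivative H (at (a, u)) (h, 0))) (at a)"
        by (rule has_derivative_compose[of "\<lambda>a. (a, u)" "\<lambda>h. (h, 0)"])
           (use hd[OF that] in \<open>auto intro!: derivative_eq_intros\<close>)
      moreover have "(\<lambda>h. frechet_derivative H (at (a, u)) (h, 0)) = (*) (frechet_derivative H (at (a, u)) (1, 0))"
      proof
        fix h show "frechet_derivative H (at (a, u)) (h, 0) = frechet_derivative H (at (a, u)) (1, 0) * h"
          using linear_cmul[OF has_derivative_linear[OF hd[OF that]], of a h "(1, 0)"] by simp
      qed
      ultimately show ?thesis by (simp only: has_field_derivative_def)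
    qed
    then show "H (a, u) < H (b, u)"
      using DERIV_pos_imp_increasing[OF \<open>a < b\<close>, of "\<lambda>a. H (a, u)"] pos[OF that] by blast
  qed
  have cont: "isCont A (t, u)" if "u \<in> W" for t u
    by (rule isCont_implicit_monotone[OF assms(1) Ck_on_continuous_on[OF CkH] mono sol that])
  show der: "(A has_derivative
      (\<lambda>(dt, du). (dt - frechet_derivative H (at (A (t, u), u)) (0, du))
        * inverse (frechet_derivative H (at (A (t, u), u)) (1, 0)))) (at (t, u))" if "u \<in> W" for t u
  proof -
    let ?H' = "frechet_derivative H (at (A (t, u), u))"
    \<comment> \<open>The derivative of \<open>(a, u) \<mapsto> (H (a, u), u)\<close> is block
      triangular with positive corner \<open>?H' (1, 0)\<close>; this is its inverse.\<close>
    let ?g' = "\<lambda>(dt, du). ((dt - ?H' (0, du)) * inverse (?H' (1, 0)), du)"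
    note bl = has_derivative_bounded_linear[OF hd[OF that, of "A (t, u)"]]
    have p: "?H' (1, 0) > 0" using pos[OF that] .
    have split: "?H' (da, du) = da * ?H' (1, 0) + ?H' (0, du)" for da du
      using linear_add[OF bounded_linear.linear[OF bl], of "da *\<^sub>R (1, 0)" "(0, du)"]
        linear_cmul[OF bounded_linear.linear[OF bl], of da "(1, 0)"] by simp
    have blg: "bounded_linear ?g'"
      unfolding case_prod_unfold
      by (intro bounded_linear_Pair bounded_linear_mult_const[THEN bounded_linear_compose] bounded_linear_sub
          bounded_linear_fst bounded_linear_snd
          bounded_linear_compose[OF bl, of "\<lambda>x. (0, snd x)"] bounded_linear_zero bounded_linear_ident)
    have "((\<lambda>(t, u). (A (t, u), u)) has_derivative ?g') (at (t, u))"
    proof (rule has_derivative_inverse_basic[where f = "\<lambda>(a, u). (H (a, u), u)" and T = "UNIV \<times> W"])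
      show "((\<lambda>(a, u). (H (a, u), u)) has_derivative (\<lambda>v. (?H' v, snd v)))
          (at ((\<lambda>(t, u). (A (t, u), u)) (t, u)))"
        using hd[OF that, of "A (t, u)"] unfolding case_prod_unfold
        by (auto intro!: derivative_eq_intros)
      show "?g' \<circ> (\<lambda>v. (?H' v, snd v)) = id"
      proof
        fix v :: "real \<times> 'a"
        obtain da du where v: "v = (da, du)" by force
        have "?H' (da, du) - ?H' (0, du) = da * ?H' (1, 0)" using split[of da du] by linarith
        then show "(?g' \<circ> (\<lambda>v. (?H' v, snd v))) v = id v" using p by (simp add: v)
      qed
      show "isCont (\<lambda>(t, u). (A (t, u), u)) (t, u)"
        using cont[OF that] unfolding case_prod_unfold
        by (auto intro!: continuous_intros)
    qed (use blg open' that sol in auto)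
    from has_derivative_fst[OF this]
    show ?thesis by (simp add: case_prod_unfold)
  qed
  show "Ck_on n (UNIV \<times> W) A"
  proof (induction n)
    case 0
    show ?case
      using cont by (auto intro!: continuous_at_imp_continuous_on)
  next
    case (Suc n)
    let ?A' = "\<lambda>p v. (fst v - frechet_derivative H (at (A p, snd p)) (0, snd v))
        * inverse (frechet_derivative H (at (A p, snd p)) (1, 0))"
    show ?case
    proof (rule Ck_on_SucI[OF open', where f' = ?A'])
      show "(A has_derivative ?A' p) (at p)" if "p \<in> UNIV \<times> W" for p
        using der[of "snd p" "fst p"] that by (auto simp: case_prod_unfold)
      have in': "Ck_on n (UNIV \<times> W) (\<lambda>p. (A p, snd p))"
        by (intro Ck_on_Pair open' Suc.IH Ck_on_snd)
      have c: "Ck_on n (UNIV \<times> W) (\<lambda>p. frechet_derivative H (at (A p, snd p)) w)" for w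
        by (rule Ck_on_compose[OF open' _ in', where f = "\<lambda>q. frechet_derivative H (at q) w" and T = "UNIV \<times> W"])
           (use Ck_on_Suc_derivative[OF CkH] in auto)
      have c': "Ck_on n (UNIV \<times> W) (\<lambda>p. fst v - frechet_derivative H (at (A p, snd p)) (0, snd v))" for v
        using Ck_on_add[OF open' Ck_on_const[OF open', of n "fst v"]
            Ck_on_bounded_linear_compose[OF open' bounded_linear_minus[OF bounded_linear_ident] c]] by simp
      show "Ck_on n (UNIV \<times> W) (\<lambda>p. ?A' p v)" for v
        by (intro Ck_on_mult open' c' Ck_on_inverse c) (use pos in \<open>auto simp: less_imp_neq[symmetric]\<close>)
    qed
  qed
qed

section \<open>Linear recurrences\<close>

text \<open>Polynomials act on sequences with the indeterminate as shift, so that a factorization of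
  the polynomial becomes an iteration of recurrences (\<open>shift_act_mult\<close>). The index set
  is the integers because both directions of time are studied.\<close>

definition shift_act :: "'a::comm_ring_1 poly \<Rightarrow> (int \<Rightarrow> 'a) \<Rightarrow> int \<Rightarrow> 'a" where
  "shift_act p u n = (\<Sum>i\<le>degree p. coeff p i * u (n + int i))"

lemma shift_act_altdef:
  assumes "degree p \<le> N"
  shows "shift_act p u n = (\<Sum>i\<le>N. coeff p i * u (n + int i))"
  unfolding shift_act_def
  by (rule sum.mono_neutral_left) (use assms in \<open>auto intro!: le_degree\<close>)

lemma shift_act_0 [simp]: "shift_act 0 u = (\<lambda>n. 0)"
  by (simp add: shift_act_def fun_eq_iff)

lemma shift_act_pCons: "shift_act (pCons a p) u n = a * u n + shift_act p u (n + 1)"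
proof -
  have "shift_act (pCons a p) u n = (\<Sum>i\<le>Suc (degree p). coeff (pCons a p) i * u (n + int i))"
    by (rule shift_act_altdef) (rule degree_pCons_le)
  then show ?thesis
    by (subst (asm) sum.atMost_Suc_shift) (simp add: shift_act_def algebra_simps)
qed

lemma shift_act_add: "shift_act (p + q) u n = shift_act p u n + shift_act q u n"
proof -
  define N where "N = max (degree p) (degree q)"
  have "degree (p + q) \<le> N" by (simp add: N_def degree_add_le_max)
  then show ?thesis
    by (simp add: shift_act_altdef[of _ N] N_def sum.distrib[symmetric] algebra_simps)
qed

lemma shift_act_smult: "shift_act (smult a p) u n = a * shift_act p u n"
proof -
  have "shift_act (smult a p) u n = (\<Sum>i\<le>degree p. coeff (smult a p) i * u (n + int i))"
    by (rule shift_act_altdef) (rule degree_smult_le)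
  then show ?thesis by (simp add: shift_act_def sum_distrib_left algebra_simps)
qed

lemma shift_act_zero [simp]: "shift_act p (\<lambda>n. 0) = (\<lambda>n. 0)"
  by (simp add: shift_act_def fun_eq_iff)

lemma shift_act_mult: "shift_act (p * q) u = shift_act p (shift_act q u)"
proof (induction p)
  case 0
  then show ?case by simp
next
  case (pCons a p)
  have "shift_act (pCons a p * q) u n = shift_act (pCons a p) (shift_act q u) n" for n
    using pCons.IH
    by (simp add: mult_pCons_left shift_act_add shift_act_smult shift_act_pCons)
  then show ?case ..
qed

section \<open>Factorization and coprimality of complex polynomials\<close>

lemma complex_poly_degree_induct [consumes 1, case_names const factor]:
  fixes p :: "complex poly"
  assumes "p \<noteq> 0"
    and "\<And>c. c \<noteq> 0 \<Longrightarrow> P [:c:]"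
    and "\<And>z q. q \<noteq> 0 \<Longrightarrow> P q \<Longrightarrow> P ([:-z, 1:] * q)"
  shows "P p"
  using assms(1)
proof (induction "degree p" arbitrary: p)
  case 0
  then obtain c where "p = [:c:]" using degree_eq_zeroE by metis
  then show ?case using assms(2) 0 by auto
next
  case (Suc n)
  then have "\<not> constant (poly p)" by (simp add: constant_degree)
  then obtain z where "poly p z = 0" using fundamental_theorem_of_algebra by blast
  then obtain q where q: "p = [:-z, 1:] * q" using poly_eq_0_iff_dvd by (metis dvd_def)
  then have "q \<noteq> 0" using Suc.prems by auto
  then have "degree p = Suc (degree q)" unfolding q by (subst degree_mult_eq) auto
  then have "P q" using Suc \<open>q \<noteq> 0\<close> by auto
  then show ?case unfolding q using assms(3) \<open>q \<noteq> 0\<close> by blast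
qed

lemma complex_poly_split_roots:
  fixes p :: "complex poly"
  assumes "p \<noteq> 0"
  obtains q r where "p = q * r" "\<And>z. poly q z = 0 \<Longrightarrow> Q z" "\<And>z. poly r z = 0 \<Longrightarrow> \<not> Q z"
proof -
  have "\<exists>q r. p = q * r \<and> (\<forall>z. poly q z = 0 \<longrightarrow> Q z) \<and> (\<forall>z. poly r z = 0 \<longrightarrow> \<not> Q z)"
    using assms
  proof (induction p rule: complex_poly_degree_induct)
    case (const c)
    then show ?case by (intro exI[of _ "[:c:]"] exI[of _ 1]) auto
  next
    case (factor z s)
    then obtain q r where qr: "s = q * r" "\<forall>z. poly q z = 0 \<longrightarrow> Q z" "\<forall>z. poly r z = 0 \<longrightarrow> \<not> Q z"
      by blast
    show ?case
    proof (cases "Q z")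
      case True
      then show ?thesis using qr
        by (intro exI[of _ "[:-z, 1:] * q"] exI[of _ r] conjI) (simp_all only: mult.assoc, auto)
    next
      case False
      then show ?thesis using qr
        by (intro exI[of _ q] exI[of _ "[:-z, 1:] * r"] conjI)
           (simp_all only: mult.assoc mult.left_commute, auto)
    qed
  qed
  then show ?thesis using that by blast
qed

text \<open>Absence of common roots is coprimality. For a linear factor with root \<open>z\<close>
  the identity comes from division with remainder, \<open>q\<close> being congruent to the nonzero
  constant \<open>poly q z\<close>; for a product the identities of the factors are
  multiplied.\<close>

lemma complex_poly_bezout:
  fixes p q :: "complex poly"
  assumes "p \<noteq> 0" "\<And>z. poly p z = 0 \<Longrightarrow> poly q z = 0 \<Longrightarrow> False"
  obtains a b where "a * p + b * q = 1"
proof -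
  have "\<exists>a b. a * p + b * q = 1"
    using assms
  proof (induction p rule: complex_poly_degree_induct)
    case (const c)
    then show ?case by (intro exI[of _ "[:inverse c:]"] exI[of _ 0]) (simp add: one_pCons)
  next
    case (factor z s)
    then obtain a b where ab: "a * s + b * q = 1" by fastforce
    have qz: "poly q z \<noteq> 0" using factor.prems[of z] by auto
    obtain t where t: "q - [:poly q z:] = [:-z, 1:] * t"
      using poly_eq_0_iff_dvd[of "q - [:poly q z:]" z] by (auto elim: dvdE)
    define c where "c = [:inverse (poly q z):]"
    define d where "d = [:-z, 1:]"
    define e where "e = - c * t"
    have "e * d + c * q = c * (q - d * t)" unfolding e_def by (simp add: algebra_simps)
    also have "q - d * t = [:poly q z:]" using t unfolding d_def by (simp add: algebra_simps)
    also have "c * [:poly q z:] = 1" using qz by (simp add: c_def one_pCons)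
    finally have 1: "e * d + c * q = 1" .
    have "(a * e) * (d * s) + (b * e * d + (a * s + b * q) * c) * q = (a * s + b * q) * (e * d + c * q)"
      by (simp add: algebra_simps)
    then have "(a * e) * (d * s) + (b * e * d + (a * s + b * q) * c) * q = 1" unfolding ab 1 by simp
    then show ?case unfolding d_def by blast
  qed
  then show ?thesis using that by blast
qed

text \<open>Each linear factor is a first-order recurrence
  \<open>w (n + 1) = z * w n + error\<close>, and an error of order \<open>r ^ n\<close> with
  \<open>cmod z < r\<close> forces the same order on \<open>w\<close>. The right-hand side is only
  assumed to be of order \<open>r ^ n\<close>, not zero, because peeling off one factor leaves an
  inhomogeneous equation for the others.\<close>

lemma recurrence_growth_forward:
  fixes p :: "complex poly"
  assumes "p \<noteq> 0" "0 < r" "\<And>z. poly p z = 0 \<Longrightarrow> cmod z < r"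
    and "\<exists>C. \<forall>n::nat. cmod (shift_act p u (int n)) \<le> C * r ^ n"
  shows "\<exists>C. \<forall>n::nat. cmod (u (int n)) \<le> C * r ^ n"
  using assms(1,3,4)
proof (induction p arbitrary: u rule: complex_poly_degree_induct)
  case (const c)
  then obtain C where C: "\<And>n::nat. cmod (shift_act [:c:] u (int n)) \<le> C * r ^ n" by blast
  have "cmod (u (int n)) \<le> (C / cmod c) * r ^ n" for n
    using C[of n] const(1)
    by (simp add: shift_act_pCons norm_mult pos_le_divide_eq mult.commute)
  then show ?case by blast
next
  case (factor z q)
  define w where "w = shift_act q u"
  from factor.prems(2) obtain C where C: "\<And>n::nat. cmod (shift_act [:-z, 1:] w (int n)) \<le> C * r ^ n"
    unfolding w_def shift_act_mult by blast
  have zr: "cmod z < r" using factor.prems(1)[of z] by simp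
  \<comment> \<open>The second entry makes \<open>cmod z * D + C \<le> r * D\<close>, which closes
    the induction; the first entry handles \<open>n = 0\<close>.\<close>
  define D where "D = max (cmod (w 0)) (C / (r - cmod z))"
  have D: "C \<le> (r - cmod z) * D"
  proof -
    have "(r - cmod z) * (C / (r - cmod z)) \<le> (r - cmod z) * D"
      by (rule mult_left_mono) (use zr in \<open>auto simp: D_def\<close>)
    then show ?thesis using zr by simp
  qed
  have "cmod (w (int n)) \<le> D * r ^ n" for n :: nat
  proof (induction n)
    case 0
    then show ?case by (simp add: D_def)
  next
    case (Suc n)
    have "w (int (Suc n)) = z * w (int n) + shift_act [:-z, 1:] w (int n)"
      by (simp add: shift_act_pCons algebra_simps)
    then have "cmod (w (int (Suc n))) \<le> cmod z * cmod (w (int n)) + C * r ^ n"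
      using norm_triangle_ineq[of "z * w (int n)" "shift_act [:-z, 1:] w (int n)"] C[of n]
      by (simp add: norm_mult)
    also have "\<dots> \<le> cmod z * (D * r ^ n) + (r - cmod z) * D * r ^ n"
      using Suc.IH D assms(2) by (intro add_mono mult_left_mono mult_right_mono) auto
    also have "\<dots> = D * r ^ Suc n" by (simp add: algebra_simps)
    finally show ?case .
  qed
  then have "\<exists>C. \<forall>n::nat. cmod (shift_act q u (int n)) \<le> C * r ^ n" unfolding w_def by blast
  then show ?case using factor.IH factor.prems(1) by auto
qed

text \<open>Towards negative indices the first-order recurrence is solved for the earlier term,
  which divides by the root \<open>z\<close>. Roots outside the circle of radius \<open>r\<close>
  therefore play the part that roots inside it play forwards.\<close>

lemma recurrence_growth_backward:
  fixes p :: "complex poly"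
  assumes "p \<noteq> 0" "0 < r" "\<And>z. poly p z = 0 \<Longrightarrow> cmod z > r"
    and "\<exists>C. \<forall>n::nat. cmod (shift_act p u (- int n)) \<le> C * inverse r ^ n"
  shows "\<exists>C. \<forall>n::nat. cmod (u (- int n)) \<le> C * inverse r ^ n"
  using assms(1,3,4)
proof (induction p arbitrary: u rule: complex_poly_degree_induct)
  case (const c)
  then obtain C where C: "\<And>n::nat. cmod (shift_act [:c:] u (- int n)) \<le> C * inverse r ^ n" by blast
  have "cmod (u (- int n)) \<le> (C / cmod c) * inverse r ^ n" for n
    using C[of n] const(1)
    by (simp add: shift_act_pCons norm_mult pos_le_divide_eq mult.commute)
  then show ?case by blast
next
  case (factor z q)
  define w where "w = shift_act q u"
  from factor.prems(2) obtain C
    where C: "\<And>n::nat. cmod (shift_act [:-z, 1:] w (- int n)) \<le> C * inverse r ^ n"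
    unfolding w_def shift_act_mult by blast
  have zr: "cmod z > r" using factor.prems(1)[of z] by simp
  then have z0: "cmod z > 0" using assms(2) by linarith
  define D where "D = max (cmod (w 0)) (C / (cmod z - r))"
  have D: "C \<le> (cmod z - r) * D"
  proof -
    have "(cmod z - r) * (C / (cmod z - r)) \<le> (cmod z - r) * D"
      by (rule mult_left_mono) (use zr in \<open>auto simp: D_def\<close>)
    then show ?thesis using zr by simp
  qed
  have "cmod (w (- int n)) \<le> D * inverse r ^ n" for n :: nat
  proof (induction n)
    case 0
    then show ?case by (simp add: D_def)
  next
    case (Suc n)
    have "z * w (- int (Suc n)) = w (- int n) - shift_act [:-z, 1:] w (- int (Suc n))"
      by (simp add: shift_act_pCons algebra_simps)
    then have "cmod z * cmod (w (- int (Suc n))) \<le> cmod (w (- int n)) + C * inverse r ^ Suc n"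
      using norm_triangle_ineq4[of "w (- int n)" "shift_act [:-z, 1:] w (- int (Suc n))"] C[of "Suc n"]
      by (metis (no_types, lifting) add_left_mono norm_mult order_trans)
    also have "\<dots> \<le> D * inverse r ^ n + (cmod z - r) * D * inverse r ^ Suc n"
      using Suc.IH D assms(2) by (intro add_mono mult_right_mono) auto
    also have "\<dots> = cmod z * (D * inverse r ^ Suc n)"
      using assms(2) by (simp add: field_simps)
    finally show ?case using z0 mult_le_cancel_left_pos by blast
  qed
  then have "\<exists>C. \<forall>n::nat. cmod (shift_act q u (- int n)) \<le> C * inverse r ^ n" unfolding w_def by blast
  then show ?case using factor.IH factor.prems(1) by auto
qed

section \<open>One-parameter groups of linear maps\<close>

text \<open>A finite-dimensional uniform boundedness principle: the constants of an orthonormal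
  basis of \<open>V\<close> are added up, since every coordinate of \<open>v\<close> is at most
  \<open>norm v\<close>.\<close>

lemma subspace_uniform_bound:
  fixes L :: "'t \<Rightarrow> 'e::euclidean_space \<Rightarrow> 'e"
  assumes "subspace V" "\<And>t. linear (L t)" "\<And>t. t \<in> S \<Longrightarrow> 0 \<le> w t"
    and "\<And>v. v \<in> V \<Longrightarrow> \<exists>C. \<forall>t\<in>S. norm (L t v) \<le> C * w t"
  shows "\<exists>C>0. \<forall>v\<in>V. \<forall>t\<in>S. norm (L t v) \<le> C * w t * norm v"
proof -
  obtain B where B: "B \<subseteq> V" "pairwise orthogonal B" "\<And>x. x \<in> B \<Longrightarrow> norm x = 1"
    "independent B" "span B = V"
    using orthonormal_basis_subspace[OF assms(1)] by metis
  have fin: "finite B" using B(4) independent_imp_finite by blast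
  from assms(4) B(1) have "\<forall>b\<in>B. \<exists>C. \<forall>t\<in>S. norm (L t b) \<le> C * w t" by blast
  then obtain K where K: "\<And>b t. b \<in> B \<Longrightarrow> t \<in> S \<Longrightarrow> norm (L t b) \<le> K b * w t" by metis
  define C where "C = 1 + (\<Sum>b\<in>B. \<bar>K b\<bar>)"
  have "norm (L t v) \<le> C * w t * norm v" if "v \<in> V" "t \<in> S" for v t
  proof -
    have "v = (\<Sum>b\<in>B. (b \<bullet> v) *\<^sub>R b)"
      using orthonormal_basis_expand[of B v] B that fin by (auto simp: inner_commute)
    then have "L t v = (\<Sum>b\<in>B. (b \<bullet> v) *\<^sub>R L t b)"
      using linear_sum[OF assms(2)] linear_cmul[OF assms(2)] by (metis (no_types, lifting) sum.cong)
    then have "norm (L t v) \<le> (\<Sum>b\<in>B. norm ((b \<bullet> v) *\<^sub>R L t b))"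
      by (simp only: norm_sum)
    also have "\<dots> \<le> (\<Sum>b\<in>B. norm v * (\<bar>K b\<bar> * w t))"
    proof (rule sum_mono)
      fix b assume b: "b \<in> B"
      have "\<bar>b \<bullet> v\<bar> \<le> norm v" using Cauchy_Schwarz_ineq2[of b v] B(3)[OF b] by simp
      moreover have "norm (L t b) \<le> \<bar>K b\<bar> * w t"
        using K[OF b that(2)] assms(3)[OF that(2)] by (meson abs_ge_self mult_right_mono order_trans)
      ultimately show "norm ((b \<bullet> v) *\<^sub>R L t b) \<le> norm v * (\<bar>K b\<bar> * w t)"
        by (simp add: mult_mono)
    qed
    also have "\<dots> = (\<Sum>b\<in>B. \<bar>K b\<bar>) * w t * norm v" by (simp add: sum_distrib_right sum_distrib_left mult_ac)
    also have "\<dots> \<le> C * w t * norm v"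
      unfolding C_def using assms(3)[OF that(2)] by (intro mult_right_mono) auto
    finally show ?thesis .
  qed
  moreover have "C > 0" unfolding C_def by (smt (verit) sum_nonneg abs_ge_zero)
  ultimately show ?thesis by blast
qed

text \<open>Local boundedness of each orbit takes the place of continuity in time; it is what the
  passage from integer to real times in \<open>discrete_growth\<close> uses.\<close>

locale linear_flow =
  fixes L :: "real \<Rightarrow> 'e::euclidean_space \<Rightarrow> 'e"
  assumes linear: "linear (L t)"
    and zero [simp]: "L 0 v = v"
    and add: "L (s + t) v = L s (L t v)"
    and bounded: "\<exists>K. \<forall>t. \<bar>t\<bar> \<le> 1 \<longrightarrow> norm (L t v) \<le> K"
begin

text \<open>\<open>Stable\<close>, \<open>Unstable\<close> and \<open>Center\<close> are the real
  points of the sums of generalized eigenspaces of \<open>L 1\<close> for eigenvalues inside,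
  outside and on the unit circle. Describing them by growth makes invariance and time reversal easy.
  The rate may depend on the vector; it is made uniform in \<open>Stable_uniform\<close>.\<close>

definition Stable :: "'e set" where
  "Stable = {v. \<exists>\<rho><0. \<exists>C. \<forall>t\<ge>0. norm (L t v) \<le> C * exp (\<rho> * t)}"

definition Unstable :: "'e set" where
  "Unstable = {v. \<exists>\<rho>>0. \<exists>C. \<forall>t\<le>0. norm (L t v) \<le> C * exp (\<rho> * t)}"

definition Center :: "'e set" where
  "Center = {v. \<forall>\<epsilon>>0. \<exists>C. \<forall>t. norm (L t v) \<le> C * exp (\<epsilon> * \<bar>t\<bar>)}"

lemma minus_cancel [simp]: "L t (L (- t) v) = v" "L (- t) (L t v) = v"
  using add[of t "- t"] add[of "- t" t] by simp_all

lemma L_0 [simp]: "L t 0 = 0" using linear_0[OF linear] .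

lemma L_add: "L t (v + w) = L t v + L t w" using linear_add[OF linear] .

lemma L_scale: "L t (c *\<^sub>R v) = c *\<^sub>R L t v" using linear_cmul[OF linear] .

lemma bounded_uniform: obtains K where "K > 0" "\<And>t v. \<bar>t\<bar> \<le> 1 \<Longrightarrow> norm (L t v) \<le> K * norm v"
proof -
  have "\<exists>C>0. \<forall>v\<in>UNIV. \<forall>t\<in>{t. \<bar>t\<bar> \<le> 1}. norm (L t v) \<le> C * 1 * norm v"
    by (rule subspace_uniform_bound) (use bounded linear in auto)
  then show ?thesis using that by auto
qed

text \<open>Time reversal halves the work: facts about \<open>Unstable\<close> are those about
  \<open>Stable\<close> for the reversed flow.\<close>

lemma Stable_minus: "linear_flow.Stable (\<lambda>t. L (- t)) = Unstable"
  and Unstable_minus: "linear_flow.Unstable (\<lambda>t. L (- t)) = Stable"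
  and Center_minus: "linear_flow.Center (\<lambda>t. L (- t)) = Center"
  and linear_flow_minus: "linear_flow (\<lambda>t. L (- t))"
proof -
  show lf: "linear_flow (\<lambda>t. L (- t))"
  proof (rule linear_flow.intro)
    show "linear (L (- t))" for t by (rule linear)
    show "L (- 0) v = v" for v by simp
    show "L (- (s + t)) v = L (- s) (L (- t) v)" for s t v using add[of "- s" "- t" v] by simp
    show "\<exists>K. \<forall>t. \<bar>t\<bar> \<le> 1 \<longrightarrow> norm (L (- t) v) \<le> K" for v
      using bounded[of v] by (metis abs_minus_cancel)
  qed
  show "linear_flow.Stable (\<lambda>t. L (- t)) = Unstable"
  proof -
    have "(\<exists>\<rho><0. \<exists>C. \<forall>t\<ge>0. norm (L (- t) v) \<le> C * exp (\<rho> * t)) \<longleftrightarrow>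
        (\<exists>\<rho>>0. \<exists>C. \<forall>t\<le>0. norm (L t v) \<le> C * exp (\<rho> * t))" for v
    proof (safe, goal_cases)
      case (1 \<rho> C)
      then have "\<forall>t\<le>0. norm (L t v) \<le> C * exp (- \<rho> * t)"
        by (metis minus_minus minus_mult_commute neg_0_le_iff_le)
      then show ?case using 1 by (intro exI[of _ "- \<rho>"]) auto
    next
      case (2 \<rho> C)
      then have "\<forall>t\<ge>0. norm (L (- t) v) \<le> C * exp (- \<rho> * t)"
        by (metis minus_mult_commute neg_le_0_iff_le)
      then show ?case using 2 by (intro exI[of _ "- \<rho>"]) auto
    qed
    then show ?thesis unfolding linear_flow.Stable_def[OF lf] Unstable_def by blast
  qed
  show "linear_flow.Unstable (\<lambda>t. L (- t)) = Stable"
  proof -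
    have "(\<exists>\<rho>>0. \<exists>C. \<forall>t\<le>0. norm (L (- t) v) \<le> C * exp (\<rho> * t)) \<longleftrightarrow>
        (\<exists>\<rho><0. \<exists>C. \<forall>t\<ge>0. norm (L t v) \<le> C * exp (\<rho> * t))" for v
    proof (safe, goal_cases)
      case (1 \<rho> C)
      then have "\<forall>t\<ge>0. norm (L t v) \<le> C * exp (- \<rho> * t)"
        by (metis minus_minus minus_mult_commute neg_le_0_iff_le)
      then show ?case using 1 by (intro exI[of _ "- \<rho>"]) auto
    next
      case (2 \<rho> C)
      then have "\<forall>t\<le>0. norm (L (- t) v) \<le> C * exp (- \<rho> * t)"
        by (metis minus_mult_commute neg_0_le_iff_le)
      then show ?case using 2 by (intro exI[of _ "- \<rho>"]) auto
    qed
    then show ?thesis unfolding linear_flow.Unstable_def[OF lf] Stable_def by blast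
  qed
  have 3: "(\<forall>t. norm (L (- t) v) \<le> C * exp (\<rho> * \<bar>t\<bar>)) \<longleftrightarrow> (\<forall>t. norm (L t v) \<le> C * exp (\<rho> * \<bar>t\<bar>))" for v C \<rho>
    by (metis minus_minus abs_minus_cancel)
  show "linear_flow.Center (\<lambda>t. L (- t)) = Center"
    unfolding linear_flow.Center_def[OF lf] Center_def 3 ..
qed

lemma subspace_Stable: "subspace Stable"
proof (rule subspaceI)
  show "0 \<in> Stable" unfolding Stable_def
    by (rule CollectI, intro exI[of _ "-1 :: real"] conjI exI[of _ "0 :: real"]) auto
next
  fix v w assume "v \<in> Stable" "w \<in> Stable"
  then obtain \<rho> \<rho>' C C' where *: "\<rho> < 0" "\<rho>' < 0" "\<And>t. t \<ge> 0 \<Longrightarrow> norm (L t v) \<le> C * exp (\<rho> * t)"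
    "\<And>t. t \<ge> 0 \<Longrightarrow> norm (L t w) \<le> C' * exp (\<rho>' * t)" unfolding Stable_def by blast
  have "norm (L t (v + w)) \<le> (\<bar>C\<bar> + \<bar>C'\<bar>) * exp (max \<rho> \<rho>' * t)" if "t \<ge> 0" for t
  proof -
    have "exp (\<rho> * t) \<le> exp (max \<rho> \<rho>' * t)" "exp (\<rho>' * t) \<le> exp (max \<rho> \<rho>' * t)"
      using that by (auto intro!: mult_right_mono)
    then have "C * exp (\<rho> * t) \<le> \<bar>C\<bar> * exp (max \<rho> \<rho>' * t)" "C' * exp (\<rho>' * t) \<le> \<bar>C'\<bar> * exp (max \<rho> \<rho>' * t)"
      by (auto intro!: mult_mono)
    then show ?thesis
      using *(3,4)[OF that] norm_triangle_ineq[of "L t v" "L t w"]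
      by (simp add: L_add distrib_right)
  qed
  moreover have "max \<rho> \<rho>' < 0" using *(1,2) by simp
  ultimately show "v + w \<in> Stable" unfolding Stable_def by blast
next
  fix c v assume "v \<in> Stable"
  then obtain \<rho> C where *: "\<rho> < 0" "\<And>t. t \<ge> 0 \<Longrightarrow> norm (L t v) \<le> C * exp (\<rho> * t)"
    unfolding Stable_def by blast
  have "norm (L t (c *\<^sub>R v)) \<le> (\<bar>c\<bar> * C) * exp (\<rho> * t)" if "t \<ge> 0" for t
    using *(2)[OF that] by (simp add: L_scale mult.assoc mult_left_mono)
  then show "c *\<^sub>R v \<in> Stable" unfolding Stable_def using *(1) by blast
qed

lemma subspace_Unstable: "subspace Unstable"
  using linear_flow.subspace_Stable[OF linear_flow_minus] unfolding Stable_minus .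

lemma subspace_Center: "subspace Center"
proof (rule subspaceI)
  show "0 \<in> Center" unfolding Center_def by (auto intro!: exI[of _ 0])
next
  fix v w assume vw: "v \<in> Center" "w \<in> Center"
  show "v + w \<in> Center" unfolding Center_def
  proof (clarify)
    fix \<epsilon> :: real assume "\<epsilon> > 0"
    then obtain C C' where *: "\<And>t. norm (L t v) \<le> C * exp (\<epsilon> * \<bar>t\<bar>)" "\<And>t. norm (L t w) \<le> C' * exp (\<epsilon> * \<bar>t\<bar>)"
      using vw unfolding Center_def by blast
    have "norm (L t (v + w)) \<le> (C + C') * exp (\<epsilon> * \<bar>t\<bar>)" for t
      using *(1)[of t] *(2)[of t] norm_triangle_ineq[of "L t v" "L t w"] by (simp add: L_add distrib_right)
    then show "\<exists>C. \<forall>t. norm (L t (v + w)) \<le> C * exp (\<epsilon> * \<bar>t\<bar>)" by blast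
  qed
next
  fix c v assume v: "v \<in> Center"
  show "c *\<^sub>R v \<in> Center" unfolding Center_def
  proof (clarify)
    fix \<epsilon> :: real assume "\<epsilon> > 0"
    then obtain C where *: "\<And>t. norm (L t v) \<le> C * exp (\<epsilon> * \<bar>t\<bar>)"
      using v unfolding Center_def by blast
    have "norm (L t (c *\<^sub>R v)) \<le> (\<bar>c\<bar> * C) * exp (\<epsilon> * \<bar>t\<bar>)" for t
      using *[of t] by (simp add: L_scale mult.assoc mult_left_mono)
    then show "\<exists>C. \<forall>t. norm (L t (c *\<^sub>R v)) \<le> C * exp (\<epsilon> * \<bar>t\<bar>)" by blast
  qed
qed

lemma Stable_invariant: "v \<in> Stable \<Longrightarrow> L s v \<in> Stable"
proof -
  assume "v \<in> Stable"
  then obtain \<rho> C where *: "\<rho> < 0" "\<And>t. t \<ge> 0 \<Longrightarrow> norm (L t v) \<le> C * exp (\<rho> * t)"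
    unfolding Stable_def by blast
  obtain K where K: "norm (L s w) \<le> K * norm w" "K > 0" for w
    using linear_bounded_pos[OF linear] by blast
  have "norm (L t (L s v)) \<le> (K * C) * exp (\<rho> * t)" if "t \<ge> 0" for t
  proof -
    have "L t (L s v) = L s (L t v)" using add[of t s v] add[of s t v] by (simp add: add.commute)
    then have "norm (L t (L s v)) \<le> K * norm (L t v)" using K by simp
    also have "\<dots> \<le> K * (C * exp (\<rho> * t))" using *(2)[OF that] K(2) by simp
    finally show ?thesis by (simp add: mult.assoc)
  qed
  then show "L s v \<in> Stable" unfolding Stable_def using *(1) by blast
qed

lemma Unstable_invariant: "v \<in> Unstable \<Longrightarrow> L s v \<in> Unstable"
  using linear_flow.Stable_invariant[OF linear_flow_minus, of v "- s"] unfolding Stable_minus by simp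

lemma Center_invariant: "v \<in> Center \<Longrightarrow> L s v \<in> Center"
  unfolding Center_def
proof (clarify)
  fix \<epsilon> :: real assume v: "\<forall>\<epsilon>>0. \<exists>C. \<forall>t. norm (L t v) \<le> C * exp (\<epsilon> * \<bar>t\<bar>)" and "\<epsilon> > 0"
  then obtain C where *: "\<And>t. norm (L t v) \<le> C * exp (\<epsilon> * \<bar>t\<bar>)" by blast
  obtain K where K: "norm (L s w) \<le> K * norm w" "K > 0" for w
    using linear_bounded_pos[OF linear] by blast
  have "norm (L t (L s v)) \<le> (K * C) * exp (\<epsilon> * \<bar>t\<bar>)" for t
  proof -
    have "L t (L s v) = L s (L t v)" using add[of t s v] add[of s t v] by (simp add: add.commute)
    then have "norm (L t (L s v)) \<le> K * norm (L t v)" using K by simp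
    also have "\<dots> \<le> K * (C * exp (\<epsilon> * \<bar>t\<bar>))" using *[of t] K(2) by simp
    finally show ?thesis by (simp add: mult.assoc)
  qed
  then show "\<exists>C. \<forall>t. norm (L t (L s v)) \<le> C * exp (\<epsilon> * \<bar>t\<bar>)" by blast
qed

text \<open>The slowest of the finitely many rates of a basis is still negative. Vectors that decay
  at this one rate form a subspace, which contains the basis and hence all of
  \<open>Stable\<close>.\<close>

lemma Stable_uniform:
  obtains \<sigma> C where "\<sigma> > 0" "C > 0" "\<And>v t. v \<in> Stable \<Longrightarrow> t \<ge> 0 \<Longrightarrow> norm (L t v) \<le> C * exp (- \<sigma> * t) * norm v"
proof -
  obtain B where B: "B \<subseteq> Stable" "independent B" "Stable = span B"
    using basis_exists[of Stable] subspace_Stable span_minimal by (metis subset_antisym)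
  have fin: "finite B" using B(2) independent_imp_finite by blast
  from B(1) have "\<forall>b\<in>B. \<exists>\<rho>. \<rho> < 0 \<and> (\<exists>C. \<forall>t\<ge>0. norm (L t b) \<le> C * exp (\<rho> * t))"
    unfolding Stable_def by blast
  then obtain \<rho> where \<rho>: "\<And>b. b \<in> B \<Longrightarrow> \<rho> b < 0" "\<And>b. b \<in> B \<Longrightarrow> \<exists>C. \<forall>t\<ge>0. norm (L t b) \<le> C * exp (\<rho> b * t)"
    by metis
  \<comment> \<open>The inserted \<open>-1\<close> keeps the maximum defined and negative when the
    basis is empty.\<close>
  define r where "r = Max (insert (-1) (\<rho> ` B))"
  have r: "r < 0" unfolding r_def using \<rho>(1) fin by simp
  have rb: "\<rho> b \<le> r" if "b \<in> B" for b unfolding r_def using fin that by simp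
  define S' where "S' = {v. \<exists>C. \<forall>t\<ge>0. norm (L t v) \<le> C * exp (r * t)}"
  have "subspace S'"
  proof (rule subspaceI)
    show "0 \<in> S'" unfolding S'_def by (auto intro!: exI[of _ 0])
  next
    fix v w assume "v \<in> S'" "w \<in> S'"
    then obtain C C' where *: "\<And>t. t \<ge> 0 \<Longrightarrow> norm (L t v) \<le> C * exp (r * t)"
      "\<And>t. t \<ge> 0 \<Longrightarrow> norm (L t w) \<le> C' * exp (r * t)" unfolding S'_def by blast
    have "norm (L t (v + w)) \<le> (C + C') * exp (r * t)" if "t \<ge> 0" for t
      using *[OF that] norm_triangle_ineq[of "L t v" "L t w"] by (simp add: L_add distrib_right)
    then show "v + w \<in> S'" unfolding S'_def by blast
  next
    fix c v assume "v \<in> S'"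
    then obtain C where *: "\<And>t. t \<ge> 0 \<Longrightarrow> norm (L t v) \<le> C * exp (r * t)" unfolding S'_def by blast
    have "norm (L t (c *\<^sub>R v)) \<le> (\<bar>c\<bar> * C) * exp (r * t)" if "t \<ge> 0" for t
      using *[OF that] by (simp add: L_scale mult.assoc mult_left_mono)
    then show "c *\<^sub>R v \<in> S'" unfolding S'_def by blast
  qed
  moreover have "B \<subseteq> S'"
  proof
    fix b assume b: "b \<in> B"
    then obtain C where C: "\<And>t. t \<ge> 0 \<Longrightarrow> norm (L t b) \<le> C * exp (\<rho> b * t)" using \<rho>(2) by blast
    have "norm (L t b) \<le> \<bar>C\<bar> * exp (r * t)" if "t \<ge> 0" for t
    proof -
      have "exp (\<rho> b * t) \<le> exp (r * t)" using that rb[OF b] by (auto intro!: mult_right_mono)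
      then have "C * exp (\<rho> b * t) \<le> \<bar>C\<bar> * exp (r * t)" by (auto intro!: mult_mono)
      then show ?thesis using C[OF that] by linarith
    qed
    then show "b \<in> S'" unfolding S'_def by blast
  qed
  ultimately have "Stable \<subseteq> S'" using B(3) span_minimal by blast
  then have "\<exists>C. \<forall>t\<in>{0..}. norm (L t v) \<le> C * exp (r * t)" if "v \<in> Stable" for v
    using that unfolding S'_def by fastforce
  then have "\<exists>C>0. \<forall>v\<in>Stable. \<forall>t\<in>{0..}. norm (L t v) \<le> C * exp (r * t) * norm v"
    by (intro subspace_uniform_bound subspace_Stable linear) auto
  then obtain C where "C > 0" "\<And>v t. v \<in> Stable \<Longrightarrow> t \<ge> 0 \<Longrightarrow> norm (L t v) \<le> C * exp (r * t) * norm v"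
    by auto
  with r show ?thesis using that[of "- r" C] by auto
qed

lemma Unstable_uniform:
  obtains \<sigma> C where "\<sigma> > 0" "C > 0" "\<And>v t. v \<in> Unstable \<Longrightarrow> t \<ge> 0 \<Longrightarrow> norm (L (- t) v) \<le> C * exp (- \<sigma> * t) * norm v"
  using linear_flow.Stable_uniform[OF linear_flow_minus] unfolding Stable_minus by blast

lemma Center_uniform:
  assumes "\<epsilon> > 0"
  obtains C where "C > 0" "\<And>v t. v \<in> Center \<Longrightarrow> norm (L t v) \<le> C * exp (\<epsilon> * \<bar>t\<bar>) * norm v"
proof -
  have "\<exists>C>0. \<forall>v\<in>Center. \<forall>t\<in>UNIV. norm (L t v) \<le> C * exp (\<epsilon> * \<bar>t\<bar>) * norm v"
    by (intro subspace_uniform_bound subspace_Center linear) (use assms in \<open>auto simp: Center_def\<close>)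
  then show ?thesis using that by auto
qed

text \<open>At time \<open>- t\<close> the vector \<open>s\<close> equals \<open>- c - u\<close>,
  hence has size at most a constant times \<open>exp (\<sigma> / 2 * t)\<close>. Going forward again
  contracts by \<open>exp (- \<sigma> * t)\<close>, so \<open>s\<close> is arbitrarily small. The
  unstable part follows by time reversal.\<close>

lemma decomposition_unique:
  assumes "s \<in> Stable" "c \<in> Center" "u \<in> Unstable" "s + c + u = 0"
  shows "s = 0" "c = 0" "u = 0"
proof -
  have stable_zero: "s = 0"
    if lf: "linear_flow L" and s: "s \<in> linear_flow.Stable L" and c: "c \<in> linear_flow.Center L"
      and u: "u \<in> linear_flow.Unstable L"
      and sum: "s + c + u = 0" for L :: "real \<Rightarrow> 'e \<Rightarrow> 'e" and s c u
  proof -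
    interpret lf: linear_flow L by (rule lf)
    obtain \<sigma> C where C: "\<sigma> > 0" "C > 0"
      "\<And>v t. v \<in> lf.Stable \<Longrightarrow> t \<ge> 0 \<Longrightarrow> norm (L t v) \<le> C * exp (- \<sigma> * t) * norm v"
      using lf.Stable_uniform by blast
    have s2: "\<sigma> / 2 > 0" using C by simp
    obtain D where D: "\<And>t. norm (L t c) \<le> D * exp (\<sigma> / 2 * \<bar>t\<bar>)"
      using c s2 unfolding lf.Center_def by blast
    obtain \<rho> E where E: "\<rho> > 0" "\<And>t. t \<le> 0 \<Longrightarrow> norm (L t u) \<le> E * exp (\<rho> * t)"
      using u unfolding lf.Unstable_def by blast
    have bound: "norm s \<le> C * (\<bar>D\<bar> + \<bar>E\<bar>) * exp (- \<sigma> / 2 * t)" if "t \<ge> 0" for t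
    proof -
      have "L (- t) s = - (L (- t) c) - L (- t) u"
      proof -
        have "L (- t) (s + c + u) = 0" using sum by simp
        then show ?thesis by (simp add: lf.L_add algebra_simps add_eq_0_iff)
      qed
      then have "norm (L (- t) s) \<le> norm (L (- t) c) + norm (L (- t) u)"
        using norm_triangle_ineq4[of "- L (- t) c" "L (- t) u"] by simp
      also have "\<dots> \<le> \<bar>D\<bar> * exp (\<sigma> / 2 * t) + \<bar>E\<bar> * exp (\<sigma> / 2 * t)"
      proof (rule add_mono)
        have "norm (L (- t) c) \<le> D * exp (\<sigma> / 2 * t)" using D[of "- t"] that by simp
        also have "\<dots> \<le> \<bar>D\<bar> * exp (\<sigma> / 2 * t)" by (intro mult_right_mono) auto
        finally show "norm (L (- t) c) \<le> \<bar>D\<bar> * exp (\<sigma> / 2 * t)" .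
        have "norm (L (- t) u) \<le> E * exp (\<rho> * (- t))" using E(2)[of "- t"] that by simp
        also have "\<dots> \<le> \<bar>E\<bar> * exp (\<sigma> / 2 * t)"
        proof -
          have "\<rho> * (- t) \<le> 0" "0 \<le> \<sigma> / 2 * t" using that E(1) s2 by (auto simp: mult_nonneg_nonneg)
          then have "exp (\<rho> * (- t)) \<le> exp (\<sigma> / 2 * t)" by (subst exp_le_cancel_iff) linarith
          then show ?thesis by (intro mult_mono) auto
        qed
        finally show "norm (L (- t) u) \<le> \<bar>E\<bar> * exp (\<sigma> / 2 * t)" .
      qed
      finally have 1: "norm (L (- t) s) \<le> (\<bar>D\<bar> + \<bar>E\<bar>) * exp (\<sigma> / 2 * t)" by (simp add: distrib_right)
      have "norm s = norm (L t (L (- t) s))" by simp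
      also have "\<dots> \<le> C * exp (- \<sigma> * t) * norm (L (- t) s)"
        using C(3)[OF lf.Stable_invariant[OF s] that] .
      also have "\<dots> \<le> C * exp (- \<sigma> * t) * ((\<bar>D\<bar> + \<bar>E\<bar>) * exp (\<sigma> / 2 * t))"
        using 1 C(2) by (intro mult_left_mono) auto
      also have "\<dots> = C * (\<bar>D\<bar> + \<bar>E\<bar>) * (exp (- \<sigma> * t) * exp (\<sigma> / 2 * t))" by (simp add: mult_ac)
      also have "exp (- \<sigma> * t) * exp (\<sigma> / 2 * t) = exp (- \<sigma> / 2 * t)"
        unfolding exp_add[symmetric] by (simp add: field_simps)
      finally show ?thesis .
    qed
    have "((\<lambda>t. C * (\<bar>D\<bar> + \<bar>E\<bar>) * exp (- \<sigma> / 2 * t)) \<longlongrightarrow> C * (\<bar>D\<bar> + \<bar>E\<bar>) * 0) at_top"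
    proof (intro tendsto_mult tendsto_const)
      have "filterlim (\<lambda>t::real. - (\<sigma> / 2) * t) at_bot at_top"
        by (rule filterlim_tendsto_neg_mult_at_bot[OF tendsto_const _ filterlim_ident]) (use s2 in simp)
      then show "((\<lambda>t. exp (- \<sigma> / 2 * t)) \<longlongrightarrow> 0) at_top"
        using filterlim_compose[OF exp_at_bot] by simp
    qed
    then have "norm s \<le> C * (\<bar>D\<bar> + \<bar>E\<bar>) * 0"
    proof (rule tendsto_lowerbound)
      show "\<forall>\<^sub>F t in at_top. norm s \<le> C * (\<bar>D\<bar> + \<bar>E\<bar>) * exp (- \<sigma> / 2 * t)"
        using eventually_ge_at_top[of 0] bound by (rule eventually_mono)
    qed simp
    then show "s = 0" by simp
  qed
  show s0: "s = 0" by (rule stable_zero[OF linear_flow_axioms assms])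
  show u0: "u = 0"
    by (rule stable_zero[OF linear_flow_minus, of u c s])
       (use assms in \<open>auto simp: Stable_minus Unstable_minus Center_minus algebra_simps\<close>)
  show "c = 0" using assms(4) s0 u0 by simp
qed

text \<open>The first \<open>DIM('e) + 1\<close> iterates of \<open>v\<close> are linearly
  dependent, and applying \<open>L n\<close> carries the relation to every integer position. One
  polynomial serves all coordinates \<open>b\<close> at once.\<close>

lemma orbit_recurrence:
  obtains p :: "complex poly" where "p \<noteq> 0"
    "\<And>b. shift_act p (\<lambda>n. of_real (L (of_int n) v \<bullet> b)) = (\<lambda>n. 0)"
proof -
  define d where "d = DIM('e)"
  define f where "f i = L (real i) v" for i
  obtain c :: "nat \<Rightarrow> real" where c: "\<exists>i\<le>d. c i \<noteq> 0" "(\<Sum>i\<le>d. c i *\<^sub>R f i) = 0"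
  proof (cases "inj_on f {..d}")
    case True
    then have "card (f ` {..d}) = Suc d" by (simp add: card_image)
    then have "dependent (f ` {..d})" by (intro dependent_biggerset) (auto simp: d_def)
    then obtain u where u: "\<exists>x\<in>f ` {..d}. u x \<noteq> 0" "(\<Sum>x\<in>f ` {..d}. u x *\<^sub>R x) = 0"
      by (auto simp: dependent_finite)
    then have "(\<Sum>i\<le>d. u (f i) *\<^sub>R f i) = 0"
      unfolding sum.reindex[OF True, of "\<lambda>x. u x *\<^sub>R x"] comp_def by blast
    with u(1) show ?thesis using that[of "u \<circ> f"] by auto
  next
    \<comment> \<open>If two iterates coincide, their set is too small for the counting argument,
      but then their difference is itself the relation.\<close>
    case False
    then obtain i j where ij: "i \<le> d" "j \<le> d" "i \<noteq> j" "f i = f j" by (auto simp: inj_on_def)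
    define c where "c k = (if k = i then 1 else 0) - (if k = j then 1 else 0 :: real)" for k
    have "(\<Sum>k\<le>d. c k *\<^sub>R f k)
        = (\<Sum>k\<le>d. (if k = i then f k else 0) - (if k = j then f k else 0))"
      by (rule sum.cong) (auto simp: c_def)
    also have "\<dots> = 0" using ij by (simp add: sum_subtractf)
    finally have "(\<Sum>k\<le>d. c k *\<^sub>R f k) = 0" .
    moreover have "c i \<noteq> 0" using ij(3) by (simp add: c_def)
    ultimately show ?thesis using that[of c] ij(1) by blast
  qed
  define p where "p = (\<Sum>i\<le>d. monom (complex_of_real (c i)) i)"
  have co: "coeff p k = (if k \<le> d then complex_of_real (c k) else 0)" for k
    by (simp add: p_def coeff_sum)
  have "p \<noteq> 0"
  proof
    assume "p = 0"
    then have "coeff p k = 0" for k by simp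
    then show False using c(1) co by (metis of_real_eq_0_iff)
  qed
  moreover have "shift_act p (\<lambda>n. of_real (L (of_int n) v \<bullet> b)) n = 0" for b n
  proof -
    have "degree p \<le> d" by (rule degree_le) (simp add: co)
    then have "shift_act p (\<lambda>n. of_real (L (of_int n) v \<bullet> b)) n
      = (\<Sum>i\<le>d. of_real (c i) * of_real (L (of_int (n + int i)) v \<bullet> b))"
      by (simp add: shift_act_altdef co)
    also have "\<dots> = of_real (\<Sum>i\<le>d. c i * (L (of_int (n + int i)) v \<bullet> b))"
      by simp
    also have "(\<Sum>i\<le>d. c i * (L (of_int (n + int i)) v \<bullet> b))
      = L (of_int n) (\<Sum>i\<le>d. c i *\<^sub>R f i) \<bullet> b"
      by (simp add: linear_sum[OF linear] L_scale inner_sum_left f_def add[symmetric])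
    finally show ?thesis using c(2) by simp
  qed
  ultimately show ?thesis using that[of p] by blast
qed

text \<open>A real time exceeds an integer by at most one, and over such times \<open>L\<close> is
  uniformly bounded. The factor \<open>exp \<bar>ln r\<bar>\<close> pays for rounding the time in
  the exponent.\<close>

lemma discrete_growth:
  assumes "r > 0" "\<And>b. b \<in> Basis \<Longrightarrow> \<exists>C. \<forall>n::nat. \<bar>L (real n) w \<bullet> b\<bar> \<le> C * r ^ n"
  shows "\<exists>C. \<forall>t\<ge>0. norm (L t w) \<le> C * exp (ln r * t)"
proof -
  obtain K where K: "K > 0" "\<And>t v. \<bar>t\<bar> \<le> 1 \<Longrightarrow> norm (L t v) \<le> K * norm v"
    using bounded_uniform by blast
  obtain C where C: "\<And>b n. b \<in> Basis \<Longrightarrow> \<bar>L (real n) w \<bullet> b\<bar> \<le> C b * r ^ n"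
    using assms(2) by metis
  define D where "D = (\<Sum>b\<in>Basis. C b)"
  have D: "norm (L (real n) w) \<le> D * r ^ n" for n
  proof -
    have "norm (L (real n) w) \<le> (\<Sum>b\<in>Basis. \<bar>L (real n) w \<bullet> b\<bar>)" by (rule norm_le_l1)
    also have "\<dots> \<le> (\<Sum>b\<in>Basis. C b * r ^ n)" by (rule sum_mono) (rule C)
    finally show ?thesis by (simp add: D_def sum_distrib_right)
  qed
  have "D \<ge> 0" using order_trans[OF norm_ge_zero D[of 0]] by simp
  have "norm (L t w) \<le> (K * D * exp \<bar>ln r\<bar>) * exp (ln r * t)" if "t \<ge> 0" for t
  proof -
    define n f where "n = nat \<lfloor>t\<rfloor>" and "f = t - real n"
    have f: "0 \<le> f" "f \<le> 1" unfolding f_def n_def using that by linarith+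
    have "L t w = L f (L (real n) w)" unfolding add[symmetric] f_def by simp
    then have "norm (L t w) \<le> K * (D * r ^ n)"
      using K(2)[of f "L (real n) w"] f D[of n] K(1) by (smt (verit) mult_left_mono)
    also have "r ^ n = exp (ln r * t) * exp (- (ln r * f))"
    proof -
      have "r ^ n = exp (ln r * real n)"
        using assms(1) by (metis exp_ln exp_of_nat_mult mult.commute)
      also have "ln r * real n = ln r * t + - (ln r * f)" by (simp add: f_def algebra_simps)
      finally show ?thesis by (simp only: exp_add)
    qed
    also have "K * (D * (exp (ln r * t) * exp (- (ln r * f)))) \<le> K * (D * (exp (ln r * t) * exp \<bar>ln r\<bar>))"
    proof (intro mult_left_mono)
      have "- (ln r * f) \<le> \<bar>ln r * f\<bar>" by simp
      also have "\<dots> \<le> \<bar>ln r\<bar>" using f by (simp add: abs_mult mult_left_le)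
      finally show "exp (- (ln r * f)) \<le> exp \<bar>ln r\<bar>" by simp
    qed (use K(1) \<open>D \<ge> 0\<close> in auto)
    finally show ?thesis by (simp add: mult_ac)
  qed
  then show ?thesis by blast
qed

text \<open>The complex sequences \<open>u b\<close> only dominate the coordinates of the orbit: in
  the application these coordinates are real parts of complex solutions of the recurrence.\<close>

lemma recurrence_orbit_growth:
  fixes p :: "complex poly"
  assumes "p \<noteq> 0" "r > 0" "\<And>b. shift_act p (u b) = (\<lambda>n. 0)"
    and "\<And>b n. \<bar>L (of_int n) w \<bullet> b\<bar> \<le> cmod (u b n)"
  shows "(\<And>z. poly p z = 0 \<Longrightarrow> cmod z < r) \<Longrightarrow> \<exists>C. \<forall>t\<ge>0. norm (L t w) \<le> C * exp (ln r * t)"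
    and "(\<And>z. poly p z = 0 \<Longrightarrow> cmod z > r) \<Longrightarrow> \<exists>C. \<forall>t\<le>0. norm (L t w) \<le> C * exp (ln r * t)"
proof -
  assume "\<And>z. poly p z = 0 \<Longrightarrow> cmod z < r"
  then have *: "\<exists>C. \<forall>n::nat. cmod (u b (int n)) \<le> C * r ^ n" for b
    by (rule recurrence_growth_forward[OF assms(1,2)])
       (use assms(3) in \<open>auto intro!: exI[of _ 0]\<close>)
  have "\<exists>C. \<forall>n::nat. \<bar>L (real n) w \<bullet> b\<bar> \<le> C * r ^ n" for b
  proof -
    obtain C where C: "\<And>n::nat. cmod (u b (int n)) \<le> C * r ^ n" using *[of b] by blast
    have "\<bar>L (real n) w \<bullet> b\<bar> \<le> C * r ^ n" for n
      using order_trans[OF assms(4)[of "int n" b] C[of n]] by simp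
    then show ?thesis by blast
  qed
  then show "\<exists>C. \<forall>t\<ge>0. norm (L t w) \<le> C * exp (ln r * t)" by (intro discrete_growth assms(2))
next
  assume "\<And>z. poly p z = 0 \<Longrightarrow> cmod z > r"
  then have *: "\<exists>C. \<forall>n::nat. cmod (u b (- int n)) \<le> C * inverse r ^ n" for b
    by (rule recurrence_growth_backward[OF assms(1,2)])
       (use assms(3) in \<open>auto intro!: exI[of _ 0]\<close>)
  have "\<exists>C. \<forall>n::nat. \<bar>L (- real n) w \<bullet> b\<bar> \<le> C * inverse r ^ n" for b
  proof -
    obtain C where C: "\<And>n::nat. cmod (u b (- int n)) \<le> C * inverse r ^ n" using *[of b] by blast
    have "\<bar>L (- real n) w \<bullet> b\<bar> \<le> C * inverse r ^ n" for n
      using order_trans[OF assms(4)[of "- int n" b] C[of n]] by simp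
    then show ?thesis by blast
  qed
  then have "\<exists>C. \<forall>t\<ge>0. norm (L (- t) w) \<le> C * exp (ln (inverse r) * t)"
    by (intro linear_flow.discrete_growth[OF linear_flow_minus]) (use assms(2) in auto)
  then obtain C where "\<And>t. t \<ge> 0 \<Longrightarrow> norm (L (- t) w) \<le> C * exp (ln (inverse r) * t)" by blast
  from this[of "- t" for t] show "\<exists>C. \<forall>t\<le>0. norm (L t w) \<le> C * exp (ln r * t)"
    using assms(2) by (auto simp: ln_inverse)
qed

text \<open>
  The coordinates of the orbit of \<open>v\<close> under \<open>L 1\<close> satisfy a linear recurrence.  Bezout's identity for
  the factors of its characteristic polynomial with roots inside, on and outside the unit circle
  writes \<open>1\<close> as a sum of three complex polynomials; the real parts of their values at \<open>L 1\<close>, applied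
  to \<open>v\<close>, are the three components.
\<close>

theorem spectral_decomposition:
  obtains s c u where "s \<in> Stable" "c \<in> Center" "u \<in> Unstable" "v = s + c + u"
proof -
  obtain p :: "complex poly" where p: "p \<noteq> 0"
    "\<And>b. shift_act p (\<lambda>n. of_real (L (of_int n) v \<bullet> b)) = (\<lambda>n. 0)"
    using orbit_recurrence by blast
  obtain ps p' where ps: "p = ps * p'" "\<And>z. poly ps z = 0 \<Longrightarrow> cmod z < 1" "\<And>z. poly p' z = 0 \<Longrightarrow> \<not> cmod z < 1"
    using complex_poly_split_roots[OF p(1), of "\<lambda>z. cmod z < 1"] by blast
  have "p' \<noteq> 0" using p(1) ps(1) by auto
  then obtain pc pu where pc: "p' = pc * pu" "\<And>z. poly pc z = 0 \<Longrightarrow> cmod z = 1" "\<And>z. poly pu z = 0 \<Longrightarrow> cmod z \<noteq> 1"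
    using complex_poly_split_roots[of p' "\<lambda>z. cmod z = 1"] by blast
  have pu: "cmod z > 1" if "poly pu z = 0" for z
    using pc(3)[OF that] ps(3)[of z] that pc(1) by fastforce
  have nz: "ps \<noteq> 0" "pc \<noteq> 0" "pu \<noteq> 0" using p(1) ps(1) pc(1) by auto
  obtain a b where ab: "a * ps + b * p' = 1"
    using complex_poly_bezout[OF nz(1), of p'] ps(2,3) by blast
  obtain c d where cd: "c * pc + d * pu = 1"
    using complex_poly_bezout[OF nz(2), of pu] pc(2,3) by blast
  define qs qc qu where "qs = b * p'" and "qc = a * ps * d * pu" and "qu = a * ps * c * pc"
  have "qs + qc + qu = b * p' + a * ps * (c * pc + d * pu)"
    by (simp add: qs_def qc_def qu_def algebra_simps)
  then have one: "qs + qc + qu = 1" unfolding cd using ab by (simp add: algebra_simps)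
  have ann: "ps * qs = b * p" "pc * qc = (a * d) * p" "pu * qu = (a * c) * p"
    by (simp_all add: qs_def qc_def qu_def ps(1) pc(1) algebra_simps)
  define u where "u q b n = shift_act q (\<lambda>n. of_real (L (of_int n) v \<bullet> b)) n" for q :: "complex poly" and b n
  have ann': "shift_act ps (u qs b) = (\<lambda>n. 0)" "shift_act pc (u qc b) = (\<lambda>n. 0)"
    "shift_act pu (u qu b) = (\<lambda>n. 0)" for b
    unfolding u_def shift_act_mult[symmetric] ann by (simp_all add: shift_act_mult p(2))
  define V where "V q = (\<Sum>i\<le>degree q. Re (coeff q i) *\<^sub>R L (real i) v)" for q :: "complex poly"
  have V_alt: "V q = (\<Sum>i\<le>N. Re (coeff q i) *\<^sub>R L (real i) v)" if "degree q \<le> N" for q N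
    unfolding V_def by (rule sum.mono_neutral_left) (use that in \<open>auto intro!: le_degree\<close>)
  have V_add: "V (q + r) = V q + V r" for q r
  proof -
    define N where "N = max (degree q) (degree r)"
    have "degree (q + r) \<le> N" by (simp add: N_def degree_add_le_max)
    then show ?thesis
      by (simp add: V_alt[of _ N] N_def sum.distrib[symmetric] scaleR_add_left)
  qed
  have V_bound: "\<bar>L (of_int n) (V q) \<bullet> b\<bar> \<le> cmod (u q b n)" for q b n
  proof -
    have "L (of_int n) (V q) \<bullet> b = (\<Sum>i\<le>degree q. Re (coeff q i) * (L (of_int n + real i) v \<bullet> b))"
      by (simp add: V_def linear_sum[OF linear] L_scale inner_sum_left add[symmetric])
    also have "\<dots> = Re (u q b n)" by (simp add: u_def shift_act_def)
    finally show ?thesis by (simp add: abs_Re_le_cmod)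
  qed
  have "V (qs + qc + qu) = v" unfolding one by (simp add: V_def)
  then have sum: "v = V qs + V qc + V qu" unfolding V_add ..
  have stable: "V qs \<in> Stable"
  proof -
    \<comment> \<open>There are finitely many roots, so there is room for a radius strictly between
      the largest modulus and \<open>1\<close>, which yields a genuine exponential rate. The
      inserted \<open>0\<close> covers a polynomial without roots.\<close>
    define m where "m = Max (insert 0 (cmod ` {z. poly ps z = 0}))"
    have fin: "finite (insert 0 (cmod ` {z. poly ps z = 0}))" using poly_roots_finite[OF nz(1)] by simp
    have m: "m < 1" "m \<ge> 0" unfolding m_def using fin ps(2) by auto
    have le: "cmod z \<le> m" if "poly ps z = 0" for z unfolding m_def using fin that by simp
    define r where "r = (1 + m) / 2"
    have r: "r > 0" "r < 1" "m < r" using m by (auto simp: r_def)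
    have "\<exists>C. \<forall>t\<ge>0. norm (L t (V qs)) \<le> C * exp (ln r * t)"
      by (rule recurrence_orbit_growth(1)[OF nz(1) r(1) ann'(1) V_bound]) (use le r in force)
    moreover have "ln r < 0" using r by simp
    ultimately show ?thesis unfolding Stable_def by blast
  qed
  have unstable: "V qu \<in> Unstable"
  proof -
    define m where "m = Min (insert 2 (cmod ` {z. poly pu z = 0}))"
    have fin: "finite (insert 2 (cmod ` {z. poly pu z = 0}))" using poly_roots_finite[OF nz(3)] by simp
    have m: "m > 1" unfolding m_def using fin pu by auto
    have le: "cmod z \<ge> m" if "poly pu z = 0" for z unfolding m_def using fin that by simp
    define r where "r = (1 + m) / 2"
    have r: "r > 1" "m > r" using m by (auto simp: r_def)
    then have r0: "r > 0" by simp
    have "\<exists>C. \<forall>t\<le>0. norm (L t (V qu)) \<le> C * exp (ln r * t)"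
      by (rule recurrence_orbit_growth(2)[OF nz(3) r0 ann'(3) V_bound]) (use le r in force)
    moreover have "ln r > 0" using r by simp
    ultimately show ?thesis unfolding Unstable_def by blast
  qed
  have center: "V qc \<in> Center"
    unfolding Center_def
  proof (clarify)
    fix \<epsilon> :: real assume \<epsilon>: "\<epsilon> > 0"
    have "\<exists>C. \<forall>t\<ge>0. norm (L t (V qc)) \<le> C * exp (ln (exp \<epsilon>) * t)"
      by (rule recurrence_orbit_growth(1)[OF nz(2) _ ann'(2) V_bound]) (use pc(2) \<epsilon> in auto)
    moreover have "\<exists>C. \<forall>t\<le>0. norm (L t (V qc)) \<le> C * exp (ln (exp (- \<epsilon>)) * t)"
      by (rule recurrence_orbit_growth(2)[OF nz(2) _ ann'(2) V_bound]) (use pc(2) \<epsilon> in auto)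
    ultimately obtain C D where CD: "\<And>t. t \<ge> 0 \<Longrightarrow> norm (L t (V qc)) \<le> C * exp (\<epsilon> * t)"
      "\<And>t. t \<le> 0 \<Longrightarrow> norm (L t (V qc)) \<le> D * exp (- \<epsilon> * t)" by auto
    have "norm (L t (V qc)) \<le> max C D * exp (\<epsilon> * \<bar>t\<bar>)" for t
    proof (cases "t \<ge> 0")
      case True
      have "C * exp (\<epsilon> * t) \<le> max C D * exp (\<epsilon> * t)" by (intro mult_right_mono) auto
      from order_trans[OF CD(1)[OF True] this] show ?thesis using True by simp
    next
      case False
      have "D * exp (- \<epsilon> * t) \<le> max C D * exp (- \<epsilon> * t)" by (intro mult_right_mono) auto
      from order_trans[OF CD(2) this] show ?thesis using False by simp
    qed
    then show "\<exists>C. \<forall>t. norm (L t (V qc)) \<le> C * exp (\<epsilon> * \<bar>t\<bar>)" by blast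
  qed
  show ?thesis using that[OF stable center unstable sum] .
qed

section \<open>Projections of the spectral splitting\<close>

definition decomp :: "'e \<Rightarrow> 'e \<times> 'e \<times> 'e" where
  "decomp v = (SOME p. fst p \<in> Stable \<and> fst (snd p) \<in> Center \<and> snd (snd p) \<in> Unstable \<and>
     v = fst p + fst (snd p) + snd (snd p))"

definition "\<pi>s v = fst (decomp v)"
definition "\<pi>c v = fst (snd (decomp v))"
definition "\<pi>u v = snd (snd (decomp v))"

lemma \<pi>: "\<pi>s v \<in> Stable" "\<pi>c v \<in> Center" "\<pi>u v \<in> Unstable" "v = \<pi>s v + \<pi>c v + \<pi>u v"
proof -
  obtain s c u where "s \<in> Stable" "c \<in> Center" "u \<in> Unstable" "v = s + c + u"
    using spectral_decomposition by blast
  then have "\<exists>p. fst p \<in> Stable \<and> fst (snd p) \<in> Center \<and> snd (snd p) \<in> Unstable \<and>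
     v = fst p + fst (snd p) + snd (snd p)"
    by (intro exI[of _ "(s, c, u)"]) simp
  from someI_ex[OF this]
  show "\<pi>s v \<in> Stable" "\<pi>c v \<in> Center" "\<pi>u v \<in> Unstable" "v = \<pi>s v + \<pi>c v + \<pi>u v"
    unfolding \<pi>s_def \<pi>c_def \<pi>u_def decomp_def by auto
qed

lemma \<pi>_unique:
  assumes "s \<in> Stable" "c \<in> Center" "u \<in> Unstable" "v = s + c + u"
  shows "\<pi>s v = s" "\<pi>c v = c" "\<pi>u v = u"
proof -
  have "(\<pi>s v - s) + (\<pi>c v - c) + (\<pi>u v - u) = 0" using \<pi>(4)[of v] assms(4) by (simp add: algebra_simps)
  moreover have "\<pi>s v - s \<in> Stable" by (intro subspace_diff subspace_Stable \<pi> assms)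
  moreover have "\<pi>c v - c \<in> Center" by (intro subspace_diff subspace_Center \<pi> assms)
  moreover have "\<pi>u v - u \<in> Unstable" by (intro subspace_diff subspace_Unstable \<pi> assms)
  ultimately have "\<pi>s v - s = 0" "\<pi>c v - c = 0" "\<pi>u v - u = 0"
    using decomposition_unique by blast+
  then show "\<pi>s v = s" "\<pi>c v = c" "\<pi>u v = u" by simp_all
qed

lemma zero_in [simp]: "0 \<in> Stable" "0 \<in> Center" "0 \<in> Unstable"
  using subspace_0 subspace_Stable subspace_Center subspace_Unstable by auto

lemma \<pi>_Stable: "v \<in> Stable \<Longrightarrow> \<pi>s v = v" "v \<in> Stable \<Longrightarrow> \<pi>u v = 0"
  using \<pi>_unique[of v 0 0 v] by auto

lemma \<pi>_Center: "v \<in> Center \<Longrightarrow> \<pi>s v = 0" "v \<in> Center \<Longrightarrow> \<pi>u v = 0"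
  using \<pi>_unique[of 0 v 0 v] by auto

lemma \<pi>_Unstable: "v \<in> Unstable \<Longrightarrow> \<pi>s v = 0" "v \<in> Unstable \<Longrightarrow> \<pi>u v = v"
  using \<pi>_unique[of 0 0 v v] by auto

lemma linear_\<pi>: "linear \<pi>s" "linear \<pi>u"
proof -
  note S = subspace_Stable subspace_Center subspace_Unstable
  have add: "\<pi>s (v + w) = \<pi>s v + \<pi>s w" "\<pi>u (v + w) = \<pi>u v + \<pi>u w" for v w
  proof -
    have eq: "v + w = (\<pi>s v + \<pi>s w) + (\<pi>c v + \<pi>c w) + (\<pi>u v + \<pi>u w)"
      using \<pi>(4)[of v] \<pi>(4)[of w] by (metis (no_types, lifting) add.assoc add.commute)
    show "\<pi>s (v + w) = \<pi>s v + \<pi>s w" "\<pi>u (v + w) = \<pi>u v + \<pi>u w"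
      by (rule \<pi>_unique[OF _ _ _ eq]; intro subspace_add S \<pi>)+
  qed
  have scale: "\<pi>s (c *\<^sub>R v) = c *\<^sub>R \<pi>s v" "\<pi>u (c *\<^sub>R v) = c *\<^sub>R \<pi>u v" for c v
  proof -
    have eq: "c *\<^sub>R v = c *\<^sub>R \<pi>s v + c *\<^sub>R \<pi>c v + c *\<^sub>R \<pi>u v"
      using \<pi>(4)[of v] by (metis scaleR_add_right)
    show "\<pi>s (c *\<^sub>R v) = c *\<^sub>R \<pi>s v" "\<pi>u (c *\<^sub>R v) = c *\<^sub>R \<pi>u v"
      by (rule \<pi>_unique[OF _ _ _ eq]; intro subspace_scale S \<pi>)+
  qed
  show "linear \<pi>s" "linear \<pi>u" by (intro linearI add scale)+
qed

end

section \<open>Cocycles over linear flows\<close>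

text \<open>An additive cocycle, linear in the fibre, over the skew product
  \<open>(x, v) \<mapsto> (\<phi> a x, L a v)\<close>. The base carries no topology: the uniform
  bound over bounded times is the form in which compactness enters. The identity
  \<open>\<phi> 0 x = x\<close> is assumed separately where it is used.\<close>

locale cocycle = linear_flow L for L :: "real \<Rightarrow> 'e::euclidean_space \<Rightarrow> 'e" +
  fixes X :: "'a set" and \<phi> :: "real \<Rightarrow> 'a \<Rightarrow> 'a" and \<kappa> :: "'a \<Rightarrow> real \<Rightarrow> 'e \<Rightarrow> real"
  assumes closed: "x \<in> X \<Longrightarrow> \<phi> t x \<in> X"
    and \<phi>_add: "x \<in> X \<Longrightarrow> \<phi> (s + t) x = \<phi> s (\<phi> t x)"
    and \<kappa>_linear: "x \<in> X \<Longrightarrow> linear (\<kappa> x a)"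
    and \<kappa>_add: "x \<in> X \<Longrightarrow> \<kappa> x (a + b) v = \<kappa> x a v + \<kappa> (\<phi> a x) b (L a v)"
    and \<kappa>_bound: "\<exists>K. \<forall>x\<in>X. \<forall>a. \<bar>a\<bar> \<le> R \<longrightarrow> (\<forall>v. \<bar>\<kappa> x a v\<bar> \<le> K * norm v)"
begin

text \<open>Meaningful for stable \<open>v\<close>, where the limit exists. Integer times suffice,
  as \<open>\<eta>_invariance\<close> holds for all real times.\<close>

definition \<eta> :: "'a \<Rightarrow> 'e \<Rightarrow> real" where
  "\<eta> x v = lim (\<lambda>n::nat. \<kappa> x (real n) v)"

lemma \<kappa>_0: assumes "x \<in> X" "\<phi> 0 x = x" shows "\<kappa> x 0 v = 0"
  using \<kappa>_add[OF assms(1), of 0 0 v] assms(2) by simp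

lemma \<kappa>_uniform: obtains K where "K > 0" "\<And>x a v. x \<in> X \<Longrightarrow> \<bar>a\<bar> \<le> R \<Longrightarrow> \<bar>\<kappa> x a v\<bar> \<le> K * norm v"
proof -
  obtain K where K: "\<And>x a v. x \<in> X \<Longrightarrow> \<bar>a\<bar> \<le> R \<Longrightarrow> \<bar>\<kappa> x a v\<bar> \<le> K * norm v"
    using \<kappa>_bound by metis
  have "\<bar>\<kappa> x a v\<bar> \<le> max K 1 * norm v" if "x \<in> X" "\<bar>a\<bar> \<le> R" for x a v
  proof -
    have "K * norm v \<le> max K 1 * norm v" by (intro mult_right_mono) auto
    then show ?thesis using K[OF that, of v] by linarith
  qed
  then show ?thesis using that[of "max K 1"] by simp
qed

text \<open>The increment \<open>\<kappa> (\<phi> n x) 1 (L n v)\<close> is controlled by the norm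
  of \<open>L n v\<close>, hence by a geometric sequence independent of \<open>x\<close>. The
  explicit error is part of the result because it makes the convergence uniform, which gives
  continuity of the limit in \<open>x\<close>.\<close>

lemma \<eta>_convergence:
  obtains C q where "C > 0" "0 < q" "q < 1"
    "\<And>x v n. x \<in> X \<Longrightarrow> v \<in> Stable \<Longrightarrow> (\<lambda>n. \<kappa> x (real n) v) \<longlonglongrightarrow> \<eta> x v"
    "\<And>x v n. x \<in> X \<Longrightarrow> v \<in> Stable \<Longrightarrow> \<bar>\<eta> x v - \<kappa> x (real n) v\<bar> \<le> C * q ^ n * norm v"
proof -
  obtain \<sigma> D where D: "\<sigma> > 0" "D > 0"
    "\<And>v t. v \<in> Stable \<Longrightarrow> t \<ge> 0 \<Longrightarrow> norm (L t v) \<le> D * exp (- \<sigma> * t) * norm v"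
    using Stable_uniform by blast
  obtain K where K: "K > 0" "\<And>x a v. x \<in> X \<Longrightarrow> \<bar>a\<bar> \<le> 1 \<Longrightarrow> \<bar>\<kappa> x a v\<bar> \<le> K * norm v"
    using \<kappa>_uniform[of 1] by blast
  define q where "q = exp (- \<sigma>)"
  have q: "0 < q" "q < 1" using D(1) by (auto simp: q_def)
  define C where "C = K * D / (1 - q)"
  have C: "C > 0" using K D q by (simp add: C_def)
  have step: "\<bar>\<kappa> x (real (Suc n)) v - \<kappa> x (real n) v\<bar> \<le> K * D * norm v * q ^ n"
    if "x \<in> X" "v \<in> Stable" for x v n
  proof -
    have "\<kappa> x (real (Suc n)) v - \<kappa> x (real n) v = \<kappa> (\<phi> (real n) x) 1 (L (real n) v)"
      using \<kappa>_add[OF that(1), of "real n" 1 v] by (simp add: add.commute)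
    also have "\<bar>\<dots>\<bar> \<le> K * norm (L (real n) v)" by (rule K(2)) (use closed that in auto)
    also have "\<dots> \<le> K * (D * exp (- \<sigma> * real n) * norm v)"
      by (intro mult_left_mono D(3) that(2)) (use K in auto)
    also have "exp (- \<sigma> * real n) = q ^ n" unfolding q_def by (simp add: exp_of_nat_mult[symmetric] mult.commute)
    finally show ?thesis by (simp add: mult_ac)
  qed
  have main: "(\<lambda>n. \<kappa> x (real n) v) \<longlonglongrightarrow> \<eta> x v"
    "\<bar>\<eta> x v - \<kappa> x (real n) v\<bar> \<le> C * q ^ n * norm v"
    if "x \<in> X" "v \<in> Stable" for x v n
  proof -
    define f where "f m = \<kappa> x (real m) v" for m
    have tail: "\<bar>f (n + k) - f n\<bar> \<le> C * q ^ n * norm v" for n k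
    proof -
      have "\<bar>f (n + k) - f n\<bar> \<le> K * D * norm v * q ^ n * ((1 - q ^ k) / (1 - q))"
      proof (induction k)
        case 0
        then show ?case by simp
      next
        case (Suc k)
        have "\<bar>f (n + Suc k) - f n\<bar> \<le> \<bar>f (n + k) - f n\<bar> + \<bar>f (Suc (n + k)) - f (n + k)\<bar>" by simp
        also have "\<dots> \<le> K * D * norm v * q ^ n * ((1 - q ^ k) / (1 - q)) + K * D * norm v * q ^ (n + k)"
          using Suc step[OF that, of "n + k"] by (auto simp: f_def)
        also have "\<dots> = K * D * norm v * q ^ n * ((1 - q ^ k) / (1 - q) + q ^ k)"
          by (simp add: power_add algebra_simps)
        also have "(1 - q ^ k) / (1 - q) + q ^ k = (1 - q ^ Suc k) / (1 - q)"
          using q by (simp add: field_simps)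
        finally show ?case .
      qed
      also have "\<dots> \<le> K * D * norm v * q ^ n * (1 / (1 - q))"
        using q K(1) D(2) by (intro mult_left_mono divide_right_mono) auto
      finally show ?thesis by (simp add: C_def mult_ac)
    qed
    have "Cauchy f"
    proof (rule metric_CauchyI)
      fix e :: real assume e: "e > 0"
      have "(\<lambda>n. C * q ^ n * norm v) \<longlonglongrightarrow> C * 0 * norm v"
        using q by (intro tendsto_intros LIMSEQ_power_zero) auto
      then have "\<forall>\<^sub>F n in sequentially. C * q ^ n * norm v < e / 2"
        using order_tendstoD(2)[of _ 0 sequentially "e / 2"] e by simp
      then obtain n where n: "C * q ^ n * norm v < e / 2" by (auto simp: eventually_sequentially)
      have "dist (f i) (f j) < e" if "i \<ge> n" "j \<ge> n" for i j
        using tail[of n "i - n"] tail[of n "j - n"] n that unfolding dist_real_def by auto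
      then show "\<exists>M. \<forall>m\<ge>M. \<forall>n\<ge>M. dist (f m) (f n) < e" by blast
    qed
    then show lim: "(\<lambda>n. \<kappa> x (real n) v) \<longlonglongrightarrow> \<eta> x v"
      unfolding \<eta>_def f_def using Cauchy_convergent_iff convergent_LIMSEQ_iff by blast
    have "(\<lambda>k. \<bar>f (n + k) - f n\<bar>) \<longlonglongrightarrow> \<bar>\<eta> x v - f n\<bar>"
      using LIMSEQ_ignore_initial_segment[OF lim, of n] unfolding f_def
      by (intro tendsto_intros) (simp add: add.commute)
    then have "\<bar>\<eta> x v - f n\<bar> \<le> C * q ^ n * norm v"
      by (rule tendsto_upperbound) (use tail in auto)
    then show "\<bar>\<eta> x v - \<kappa> x (real n) v\<bar> \<le> C * q ^ n * norm v" by (simp add: f_def)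
  qed
  show ?thesis by (rule that[OF C q]) (use main in auto)
qed

lemma \<eta>_lim: "x \<in> X \<Longrightarrow> v \<in> Stable \<Longrightarrow> (\<lambda>n. \<kappa> x (real n) v) \<longlonglongrightarrow> \<eta> x v"
  using \<eta>_convergence by metis

lemma \<eta>_linear:
  assumes x: "x \<in> X" and v: "v \<in> Stable" and w: "w \<in> Stable"
  shows "\<eta> x (v + w) = \<eta> x v + \<eta> x w" "\<eta> x (c *\<^sub>R v) = c * \<eta> x v"
proof -
  have "(\<lambda>n. \<kappa> x (real n) v + \<kappa> x (real n) w) \<longlonglongrightarrow> \<eta> x v + \<eta> x w"
    by (intro tendsto_add \<eta>_lim x v w)
  moreover have "(\<lambda>n. \<kappa> x (real n) (v + w)) \<longlonglongrightarrow> \<eta> x (v + w)"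
    by (intro \<eta>_lim x subspace_add[OF subspace_Stable] v w)
  ultimately show "\<eta> x (v + w) = \<eta> x v + \<eta> x w"
    using LIMSEQ_unique linear_add[OF \<kappa>_linear[OF x]] by auto
  have "(\<lambda>n. c * \<kappa> x (real n) v) \<longlonglongrightarrow> c * \<eta> x v"
    by (intro tendsto_mult tendsto_const \<eta>_lim x v)
  moreover have "(\<lambda>n. \<kappa> x (real n) (c *\<^sub>R v)) \<longlonglongrightarrow> \<eta> x (c *\<^sub>R v)"
    by (intro \<eta>_lim x subspace_scale[OF subspace_Stable] v)
  ultimately show "\<eta> x (c *\<^sub>R v) = c * \<eta> x v"
    using LIMSEQ_unique linear_cmul[OF \<kappa>_linear[OF x]] by auto
qed

text \<open>Splitting \<open>\<kappa> x (a + n) v\<close> in its two possible orders compares the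
  sequences at \<open>\<phi> a x\<close> and at \<open>x\<close>. Apart from
  \<open>\<kappa> x a v\<close> they differ by \<open>\<kappa> (\<phi> n x) a (L n v)\<close>, which
  vanishes in the limit because \<open>L n v\<close> does.\<close>

lemma \<eta>_invariance:
  assumes x: "x \<in> X" and v: "v \<in> Stable"
  shows "\<eta> (\<phi> a x) (L a v) = \<eta> x v - \<kappa> x a v"
proof -
  have "(\<lambda>n. \<kappa> (\<phi> a x) (real n) (L a v)) \<longlonglongrightarrow> \<eta> (\<phi> a x) (L a v)"
    by (intro \<eta>_lim closed x Stable_invariant v)
  moreover have "(\<lambda>n. \<kappa> (\<phi> a x) (real n) (L a v)) \<longlonglongrightarrow> \<eta> x v + 0 - \<kappa> x a v"
  proof -
    have eq: "\<kappa> (\<phi> a x) (real n) (L a v)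
        = \<kappa> x (real n) v + \<kappa> (\<phi> (real n) x) a (L (real n) v) - \<kappa> x a v" for n
      using \<kappa>_add[OF x, of a "real n" v] \<kappa>_add[OF x, of "real n" a v] by (simp add: add.commute)
    obtain K where K: "K > 0" "\<And>x b v. x \<in> X \<Longrightarrow> \<bar>b\<bar> \<le> \<bar>a\<bar> \<Longrightarrow> \<bar>\<kappa> x b v\<bar> \<le> K * norm v"
      using \<kappa>_uniform[of "\<bar>a\<bar>"] by blast
    obtain \<sigma> D where D: "\<sigma> > 0" "D > 0"
      "\<And>v t. v \<in> Stable \<Longrightarrow> t \<ge> 0 \<Longrightarrow> norm (L t v) \<le> D * exp (- \<sigma> * t) * norm v"
      using Stable_uniform by blast
    have "(\<lambda>n. \<kappa> (\<phi> (real n) x) a (L (real n) v)) \<longlonglongrightarrow> 0"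
    proof (rule Lim_null_comparison)
      show "\<forall>\<^sub>F n in sequentially. norm (\<kappa> (\<phi> (real n) x) a (L (real n) v)) \<le> K * (D * exp (- \<sigma>) ^ n * norm v)"
      proof (rule always_eventually, rule allI)
        fix n :: nat
        have "\<bar>\<kappa> (\<phi> (real n) x) a (L (real n) v)\<bar> \<le> K * norm (L (real n) v)"
          by (rule K(2)) (use closed x in auto)
        also have "\<dots> \<le> K * (D * exp (- \<sigma> * real n) * norm v)"
          by (intro mult_left_mono D(3) v) (use K in auto)
        finally show "norm (\<kappa> (\<phi> (real n) x) a (L (real n) v)) \<le> K * (D * exp (- \<sigma>) ^ n * norm v)"
          by (simp add: exp_of_nat_mult[symmetric] mult.commute)
      qed
      have "(\<lambda>n. K * (D * exp (- \<sigma>) ^ n * norm v)) \<longlonglongrightarrow> K * (D * 0 * norm v)"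
        by (intro tendsto_intros LIMSEQ_power_zero) (use D in auto)
      then show "(\<lambda>n. K * (D * exp (- \<sigma>) ^ n * norm v)) \<longlonglongrightarrow> 0" by simp
    qed
    then show ?thesis unfolding eq by (intro tendsto_intros \<eta>_lim x v)
  qed
  ultimately show ?thesis using LIMSEQ_unique by fastforce
qed

text \<open>A sum of increments of size \<open>exp (\<epsilon> * n)\<close> is of the order of its
  last term, so the cocycle grows no faster than the central vectors themselves, up to a
  constant.\<close>

lemma \<kappa>_center_forward:
  assumes "\<epsilon> > 0"
  obtains C where "C > 0" "\<And>x v a. x \<in> X \<Longrightarrow> \<phi> 0 x = x \<Longrightarrow> v \<in> Center \<Longrightarrow> a \<ge> 0 \<Longrightarrow> \<bar>\<kappa> x a v\<bar> \<le> C * exp (\<epsilon> * a) * norm v"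
proof -
  obtain D where D: "D > 0" "\<And>v t. v \<in> Center \<Longrightarrow> norm (L t v) \<le> D * exp (\<epsilon> * \<bar>t\<bar>) * norm v"
    using Center_uniform[OF assms] by blast
  obtain K where K: "K > 0" "\<And>x a v. x \<in> X \<Longrightarrow> \<bar>a\<bar> \<le> 1 \<Longrightarrow> \<bar>\<kappa> x a v\<bar> \<le> K * norm v"
    using \<kappa>_uniform[of 1] by blast
  \<comment> \<open>\<open>E\<close> solves \<open>E * exp \<epsilon> = E + K * D\<close>, so that
    the induction over integer times closes.\<close>
  define E where "E = K * D / (exp \<epsilon> - 1)"
  have E: "E > 0" "E * (exp \<epsilon> - 1) = K * D" using assms K D by (auto simp: E_def)
  have step: "\<bar>\<kappa> (\<phi> (real n) x) f (L (real n) v)\<bar> \<le> K * D * exp (\<epsilon> * real n) * norm v"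
    if "x \<in> X" "v \<in> Center" "\<bar>f\<bar> \<le> 1" for x v n f
  proof -
    have "\<bar>\<kappa> (\<phi> (real n) x) f (L (real n) v)\<bar> \<le> K * norm (L (real n) v)"
      by (rule K(2)) (use closed that in auto)
    also have "\<dots> \<le> K * (D * exp (\<epsilon> * \<bar>real n\<bar>) * norm v)"
      by (intro mult_left_mono D(2) that) (use K in auto)
    finally show ?thesis by (simp add: mult_ac)
  qed
  have nat: "\<bar>\<kappa> x (real n) v\<bar> \<le> E * exp (\<epsilon> * real n) * norm v"
    if "x \<in> X" "\<phi> 0 x = x" "v \<in> Center" for x v n
  proof (induction n)
    case 0
    then show ?case using \<kappa>_0[OF that(1,2), of v] E by simp
  next
    case (Suc n)
    have "\<kappa> x (real (Suc n)) v = \<kappa> x (real n) v + \<kappa> (\<phi> (real n) x) 1 (L (real n) v)"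
      using \<kappa>_add[OF that(1), of "real n" 1 v] by (simp add: add.commute)
    then have "\<bar>\<kappa> x (real (Suc n)) v\<bar> \<le> E * exp (\<epsilon> * real n) * norm v + E * (exp \<epsilon> - 1) * exp (\<epsilon> * real n) * norm v"
      using Suc step[OF that(1,3), of 1 n] unfolding E(2) by simp
    also have "\<dots> = E * exp (\<epsilon> * real (Suc n)) * norm v"
      by (simp add: algebra_simps exp_add)
    finally show ?case .
  qed
  have "\<bar>\<kappa> x a v\<bar> \<le> (E + K * D) * exp (\<epsilon> * a) * norm v"
    if "x \<in> X" "\<phi> 0 x = x" "v \<in> Center" "a \<ge> 0" for x v a
  proof -
    define n f where "n = nat \<lfloor>a\<rfloor>" and "f = a - real n"
    have f: "0 \<le> f" "f \<le> 1" unfolding f_def n_def using that by linarith+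
    have "\<kappa> x a v = \<kappa> x (real n) v + \<kappa> (\<phi> (real n) x) f (L (real n) v)"
      using \<kappa>_add[OF that(1), of "real n" f v] by (simp add: f_def)
    then have "\<bar>\<kappa> x a v\<bar> \<le> E * exp (\<epsilon> * real n) * norm v + K * D * exp (\<epsilon> * real n) * norm v"
      using nat[OF that(1-3), of n] step[OF that(1,3), of f n] f by simp
    also have "\<dots> = (E + K * D) * exp (\<epsilon> * real n) * norm v" by (simp add: algebra_simps)
    also have "\<dots> \<le> (E + K * D) * exp (\<epsilon> * a) * norm v"
      using E K D assms f by (intro mult_right_mono mult_left_mono) (auto simp: f_def)
    finally show ?thesis .
  qed
  then show ?thesis using that[of "E + K * D"] E K D by (auto simp: add_pos_pos)
qed

text \<open>The reversed cocycle supplies the negative times in \<open>\<kappa>_center\<close> and,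
  later, the limit \<open>\<eta>u\<close> on unstable vectors.\<close>

lemma cocycle_minus: "cocycle (\<lambda>t. L (- t)) X (\<lambda>t. \<phi> (- t)) (\<lambda>x a. \<kappa> x (- a))"
proof (rule cocycle.intro[OF linear_flow_minus], rule cocycle_axioms.intro)
  fix x s t a b v R assume x: "x \<in> X"
  show "\<phi> (- t) x \<in> X" using closed x by blast
  show "\<phi> (- (s + t)) x = \<phi> (- s) (\<phi> (- t) x)" using \<phi>_add[OF x, of "- s" "- t"] by simp
  show "linear (\<kappa> x (- a))" by (rule \<kappa>_linear[OF x])
  show "\<kappa> x (- (a + b)) v = \<kappa> x (- a) v + \<kappa> (\<phi> (- a) x) (- b) (L (- a) v)"
    using \<kappa>_add[OF x, of "- a" "- b" v] by simp
next
  fix R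
  show "\<exists>K. \<forall>x\<in>X. \<forall>a. \<bar>a\<bar> \<le> R \<longrightarrow> (\<forall>v. \<bar>\<kappa> x (- a) v\<bar> \<le> K * norm v)"
    using \<kappa>_bound[of R] by (metis abs_minus_cancel)
qed

lemma \<kappa>_center:
  assumes "\<epsilon> > 0"
  obtains C where "C > 0" "\<And>x v a. x \<in> X \<Longrightarrow> \<phi> 0 x = x \<Longrightarrow> v \<in> Center \<Longrightarrow> \<bar>\<kappa> x a v\<bar> \<le> C * exp (\<epsilon> * \<bar>a\<bar>) * norm v"
proof -
  obtain C where C: "C > 0" "\<And>x v a. x \<in> X \<Longrightarrow> \<phi> 0 x = x \<Longrightarrow> v \<in> Center \<Longrightarrow> a \<ge> 0 \<Longrightarrow> \<bar>\<kappa> x a v\<bar> \<le> C * exp (\<epsilon> * a) * norm v"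
    using \<kappa>_center_forward[OF assms] by blast
  obtain D where D: "D > 0" "\<And>x v a. x \<in> X \<Longrightarrow> \<phi> 0 x = x \<Longrightarrow> v \<in> Center \<Longrightarrow> a \<ge> 0 \<Longrightarrow> \<bar>\<kappa> x (- a) v\<bar> \<le> D * exp (\<epsilon> * a) * norm v"
    using cocycle.\<kappa>_center_forward[OF cocycle_minus assms] unfolding Center_minus minus_zero by metis
  have "\<bar>\<kappa> x a v\<bar> \<le> (C + D) * exp (\<epsilon> * \<bar>a\<bar>) * norm v" if "x \<in> X" "\<phi> 0 x = x" "v \<in> Center" for x v a
  proof (cases "a \<ge> 0")
    case True
    have "\<bar>\<kappa> x a v\<bar> \<le> C * exp (\<epsilon> * \<bar>a\<bar>) * norm v" using C(2)[OF that True] True by simp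
    also have "\<dots> \<le> (C + D) * exp (\<epsilon> * \<bar>a\<bar>) * norm v" using D by (intro mult_right_mono) auto
    finally show ?thesis .
  next
    case False
    have "\<bar>\<kappa> x a v\<bar> \<le> D * exp (\<epsilon> * \<bar>a\<bar>) * norm v" using D(2)[OF that, of "- a"] False by simp
    also have "\<dots> \<le> (C + D) * exp (\<epsilon> * \<bar>a\<bar>) * norm v" using C by (intro mult_right_mono) auto
    finally show ?thesis .
  qed
  then show ?thesis using that[of "C + D"] C D by auto
qed

end

section \<open>Derivatives in charts\<close>

locale smooth_mfd =
  fixes M :: "('a, 'e::euclidean_space) manifold"
  assumes smooth: "smooth_manifold M"
begin

lemma chart_subset: "c \<in> atlas M \<Longrightarrow> fst c \<subseteq> topspace (mtop M)"
  using smooth unfolding smooth_manifold_def by blast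

lemma chart_point: "c \<in> atlas M \<Longrightarrow> x \<in> fst c \<Longrightarrow> x \<in> topspace (mtop M)"
  using chart_subset by blast

lemma chart_openin: "c \<in> atlas M \<Longrightarrow> openin (mtop M) (fst c)"
  using smooth unfolding smooth_manifold_def by blast

lemma chart_image_open: "c \<in> atlas M \<Longrightarrow> open (snd c ` fst c)"
  using smooth unfolding smooth_manifold_def by blast

lemma chart_homeo:
  "c \<in> atlas M \<Longrightarrow> homeomorphic_map (subtopology (mtop M) (fst c)) (top_of_set (snd c ` fst c)) (snd c)"
  using smooth unfolding smooth_manifold_def by blast

lemma chart_inj: "c \<in> atlas M \<Longrightarrow> inj_on (snd c) (fst c)"
  using chart_homeo[of c] chart_subset[of c]
  by (auto dest!: homeomorphic_imp_injective_map simp: inf_absorb2)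

lemma chart_inv_left [simp]: "c \<in> atlas M \<Longrightarrow> x \<in> fst c \<Longrightarrow> chart_inv c (snd c x) = x"
  by (simp add: chart_inv_def chart_inj)

lemma chart_inv_right [simp]: "u \<in> snd c ` fst c \<Longrightarrow> snd c (chart_inv c u) = u"
  by (simp add: chart_inv_def f_inv_into_f)

lemma chart_inv_in: "u \<in> snd c ` fst c \<Longrightarrow> chart_inv c u \<in> fst c"
  by (simp add: chart_inv_def inv_into_into)

lemma chart_open_image:
  assumes "c \<in> atlas M" "openin (mtop M) U" "U \<subseteq> fst c"
  shows "open (snd c ` U)"
proof -
  have "openin (subtopology (mtop M) (fst c)) U"
    using assms by (simp add: openin_subset_topspace_eq openin_open_subtopology chart_openin)
  then have "openin (top_of_set (snd c ` fst c)) (snd c ` U)"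
    using homeomorphic_imp_open_map[OF chart_homeo[OF assms(1)]] by (simp add: open_map_def)
  then show ?thesis using chart_image_open[OF assms(1)] openin_open_trans by blast
qed

lemma chart_at: assumes "x \<in> topspace (mtop M)" shows "chart_at M x \<in> atlas M" "x \<in> fst (chart_at M x)"
proof -
  have "\<exists>c. c \<in> atlas M \<and> x \<in> fst c" using assms smooth unfolding smooth_manifold_def by auto
  from someI_ex[OF this] show "chart_at M x \<in> atlas M" "x \<in> fst (chart_at M x)"
    unfolding chart_at_def by auto
qed

end

text \<open>
  Continuity is only required at the point, and no condition is imposed elsewhere, so that maps
  which are well-behaved only near the point can be differentiated.
\<close>

definition cont_at :: "('a, 'e) manifold \<Rightarrow> ('b, 'f) manifold \<Rightarrow> ('a \<Rightarrow> 'b) \<Rightarrow> 'a \<Rightarrow> bool" where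
  "cont_at M N f x \<longleftrightarrow> x \<in> topspace (mtop M) \<and>
     (\<forall>V. openin (mtop N) V \<and> f x \<in> V \<longrightarrow> (\<exists>U. openin (mtop M) U \<and> x \<in> U \<and> f ` U \<subseteq> V))"

text \<open>The two charts are explicit here, whereas \<open>mderiv\<close> is tied to the preferred
  charts. Like \<open>has_mderiv\<close>, it is a relation and so includes differentiability, which
  a value of \<open>frechet_derivative\<close> alone does not express.\<close>

definition has_cderiv ::
  "('a, 'e::euclidean_space) chart \<Rightarrow> ('b, 'f::euclidean_space) chart \<Rightarrow> ('a \<Rightarrow> 'b) \<Rightarrow> 'a \<Rightarrow> ('e \<Rightarrow> 'f) \<Rightarrow> bool"
  where "has_cderiv c d f x D \<longleftrightarrow> (snd d \<circ> f \<circ> chart_inv c has_derivative D) (at (snd c x))"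

definition has_mderiv ::
  "('a, 'e::euclidean_space) manifold \<Rightarrow> ('b, 'f::euclidean_space) manifold \<Rightarrow> ('a \<Rightarrow> 'b) \<Rightarrow> 'a \<Rightarrow> ('e \<Rightarrow> 'f) \<Rightarrow> bool"
  where "has_mderiv M N f x D \<longleftrightarrow> cont_at M N f x \<and> f x \<in> topspace (mtop N) \<and>
     has_cderiv (chart_at M x) (chart_at N (f x)) f x D"

lemma cont_at_continuous_map:
  "continuous_map (mtop M) (mtop N) f \<Longrightarrow> x \<in> topspace (mtop M) \<Longrightarrow> cont_at M N f x"
  unfolding cont_at_def continuous_map_def
  by (auto intro!: exI[of _ "{y \<in> topspace (mtop M). f y \<in> V}" for V])

lemma cont_at_id: "x \<in> topspace (mtop M) \<Longrightarrow> cont_at M M (\<lambda>x. x) x"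
  unfolding cont_at_def by auto

lemma cont_at_compose:
  "cont_at M N f x \<Longrightarrow> cont_at N P g (f x) \<Longrightarrow> cont_at M P (\<lambda>x. g (f x)) x"
  unfolding cont_at_def image_subset_iff by meson

lemma cont_at_cong:
  assumes "cont_at M N f x" "openin (mtop M) U" "x \<in> U" "\<And>y. y \<in> U \<Longrightarrow> f y = g y"
  shows "cont_at M N g x"
  unfolding cont_at_def
proof (intro conjI allI impI)
  fix V assume V: "openin (mtop N) V \<and> g x \<in> V"
  then obtain U' where U': "openin (mtop M) U'" "x \<in> U'" "f ` U' \<subseteq> V"
    using assms unfolding cont_at_def by metis
  show "\<exists>U. openin (mtop M) U \<and> x \<in> U \<and> g ` U \<subseteq> V"
    by (rule exI[of _ "U \<inter> U'"]) (use U' assms(2-4) in \<open>auto simp: openin_Int image_subset_iff\<close>)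
qed (use assms in \<open>simp add: cont_at_def\<close>)

lemma mderiv_eq: "has_mderiv M N f x D \<Longrightarrow> mderiv M N f x = D"
  unfolding has_mderiv_def has_cderiv_def mderiv_def using frechet_derivative_at by metis

text \<open>The intermediate chart \<open>d\<close> cancels only where \<open>f\<close> takes values
  in its domain; continuity of \<open>f\<close> at the point provides a neighbourhood of such
  points.\<close>

lemma has_cderiv_compose:
  assumes M: "smooth_manifold M" and N: "smooth_manifold N"
    and f: "cont_at M N f x" and c: "c \<in> atlas M" "x \<in> fst c" and d: "d \<in> atlas N" "f x \<in> fst d"
    and D: "has_cderiv c d f x D" and g: "has_cderiv d e g (f x) D'"
  shows "has_cderiv c e (\<lambda>x. g (f x)) x (\<lambda>v. D' (D v))"
proof -
  interpret M: smooth_mfd M by unfold_locales (rule M)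
  interpret N: smooth_mfd N by unfold_locales (rule N)
  obtain U where U: "openin (mtop M) U" "x \<in> U" "f ` U \<subseteq> fst d"
    using f d N.chart_openin unfolding cont_at_def by blast
  let ?W = "snd c ` (U \<inter> fst c)"
  have "((snd e \<circ> g \<circ> chart_inv d) \<circ> (snd d \<circ> f \<circ> chart_inv c) has_derivative D' \<circ> D) (at (snd c x))"
    by (rule diff_chain_at) (use D g c d in \<open>simp_all add: has_cderiv_def\<close>)
  then have "(snd e \<circ> (\<lambda>x. g (f x)) \<circ> chart_inv c has_derivative D' \<circ> D) (at (snd c x))"
  proof (rule has_derivative_transform_within_open)
    show "open ?W"
      by (rule M.chart_open_image[OF c(1)]) (use U c M.chart_openin in \<open>auto simp: openin_Int\<close>)
    show "snd c x \<in> ?W" using U c by auto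
    show "(snd e \<circ> g \<circ> chart_inv d \<circ> (snd d \<circ> f \<circ> chart_inv c)) u = (snd e \<circ> (\<lambda>x. g (f x)) \<circ> chart_inv c) u"
      if "u \<in> ?W" for u using that U c d by auto
  qed
  then show ?thesis unfolding has_cderiv_def by (simp add: comp_def)
qed

lemma has_cderiv_cong:
  assumes M: "smooth_manifold M" and c: "c \<in> atlas M" "x \<in> fst c"
    and U: "openin (mtop M) U" "x \<in> U" "\<And>y. y \<in> U \<Longrightarrow> f y = g y" and f: "has_cderiv c d f x D"
  shows "has_cderiv c d g x D"
proof -
  interpret M: smooth_mfd M by unfold_locales (rule M)
  show ?thesis
    unfolding has_cderiv_def
  proof (rule has_derivative_transform_within_open[OF f[unfolded has_cderiv_def]])
    show "open (snd c ` (U \<inter> fst c))"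
      by (rule M.chart_open_image[OF c(1)]) (use U c M.chart_openin in \<open>auto simp: openin_Int\<close>)
  qed (use U c in auto)
qed

context smooth_mfd
begin

lemma has_cderiv_coord_change:
  assumes "c \<in> atlas M" "d \<in> atlas M" "x \<in> fst c" "x \<in> fst d"
  shows "has_cderiv c d (\<lambda>x. x) x (coord_change c d x)"
proof -
  have "smooth_on (snd c ` (fst c \<inter> fst d)) (snd d \<circ> chart_inv c)"
    using smooth assms unfolding smooth_manifold_def by blast
  then have "Ck_on (Suc 0) (snd c ` (fst c \<inter> fst d)) (snd d \<circ> chart_inv c)"
    unfolding smooth_on_def by blast
  from Ck_on_Suc_has_derivative[OF this, of "snd c x"] assms
  show ?thesis unfolding has_cderiv_def coord_change_def by (auto simp: comp_def)
qed

lemma linear_coord_change: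
  assumes "c \<in> atlas M" "d \<in> atlas M" "x \<in> fst c" "x \<in> fst d"
  shows "linear (coord_change c d x)"
  using has_derivative_linear[OF has_cderiv_coord_change[OF assms, unfolded has_cderiv_def]] .

lemma coord_change_compose:
  assumes "c \<in> atlas M" "d \<in> atlas M" "e \<in> atlas M" "x \<in> fst c" "x \<in> fst d" "x \<in> fst e"
  shows "coord_change d e x (coord_change c d x v) = coord_change c e x v"
proof -
  have "has_cderiv c e (\<lambda>x. x) x (\<lambda>v. coord_change d e x (coord_change c d x v))"
    by (rule has_cderiv_compose[OF smooth smooth cont_at_id assms(1,4,2,5)])
       (use assms in \<open>auto intro: chart_point has_cderiv_coord_change\<close>)
  moreover have "has_cderiv c e (\<lambda>x. x) x (coord_change c e x)"
    by (rule has_cderiv_coord_change) (use assms in auto)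
  ultimately show ?thesis unfolding has_cderiv_def using has_derivative_unique by metis
qed

lemma coord_change_self:
  assumes "c \<in> atlas M" "x \<in> fst c"
  shows "coord_change c c x v = v"
proof -
  have "((\<lambda>u. u) has_derivative (\<lambda>v. v)) (at (snd c x))" by (rule has_derivative_ident)
  then have "(snd c \<circ> (\<lambda>x. x) \<circ> chart_inv c has_derivative (\<lambda>v. v)) (at (snd c x))"
    by (rule has_derivative_transform_within_open[OF _ chart_image_open[OF assms(1)]])
       (use assms in auto)
  moreover have "has_cderiv c c (\<lambda>x. x) x (coord_change c c x)"
    by (rule has_cderiv_coord_change) (use assms in auto)
  ultimately show ?thesis unfolding has_cderiv_def using has_derivative_unique by metis
qed

lemma coord_change_inverse:
  assumes "c \<in> atlas M" "d \<in> atlas M" "x \<in> fst c" "x \<in> fst d"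
  shows "coord_change d c x (coord_change c d x v) = v"
  using coord_change_compose[OF assms(1,2,1,3,4,3)] coord_change_self[OF assms(1,3)] by simp

end

lemma has_cderiv_change:
  assumes M: "smooth_manifold M" and N: "smooth_manifold N" and f: "cont_at M N f x"
    and c: "c \<in> atlas M" "x \<in> fst c" "c' \<in> atlas M" "x \<in> fst c'"
    and d: "d \<in> atlas N" "f x \<in> fst d" "d' \<in> atlas N" "f x \<in> fst d'" and D: "has_cderiv c d f x D"
  shows "has_cderiv c' d' f x (\<lambda>v. coord_change d d' (f x) (D (coord_change c' c x v)))"
proof -
  interpret M: smooth_mfd M by unfold_locales (rule M)
  interpret N: smooth_mfd N by unfold_locales (rule N)
  have x: "cont_at M M (\<lambda>x. x) x"
    using c by (intro cont_at_id M.chart_point)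
  have "has_cderiv c' d f x (\<lambda>v. D (coord_change c' c x v))"
    by (rule has_cderiv_compose[OF M M x c(3,4,1,2) M.has_cderiv_coord_change D]) (use c in auto)
  then show ?thesis
    by (rule has_cderiv_compose[OF M N f c(3,4) d(1,2) _ N.has_cderiv_coord_change]) (use d in auto)
qed

lemma has_mderivI:
  assumes M: "smooth_manifold M" and N: "smooth_manifold N" and f: "cont_at M N f x"
    and c: "c \<in> atlas M" "x \<in> fst c" and d: "d \<in> atlas N" "f x \<in> fst d" and D: "has_cderiv c d f x D"
  shows "has_mderiv M N f x (\<lambda>v. coord_change d (chart_at N (f x)) (f x) (D (coord_change (chart_at M x) c x v)))"
proof -
  interpret M: smooth_mfd M by unfold_locales (rule M)
  interpret N: smooth_mfd N by unfold_locales (rule N)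
  have x: "x \<in> topspace (mtop M)" "f x \<in> topspace (mtop N)"
    using M.chart_point[OF c] N.chart_point[OF d] by auto
  show ?thesis
    unfolding has_mderiv_def
    using has_cderiv_change[OF M N f c M.chart_at[OF x(1)] d N.chart_at[OF x(2)] D] f x by blast
qed

lemma has_mderivD:
  assumes M: "smooth_manifold M" and N: "smooth_manifold N" and f: "has_mderiv M N f x D"
    and c: "c \<in> atlas M" "x \<in> fst c" and d: "d \<in> atlas N" "f x \<in> fst d"
  shows "has_cderiv c d f x (\<lambda>v. coord_change (chart_at N (f x)) d (f x) (D (coord_change c (chart_at M x) x v)))"
proof -
  interpret M: smooth_mfd M by unfold_locales (rule M)
  interpret N: smooth_mfd N by unfold_locales (rule N)
  have x: "x \<in> topspace (mtop M)" "f x \<in> topspace (mtop N)"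
    using M.chart_point[OF c] N.chart_point[OF d] by auto
  show ?thesis
    by (rule has_cderiv_change[where f = f, OF M N _ M.chart_at[OF x(1)] c N.chart_at[OF x(2)] d])
       (use f in \<open>auto simp: has_mderiv_def\<close>)
qed

lemma has_mderiv_compose:
  assumes M: "smooth_manifold M" and N: "smooth_manifold N"
    and f: "has_mderiv M N f x D" and g: "has_mderiv N P g (f x) D'"
  shows "has_mderiv M P (\<lambda>x. g (f x)) x (\<lambda>v. D' (D v))"
proof -
  interpret M: smooth_mfd M by unfold_locales (rule M)
  interpret N: smooth_mfd N by unfold_locales (rule N)
  have x: "x \<in> topspace (mtop M)" "f x \<in> topspace (mtop N)"
    using f unfolding has_mderiv_def cont_at_def by auto
  show ?thesis
    unfolding has_mderiv_def
  proof (intro conjI)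
    show "cont_at M P (\<lambda>x. g (f x)) x" "g (f x) \<in> topspace (mtop P)"
      using f g cont_at_compose[of M N f x P g] unfolding has_mderiv_def by auto
    show "has_cderiv (chart_at M x) (chart_at P (g (f x))) (\<lambda>x. g (f x)) x (\<lambda>v. D' (D v))"
      by (rule has_cderiv_compose[where f = f and g = g and D = D,
            OF M N _ M.chart_at[OF x(1)] N.chart_at[OF x(2)]])
         (use f g in \<open>auto simp: has_mderiv_def\<close>)
  qed
qed

lemma has_mderiv_cong:
  assumes M: "smooth_manifold M" and f: "has_mderiv M N f x D"
    and U: "openin (mtop M) U" "x \<in> U" "\<And>y. y \<in> U \<Longrightarrow> f y = g y"
  shows "has_mderiv M N g x D"
proof -
  interpret M: smooth_mfd M by unfold_locales (rule M)
  have "x \<in> topspace (mtop M)" using f unfolding has_mderiv_def cont_at_def by auto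
  note c = M.chart_at[OF this]
  have eq: "f x = g x" using U by blast
  have "cont_at M N g x"
    by (rule cont_at_cong[where f = f, OF _ U]) (use f in \<open>auto simp: has_mderiv_def\<close>)
  moreover have "has_cderiv (chart_at M x) (chart_at N (f x)) g x D"
    by (rule has_cderiv_cong[where f = f, OF M c U]) (use f in \<open>auto simp: has_mderiv_def\<close>)
  ultimately show ?thesis using f unfolding has_mderiv_def eq by blast
qed

lemma has_mderiv_id:
  assumes M: "smooth_manifold M" and x: "x \<in> topspace (mtop M)"
  shows "has_mderiv M M (\<lambda>x. x) x (\<lambda>v. v)"
proof -
  interpret M: smooth_mfd M by unfold_locales (rule M)
  note c = M.chart_at[OF x]
  have "coord_change (chart_at M x) (chart_at M x) x = (\<lambda>v. v)"
    using M.coord_change_self[OF c] by blast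
  then show ?thesis
    unfolding has_mderiv_def using cont_at_id[OF x] x M.has_cderiv_coord_change[OF c(1) c(1) c(2) c(2)] by simp
qed

lemma linear_has_mderiv: "has_mderiv M N f x D \<Longrightarrow> linear D"
  unfolding has_mderiv_def has_cderiv_def by (auto intro: has_derivative_linear)

lemma
  assumes f: "smooth_map M N f" and c: "c \<in> atlas M" and d: "d \<in> atlas N"
  shows smooth_map_chart_Ck: "Ck_on n (snd c ` {x \<in> fst c. f x \<in> fst d}) (snd d \<circ> f \<circ> chart_inv c)"
    and smooth_map_has_cderiv: "x \<in> fst c \<Longrightarrow> f x \<in> fst d \<Longrightarrow>
      has_cderiv c d f x (frechet_derivative (snd d \<circ> f \<circ> chart_inv c) (at (snd c x)))"
proof -
  show Ck: "Ck_on n (snd c ` {x \<in> fst c. f x \<in> fst d}) (snd d \<circ> f \<circ> chart_inv c)" for n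
    using f c d unfolding smooth_map_def smooth_on_def by blast
  show "has_cderiv c d f x (frechet_derivative (snd d \<circ> f \<circ> chart_inv c) (at (snd c x)))"
    if "x \<in> fst c" "f x \<in> fst d"
    unfolding has_cderiv_def by (rule Ck_on_Suc_has_derivative[OF Ck[of "Suc 0"]]) (use that in auto)
qed

lemma smooth_map_has_mderiv:
  assumes M: "smooth_manifold M" and N: "smooth_manifold N" and f: "smooth_map M N f"
    and x: "x \<in> topspace (mtop M)"
  shows "has_mderiv M N f x (mderiv M N f x)"
proof -
  interpret M: smooth_mfd M by unfold_locales (rule M)
  interpret N: smooth_mfd N by unfold_locales (rule N)
  have cont: "continuous_map (mtop M) (mtop N) f" using f unfolding smooth_map_def by blast
  then have fx: "f x \<in> topspace (mtop N)" using x unfolding continuous_map_def by auto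
  have "has_cderiv (chart_at M x) (chart_at N (f x)) f x (mderiv M N f x)"
    unfolding mderiv_def
    by (rule smooth_map_has_cderiv[where f = f, OF f])
       (use M.chart_at[OF x] N.chart_at[OF fx] in auto)
  then show ?thesis
    unfolding has_mderiv_def using cont_at_continuous_map[OF cont x] fx by blast
qed

section \<open>Euclidean space as a manifold\<close>

lemma smooth_manifold_euclidean: "smooth_manifold (euclidean_manifold :: ('e::euclidean_space, 'e) manifold)"
proof -
  have inv: "chart_inv (UNIV, id) = (id :: 'e \<Rightarrow> 'e)"
    by (simp add: chart_inv_def)
  have "second_countable (euclidean :: 'e topology)"
  proof -
    obtain B :: "'e set set" where B: "countable B" "topological_basis B"
      using ex_countable_basis by blast
    have "\<exists>V\<in>B. x \<in> V \<and> V \<subseteq> U" if "open U" "x \<in> U" for U x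
      using topological_basisE[OF B(2) that] by metis
    then show ?thesis
      unfolding second_countable_def using B(1) topological_basis_open[OF B(2)]
      by (intro exI[of _ B]) simp
  qed
  moreover have "smooth_on (UNIV :: 'e set) id"
    unfolding smooth_on_def id_def by (intro allI Ck_on_id open_UNIV)
  ultimately show ?thesis
    unfolding smooth_manifold_def euclidean_manifold_def by (simp add: inv Hausdorff_space_euclidean)
qed

lemma chart_at_euclidean [simp]: "chart_at euclidean_manifold x = (UNIV, id)"
  by (auto simp: chart_at_def euclidean_manifold_def)

lemma mtop_euclidean_manifold [simp]: "mtop euclidean_manifold = euclidean"
  by (simp add: euclidean_manifold_def)

lemma atlas_euclidean_manifold [simp]: "atlas euclidean_manifold = {(UNIV, id)}"
  by (simp add: euclidean_manifold_def)

lemma chart_inv_euclidean [simp]: "chart_inv (UNIV, id) = id"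
  by (simp add: chart_inv_def)

section \<open>Products, sections and metrics\<close>

text \<open>The coordinate domain in the definition of \<open>smooth_map\<close> for a product
  source, rewritten in terms of the two coordinates (\<open>prod_dom_eq\<close>), which avoids the
  inverse of a product chart.\<close>

definition prod_dom ::
  "('a, 'e::euclidean_space) chart \<Rightarrow> ('b, 'f::euclidean_space) chart \<Rightarrow> ('c, 'h) chart \<Rightarrow> ('a \<times> 'b \<Rightarrow> 'c) \<Rightarrow> ('e \<times> 'f) set"
  where "prod_dom c d e f =
    {(u, v). u \<in> snd c ` fst c \<and> v \<in> snd d ` fst d \<and> f (chart_inv c u, chart_inv d v) \<in> fst e}"

lemma chart_inv_prod:
  assumes "inj_on (snd c) (fst c)" "inj_on (snd d) (fst d)" "u \<in> snd c ` fst c" "v \<in> snd d ` fst d"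
  shows "chart_inv (fst c \<times> fst d, map_prod (snd c) (snd d)) (u, v) = (chart_inv c u, chart_inv d v)"
  unfolding chart_inv_def fst_conv snd_conv
proof (rule inv_into_f_eq)
  show "inj_on (map_prod (snd c) (snd d)) (fst c \<times> fst d)"
    by (rule map_prod_inj_on[OF assms(1,2)])
qed (use assms(3,4) in \<open>auto simp: inv_into_into f_inv_into_f\<close>)

lemma prod_dom_eq:
  assumes "inj_on (snd c) (fst c)" "inj_on (snd d) (fst d)"
  shows "map_prod (snd c) (snd d) ` {x \<in> fst c \<times> fst d. f x \<in> fst e} = prod_dom c d e f"
  using assms unfolding prod_dom_def by (force simp: chart_inv_def)

context
  fixes M :: "('a, 'e::euclidean_space) manifold" and N :: "('b, 'f::euclidean_space) manifold"
    and P :: "('c, 'h::euclidean_space) manifold" and f :: "'a \<times> 'b \<Rightarrow> 'c"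
  assumes M: "smooth_manifold M" and N: "smooth_manifold N" and P: "smooth_manifold P"
begin

interpretation M: smooth_mfd M by unfold_locales (rule M)
interpretation N: smooth_mfd N by unfold_locales (rule N)
interpretation P: smooth_mfd P by unfold_locales (rule P)

lemma prod_dom_open:
  assumes f: "continuous_map (prod_topology (mtop M) (mtop N)) (mtop P) f"
    and c: "c \<in> atlas M" and d: "d \<in> atlas N" and e: "e \<in> atlas P"
  shows "open (prod_dom c d e f)"
proof -
  let ?S = "{p \<in> topspace (prod_topology (mtop M) (mtop N)). f p \<in> fst e}"
  have S: "openin (prod_topology (mtop M) (mtop N)) ?S"
    using f P.chart_openin[OF e] unfolding continuous_map_def by blast
  show ?thesis
    unfolding open_prod_def
  proof
    fix p assume "p \<in> prod_dom c d e f"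
    then obtain x y where xy: "p = (snd c x, snd d y)" "x \<in> fst c" "y \<in> fst d" "f (x, y) \<in> fst e"
      unfolding prod_dom_def using c d by auto
    then have "(x, y) \<in> ?S" using M.chart_point[OF c] N.chart_point[OF d] by auto
    then obtain U V where UV: "openin (mtop M) U" "openin (mtop N) V" "x \<in> U" "y \<in> V" "U \<times> V \<subseteq> ?S"
      using S unfolding openin_prod_topology_alt by meson
    let ?A = "snd c ` (U \<inter> fst c)" and ?B = "snd d ` (V \<inter> fst d)"
    have "open ?A" by (rule M.chart_open_image[OF c]) (use UV M.chart_openin[OF c] in \<open>auto simp: openin_Int\<close>)
    moreover have "open ?B" by (rule N.chart_open_image[OF d]) (use UV N.chart_openin[OF d] in \<open>auto simp: openin_Int\<close>)
    moreover have "?A \<times> ?B \<subseteq> prod_dom c d e f"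
      using UV(5) c d unfolding prod_dom_def by auto
    ultimately show "\<exists>A B. open A \<and> open B \<and> p \<in> A \<times> B \<and> A \<times> B \<subseteq> prod_dom c d e f"
      using xy UV(3,4) by (intro exI[of _ ?A] exI[of _ ?B]) auto
  qed
qed

lemma smooth_map_prod_Ck:
  assumes f: "smooth_map (prod_manifold M N) P f"
    and c: "c \<in> atlas M" and d: "d \<in> atlas N" and e: "e \<in> atlas P"
  shows "open (prod_dom c d e f)"
    and "Ck_on n (prod_dom c d e f) (\<lambda>(u, v). snd e (f (chart_inv c u, chart_inv d v)))"
proof -
  have cont: "continuous_map (prod_topology (mtop M) (mtop N)) (mtop P) f"
    using f unfolding smooth_map_def prod_manifold_def by simp
  show o: "open (prod_dom c d e f)" by (rule prod_dom_open[OF cont c d e])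
  let ?C = "(fst c \<times> fst d, map_prod (snd c) (snd d))"
  have "?C \<in> atlas (prod_manifold M N)"
    using c d by (simp add: prod_manifold_def del: split_paired_Ex) blast
  then have "Ck_on n (snd ?C ` {x \<in> fst ?C. f x \<in> fst e}) (snd e \<circ> f \<circ> chart_inv ?C)"
    using f e unfolding smooth_map_def smooth_on_def by blast
  then have "Ck_on n (prod_dom c d e f) (snd e \<circ> f \<circ> chart_inv ?C)"
    unfolding fst_conv snd_conv prod_dom_eq[OF M.chart_inj[OF c] N.chart_inj[OF d]] .
  then show "Ck_on n (prod_dom c d e f) (\<lambda>(u, v). snd e (f (chart_inv c u, chart_inv d v)))"
    by (rule Ck_on_cong[OF o, rotated])
       (auto simp: prod_dom_def chart_inv_prod[OF M.chart_inj[OF c] N.chart_inj[OF d]])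
qed

lemma smooth_map_prodI:
  assumes cont: "continuous_map (prod_topology (mtop M) (mtop N)) (mtop P) f"
    and Ck: "\<And>c d e n. c \<in> atlas M \<Longrightarrow> d \<in> atlas N \<Longrightarrow> e \<in> atlas P \<Longrightarrow>
      Ck_on n (prod_dom c d e f) (\<lambda>(u, v). snd e (f (chart_inv c u, chart_inv d v)))"
  shows "smooth_map (prod_manifold M N) P f"
  unfolding smooth_map_def
proof (intro conjI ballI)
  show "continuous_map (mtop (prod_manifold M N)) (mtop P) f"
    using cont by (simp add: prod_manifold_def)
  fix C e assume "C \<in> atlas (prod_manifold M N)" and e: "e \<in> atlas P"
  then obtain c d where c: "c \<in> atlas M" and d: "d \<in> atlas N"
    and C: "C = (fst c \<times> fst d, map_prod (snd c) (snd d))"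
    unfolding prod_manifold_def by auto
  have "Ck_on n (prod_dom c d e f) (snd e \<circ> f \<circ> chart_inv C)" for n
    by (rule Ck_on_cong[OF prod_dom_open[OF cont c d e] _ Ck[OF c d e]])
       (auto simp: C prod_dom_def chart_inv_prod[OF M.chart_inj[OF c] N.chart_inj[OF d]])
  then show "smooth_on (snd C ` {x \<in> fst C. f x \<in> fst e}) (snd e \<circ> f \<circ> chart_inv C)"
    unfolding smooth_on_def C fst_conv snd_conv prod_dom_eq[OF M.chart_inj[OF c] N.chart_inj[OF d]] by blast
qed

end

lemma continuous_map_local:
  assumes "\<And>x. x \<in> topspace X \<Longrightarrow> \<exists>U. openin X U \<and> x \<in> U \<and> continuous_map (subtopology X U) Y f"
  shows "continuous_map X Y f"
  unfolding continuous_map_def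
proof (intro conjI allI impI)
  show "f \<in> topspace X \<rightarrow> topspace Y"
  proof
    fix x assume x: "x \<in> topspace X"
    with assms obtain U where "x \<in> U" "continuous_map (subtopology X U) Y f" by blast
    then show "f x \<in> topspace Y" using x unfolding continuous_map_def by auto
  qed
  fix V assume V: "openin Y V"
  show "openin X {x \<in> topspace X. f x \<in> V}"
  proof (subst openin_subopen, intro ballI)
    fix x assume x: "x \<in> {x \<in> topspace X. f x \<in> V}"
    with assms obtain U where U: "openin X U" "x \<in> U" "continuous_map (subtopology X U) Y f" by blast
    then have "openin (subtopology X U) {y \<in> topspace (subtopology X U). f y \<in> V}"
      using V unfolding continuous_map_def by blast
    then have "openin X {y \<in> topspace (subtopology X U). f y \<in> V}"
      using U(1) openin_trans_full by blast
    then show "\<exists>T. openin X T \<and> x \<in> T \<and> T \<subseteq> {x \<in> topspace X. f x \<in> V}"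
      using x U(2) by (intro exI[of _ "{y \<in> topspace (subtopology X U). f y \<in> V}"]) auto
  qed
qed

context smooth_mfd
begin

lemma continuous_map_chart:
  assumes "c \<in> atlas M" shows "continuous_map (subtopology (mtop M) (fst c)) euclidean (snd c)"
  using homeomorphic_imp_continuous_map[OF chart_homeo[OF assms]]
  by (simp add: continuous_map_in_subtopology)

text \<open>Time has one global chart, so the sets \<open>UNIV \<times> fst c\<close> cover the
  product and continuity can be tested in the coordinates of \<open>c\<close>.\<close>

lemma continuous_map_real_prod_charts:
  fixes \<alpha> :: "real \<times> 'a \<Rightarrow> 'b::topological_space"
  assumes "\<And>c. c \<in> atlas M \<Longrightarrow> continuous_on (UNIV \<times> snd c ` fst c) (\<lambda>(t, u). \<alpha> (t, chart_inv c u))"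
  shows "continuous_map (prod_topology euclidean (mtop M)) euclidean \<alpha>"
proof (rule continuous_map_local)
  fix p assume p: "p \<in> topspace (prod_topology (euclidean :: real topology) (mtop M))"
  define c where "c = chart_at M (snd p)"
  have c: "c \<in> atlas M" "snd p \<in> fst c" using chart_at p unfolding c_def by auto
  let ?U = "UNIV \<times> fst c"
  have sub: "subtopology (prod_topology (euclidean :: real topology) (mtop M)) ?U
    = prod_topology euclidean (subtopology (mtop M) (fst c))"
    by (simp add: prod_topology_subtopology)
  have "continuous_map (prod_topology euclidean (subtopology (mtop M) (fst c)))
      (top_of_set ((UNIV :: real set) \<times> snd c ` fst c)) (\<lambda>q. (fst q, snd c (snd q)))"
  proof -
    have "continuous_map (prod_topology (euclidean :: real topology) (subtopology (mtop M) (fst c)))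
        euclidean (\<lambda>q. snd c (snd q))"
      using continuous_map_compose[OF continuous_map_snd continuous_map_chart[OF c(1)]]
      by (simp add: comp_def)
    moreover have "continuous_map (prod_topology (euclidean :: real topology) (subtopology (mtop M) (fst c))) euclidean fst"
      by (rule continuous_map_fst)
    ultimately have "continuous_map (prod_topology (euclidean :: real topology) (subtopology (mtop M) (fst c)))
        euclidean (\<lambda>q. (fst q, snd c (snd q)))"
      unfolding prod_topology_euclidean[symmetric] by (intro continuous_map_pairedI)
    then show ?thesis by (auto simp: continuous_map_in_subtopology)
  qed
  moreover have "continuous_map (top_of_set (UNIV \<times> snd c ` fst c)) euclidean (\<lambda>(t, u). \<alpha> (t, chart_inv c u))"
    using assms[OF c(1)] by simp
  ultimately have "continuous_map (prod_topology euclidean (subtopology (mtop M) (fst c))) euclidean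
      ((\<lambda>(t, u). \<alpha> (t, chart_inv c u)) \<circ> (\<lambda>q. (fst q, snd c (snd q))))"
    by (rule continuous_map_compose)
  then have "continuous_map (prod_topology euclidean (subtopology (mtop M) (fst c))) euclidean \<alpha>"
    by (rule continuous_map_eq) (use c in auto)
  moreover have "openin (prod_topology euclidean (mtop M)) ?U"
    using chart_openin[OF c(1)] by (simp add: openin_prod_Times_iff)
  ultimately show "\<exists>U. openin (prod_topology euclidean (mtop M)) U \<and> p \<in> U
      \<and> continuous_map (subtopology (prod_topology euclidean (mtop M)) U) euclidean \<alpha>"
    using c by (intro exI[of _ ?U]) (auto simp: sub mem_Times_iff)
qed

text \<open>Continuity of a vector field along a map, \<open>s z\<close> being tangent at
  \<open>p z\<close>. Sections are the case where \<open>p\<close> is the identity;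
  \<open>orbit_bounded\<close> takes an orbit for \<open>p\<close>.\<close>

definition cont_along :: "'z topology \<Rightarrow> ('z \<Rightarrow> 'a) \<Rightarrow> ('z \<Rightarrow> 'e) \<Rightarrow> bool" where
  "cont_along X p s \<longleftrightarrow> (\<forall>c\<in>atlas M.
     continuous_map (subtopology X {z \<in> topspace X. p z \<in> fst c}) euclidean
       (\<lambda>z. coord_change (chart_at M (p z)) c (p z) (s z)))"

lemma cont_along_section: "continuous_section M (topspace (mtop M)) s \<longleftrightarrow> cont_along (mtop M) (\<lambda>x. x) s"
proof -
  have "topspace (mtop M) \<inter> fst c = {z \<in> topspace (mtop M). z \<in> fst c}" for c :: "('a, 'e) chart" by auto
  then show ?thesis unfolding continuous_section_def cont_along_def by simp
qed

text \<open>The preferred chart at \<open>p z\<close> may jump with \<open>z\<close>. In one fixed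
  chart around \<open>p z0\<close> both the coefficients of the metric and the coordinates of the
  two vectors are continuous, and bilinear expansion expresses the value through them.\<close>

lemma continuous_map_metric_along:
  assumes g: "riemannian_metric M g" and p: "continuous_map X (mtop M) p"
    and s: "cont_along X p s" "cont_along X p s'"
  shows "continuous_map X euclidean (\<lambda>z. g (p z) (s z) (s' z))"
proof (rule continuous_map_local)
  fix z0 assume z0: "z0 \<in> topspace X"
  then have "p z0 \<in> topspace (mtop M)" using p unfolding continuous_map_def by auto
  define c where "c = chart_at M (p z0)"
  have c: "c \<in> atlas M" "p z0 \<in> fst c" using chart_at[OF \<open>p z0 \<in> _\<close>] unfolding c_def by auto
  define U where "U = {z \<in> topspace X. p z \<in> fst c}"
  have U: "openin X U" "z0 \<in> U"
    using p chart_openin[OF c(1)] z0 c(2) unfolding U_def continuous_map_def by auto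
  define \<sigma> \<sigma>' where "\<sigma> z = coord_change (chart_at M (p z)) c (p z) (s z)"
    and "\<sigma>' z = coord_change (chart_at M (p z)) c (p z) (s' z)" for z
  define Gc where "Gc b b' y = (let x = chart_inv c y in
    g x (coord_change c (chart_at M x) x b) (coord_change c (chart_at M x) x b'))" for b b' y
  have pc: "continuous_map (subtopology X U) (subtopology (mtop M) (fst c)) p"
    using p by (auto simp: continuous_map_in_subtopology continuous_map_from_subtopology U_def)
  have Gcont: "continuous_on (snd c ` fst c) (Gc b b')" for b b'
  proof -
    have "smooth_on (snd c ` fst c) (Gc b b')"
      using g c(1) unfolding riemannian_metric_def Gc_def by blast
    then show ?thesis unfolding smooth_on_def using Ck_on_continuous_on by blast
  qed
  have "continuous_map (subtopology X U) euclidean (\<lambda>z. Gc b b' (snd c (p z)))" for b b'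
  proof -
    have "continuous_map (subtopology X U) (top_of_set (snd c ` fst c)) (snd c \<circ> p)"
      using continuous_map_compose[OF pc homeomorphic_imp_continuous_map[OF chart_homeo[OF c(1)]]] .
    from continuous_map_compose[OF this, of euclidean "Gc b b'"] Gcont
    show ?thesis by (simp add: comp_def)
  qed
  moreover have "continuous_map (subtopology X U) euclidean \<sigma>" "continuous_map (subtopology X U) euclidean \<sigma>'"
    using s c(1) unfolding cont_along_def \<sigma>_def \<sigma>'_def U_def by auto
  then have "continuous_map (subtopology X U) euclidean (\<lambda>z. \<sigma> z \<bullet> b)"
    "continuous_map (subtopology X U) euclidean (\<lambda>z. \<sigma>' z \<bullet> b)" for b
    using continuous_map_compose[of "subtopology X U" euclidean _ euclidean "\<lambda>v. v \<bullet> b"]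
    by (auto simp: comp_def continuous_on_inner continuous_on_id continuous_on_const)
  ultimately have "continuous_map (subtopology X U) euclidean
      (\<lambda>z. \<Sum>b\<in>Basis. \<Sum>b'\<in>Basis. (\<sigma> z \<bullet> b) * ((\<sigma>' z \<bullet> b') * Gc b b' (snd c (p z))))"
    by (intro continuous_map_sum finite_Basis continuous_map_real_mult)
  moreover have "(\<Sum>b\<in>Basis. \<Sum>b'\<in>Basis. (\<sigma> z \<bullet> b) * ((\<sigma>' z \<bullet> b') * Gc b b' (snd c (p z)))) = g (p z) (s z) (s' z)"
    if "z \<in> topspace (subtopology X U)" for z
  proof -
    have z: "p z \<in> fst c" "p z \<in> topspace (mtop M)" using that chart_point[OF c(1)] unfolding U_def by auto
    note d = chart_at[OF z(2)]
    let ?cc = "coord_change c (chart_at M (p z)) (p z)"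
    have lin: "linear ?cc" by (rule linear_coord_change[OF c(1) d(1) z(1) d(2)])
    have bil: "bilinear (g (p z))" using g z(2) unfolding riemannian_metric_def by blast
    have s_eq: "s z = ?cc (\<sigma> z)" "s' z = ?cc (\<sigma>' z)"
      unfolding \<sigma>_def \<sigma>'_def using coord_change_inverse[OF d(1) c(1) d(2) z(1)] by auto
    have "bilinear (\<lambda>v w. g (p z) (?cc v) (?cc w))"
      unfolding bilinear_def
    proof (intro conjI allI)
      fix v
      show "linear (\<lambda>w. g (p z) (?cc v) (?cc w))"
        using linear_compose[OF lin, of "g (p z) (?cc v)"] bil unfolding bilinear_def comp_def by blast
      show "linear (\<lambda>w. g (p z) (?cc w) (?cc v))"
        using linear_compose[OF lin, of "\<lambda>w. g (p z) w (?cc v)"] bil unfolding bilinear_def comp_def by blast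
    qed
    note bi = this
    have "g (p z) (s z) (s' z) = g (p z) (?cc (\<Sum>b\<in>Basis. (\<sigma> z \<bullet> b) *\<^sub>R b)) (?cc (\<Sum>b\<in>Basis. (\<sigma>' z \<bullet> b) *\<^sub>R b))"
      by (simp add: s_eq euclidean_representation)
    also have "\<dots> = (\<Sum>(b, b')\<in>Basis \<times> Basis. g (p z) (?cc ((\<sigma> z \<bullet> b) *\<^sub>R b)) (?cc ((\<sigma>' z \<bullet> b') *\<^sub>R b')))"
      by (rule bilinear_sum[OF bi])
    also have "\<dots> = (\<Sum>(b, b')\<in>Basis \<times> Basis. (\<sigma> z \<bullet> b) * ((\<sigma>' z \<bullet> b') * g (p z) (?cc b) (?cc b')))"
      by (intro sum.cong refl) (auto simp: bilinear_lmul[OF bi] bilinear_rmul[OF bi])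
    finally show ?thesis
      using z(1) c(1) by (simp add: sum.cartesian_product Gc_def Let_def)
  qed
  ultimately have "continuous_map (subtopology X U) euclidean (\<lambda>z. g (p z) (s z) (s' z))"
    by (rule continuous_map_eq)
  then show "\<exists>U. openin X U \<and> z0 \<in> U \<and> continuous_map (subtopology X U) euclidean (\<lambda>z. g (p z) (s z) (s' z))"
    using U by blast
qed

end

lemma compact_space_real_bounds:
  fixes f :: "'a \<Rightarrow> real"
  assumes "compact_space X" "continuous_map X euclidean f"
  obtains K where "K > 0" "\<And>x. x \<in> topspace X \<Longrightarrow> \<bar>f x\<bar> \<le> K"
proof -
  have "compact (f ` topspace X)"
    using image_compactin[OF _ assms(2)] assms(1) by (simp add: compact_space_def)
  then obtain B where "B > 0" "\<forall>y\<in>f ` topspace X. norm y \<le> B"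
    using bounded_pos compact_imp_bounded by blast
  then show ?thesis using that by auto
qed

lemma compact_space_real_pos:
  fixes f :: "'a \<Rightarrow> real"
  assumes "compact_space X" "continuous_map X euclidean f" "\<And>x. x \<in> topspace X \<Longrightarrow> f x > 0"
  obtains m where "m > 0" "\<And>x. x \<in> topspace X \<Longrightarrow> m \<le> f x"
proof (cases "topspace X = {}")
  case True
  then show ?thesis using that[of 1] by auto
next
  case False
  have "compact (f ` topspace X)"
    using image_compactin[OF _ assms(2)] assms(1) by (simp add: compact_space_def)
  then obtain x where "x \<in> topspace X" "\<And>y. y \<in> topspace X \<Longrightarrow> f x \<le> f y"
    using compact_attains_inf[of "f ` topspace X"] False by auto
  then show ?thesis using that[of "f x"] assms(3) by blast
qed

lemma continuous_map_binop:
  fixes h :: "'b::topological_space \<Rightarrow> 'c::topological_space \<Rightarrow> 'd::topological_space"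
  assumes "continuous_map X euclidean f" "continuous_map X euclidean g"
    and "continuous_on UNIV (\<lambda>p. h (fst p) (snd p))"
  shows "continuous_map X euclidean (\<lambda>x. h (f x) (g x))"
proof -
  have "continuous_map X euclidean (\<lambda>x. (f x, g x))"
    unfolding prod_topology_euclidean[symmetric] by (intro continuous_map_pairedI assms)
  moreover have "continuous_map euclidean euclidean (\<lambda>p. h (fst p) (snd p))" using assms(3) by simp
  ultimately have "continuous_map X euclidean ((\<lambda>p. h (fst p) (snd p)) \<circ> (\<lambda>x. (f x, g x)))"
    by (rule continuous_map_compose)
  then show ?thesis by (simp add: comp_def)
qed

section \<open>Sections in charts and continuous frames\<close>

context smooth_mfd
begin

lemma chart_inv_continuous_map:
  assumes c: "c \<in> atlas M"
  shows "continuous_map (top_of_set (snd c ` fst c)) (subtopology (mtop M) (fst c)) (chart_inv c)"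
  unfolding continuous_map_def
proof (intro conjI allI impI)
  show "chart_inv c \<in> topspace (top_of_set (snd c ` fst c)) \<rightarrow> topspace (subtopology (mtop M) (fst c))"
    using chart_inv_in[of _ c] chart_point[OF c] c by auto
  fix U assume "openin (subtopology (mtop M) (fst c)) U"
  then obtain T where T: "openin (mtop M) T" "U = T \<inter> fst c" unfolding openin_subtopology by blast
  then have "open (snd c ` U)"
    by (intro chart_open_image[OF c]) (auto intro: openin_Int chart_openin[OF c])
  moreover have "{u \<in> topspace (top_of_set (snd c ` fst c)). chart_inv c u \<in> U} = snd c ` U"
    using T(2) c by (auto simp: image_iff)
  ultimately show "openin (top_of_set (snd c ` fst c)) {u \<in> topspace (top_of_set (snd c ` fst c)). chart_inv c u \<in> U}"
    using T(2) by (auto simp: openin_open_eq chart_image_open[OF c])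
qed

lemma section_chart_continuous:
  assumes "cont_along (mtop M) (\<lambda>x. x) s" "c \<in> atlas M"
  shows "continuous_on (snd c ` fst c)
    (\<lambda>u. coord_change (chart_at M (chart_inv c u)) c (chart_inv c u) (s (chart_inv c u)))"
proof -
  have "{z \<in> topspace (mtop M). z \<in> fst c} = fst c" using chart_point[OF assms(2)] by auto
  moreover have "continuous_map (subtopology (mtop M) {z \<in> topspace (mtop M). z \<in> fst c}) euclidean
      (\<lambda>z. coord_change (chart_at M z) c z (s z))"
    using assms unfolding cont_along_def by blast
  ultimately have "continuous_map (subtopology (mtop M) (fst c)) euclidean
      (\<lambda>z. coord_change (chart_at M z) c z (s z))" by (simp only:)
  from continuous_map_compose[OF chart_inv_continuous_map[OF assms(2)] this]
  show ?thesis by (simp add: comp_def)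
qed

lemma cont_along_add_scale:
  assumes p: "continuous_map X (mtop M) p"
    and s: "cont_along X p s" "cont_along X p s'" "continuous_map X euclidean (f :: _ \<Rightarrow> real)"
  shows "cont_along X p (\<lambda>z. s z + f z *\<^sub>R s' z)"
  unfolding cont_along_def
proof
  fix c assume c: "c \<in> atlas M"
  let ?U = "{z \<in> topspace X. p z \<in> fst c}"
  let ?cc = "\<lambda>z. coord_change (chart_at M (p z)) c (p z)"
  have "continuous_map (subtopology X ?U) euclidean (\<lambda>z. f z *\<^sub>R ?cc z (s' z))"
    using s c unfolding cont_along_def
    by (intro continuous_map_binop[where h = "\<lambda>a b. a *\<^sub>R b"])
       (auto intro!: continuous_intros continuous_map_from_subtopology)
  then have "continuous_map (subtopology X ?U) euclidean (\<lambda>z. ?cc z (s z) + f z *\<^sub>R ?cc z (s' z))"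
    using s c unfolding cont_along_def
    by (intro continuous_map_binop[where h = "\<lambda>a b. a + b"]) (auto intro!: continuous_intros)
  then show "continuous_map (subtopology X ?U) euclidean (\<lambda>z. ?cc z (s z + f z *\<^sub>R s' z))"
  proof (rule continuous_map_eq)
    fix z assume "z \<in> topspace (subtopology X ?U)"
    then have z: "p z \<in> fst c" by auto
    note d = chart_at[OF chart_point[OF c z]]
    have "linear (?cc z)" by (rule linear_coord_change[OF d(1) c d(2) z])
    then show "?cc z (s z) + f z *\<^sub>R ?cc z (s' z) = ?cc z (s z + f z *\<^sub>R s' z)"
      by (simp add: linear_add linear_cmul)
  qed
qed

text \<open>The squared length of \<open>P x v\<close> is continuous and positive on the compact
  product of the manifold with the unit sphere, so it has a positive minimum and a finite maximum;
  homogeneity does the rest. Estimates in the fixed model space can thereby be transferred to the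
  Riemannian metric.\<close>

lemma frame_norm_bounds:
  fixes P :: "'a \<Rightarrow> 'e \<Rightarrow> 'e"
  assumes compact: "compact_space (mtop M)" and g: "riemannian_metric M g"
    and lin: "\<And>x. x \<in> topspace (mtop M) \<Longrightarrow> linear (P x)"
    and inj: "\<And>x. x \<in> topspace (mtop M) \<Longrightarrow> inj (P x)"
    and cont: "\<And>v. cont_along (mtop M) (\<lambda>x. x) (\<lambda>x. P x v)"
  obtains K where "K > 0" "\<And>x v. x \<in> topspace (mtop M) \<Longrightarrow> norm v \<le> K * metric_norm g x (P x v)"
    "\<And>x v. x \<in> topspace (mtop M) \<Longrightarrow> metric_norm g x (P x v) \<le> K * norm v"
proof -
  let ?T = "prod_topology (mtop M) (top_of_set (sphere (0::'e) 1))"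
  define f where "f p = g (fst p) (P (fst p) (snd p)) (P (fst p) (snd p))" for p
  have bil: "bilinear (\<lambda>v w. g x (P x v) (P x w))" if x: "x \<in> topspace (mtop M)" for x
    unfolding bilinear_def
  proof (intro conjI allI)
    have b: "bilinear (g x)" using g x unfolding riemannian_metric_def by blast
    fix v
    show "linear (\<lambda>w. g x (P x v) (P x w))"
      using linear_compose[OF lin[OF x], of "g x (P x v)"] b unfolding bilinear_def comp_def by blast
    show "linear (\<lambda>w. g x (P x w) (P x v))"
      using linear_compose[OF lin[OF x], of "\<lambda>w. g x w (P x v)"] b unfolding bilinear_def comp_def by blast
  qed
  have "continuous_map ?T euclidean (\<lambda>p. \<Sum>b\<in>Basis. \<Sum>b'\<in>Basis.
      (snd p \<bullet> b) * ((snd p \<bullet> b') * g (fst p) (P (fst p) b) (P (fst p) b')))"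
  proof (intro continuous_map_sum finite_Basis continuous_map_real_mult)
    fix b b' :: 'e
    have "continuous_map (top_of_set (sphere (0::'e) 1)) euclidean (\<lambda>v. v \<bullet> b)" for b
      by (auto intro!: continuous_intros)
    from continuous_map_compose[OF continuous_map_snd this]
    show "continuous_map ?T euclideanreal (\<lambda>p. snd p \<bullet> b)" "continuous_map ?T euclideanreal (\<lambda>p. snd p \<bullet> b')"
      by (simp_all add: comp_def)
    have "continuous_map (mtop M) euclidean (\<lambda>x. g x (P x b) (P x b'))"
      by (rule continuous_map_metric_along[OF g _ cont cont]) auto
    from continuous_map_compose[OF continuous_map_fst this]
    show "continuous_map ?T euclideanreal (\<lambda>p. g (fst p) (P (fst p) b) (P (fst p) b'))"
      by (simp add: comp_def)
  qed
  then have contf: "continuous_map ?T euclidean f"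
  proof (rule continuous_map_eq)
    fix p assume "p \<in> topspace ?T"
    then have x: "fst p \<in> topspace (mtop M)" by auto
    note bi = bil[OF x]
    have "f p = g (fst p) (P (fst p) (\<Sum>b\<in>Basis. (snd p \<bullet> b) *\<^sub>R b)) (P (fst p) (\<Sum>b\<in>Basis. (snd p \<bullet> b) *\<^sub>R b))"
      by (simp add: f_def euclidean_representation)
    also have "\<dots> = (\<Sum>(b, b')\<in>Basis \<times> Basis. g (fst p) (P (fst p) ((snd p \<bullet> b) *\<^sub>R b)) (P (fst p) ((snd p \<bullet> b') *\<^sub>R b')))"
      by (rule bilinear_sum[OF bi])
    also have "\<dots> = (\<Sum>(b, b')\<in>Basis \<times> Basis. (snd p \<bullet> b) * ((snd p \<bullet> b') * g (fst p) (P (fst p) b) (P (fst p) b')))"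
      by (intro sum.cong refl) (auto simp: bilinear_lmul[OF bi] bilinear_rmul[OF bi])
    finally show "(\<Sum>b\<in>Basis. \<Sum>b'\<in>Basis.
      (snd p \<bullet> b) * ((snd p \<bullet> b') * g (fst p) (P (fst p) b) (P (fst p) b'))) = f p"
      by (simp add: sum.cartesian_product)
  qed
  have compT: "compact_space ?T"
    using compact by (simp add: compact_space_prod_topology compact_space_subtopology compact_imp_compactin_subtopology compactin_euclidean_iff)
  have posf: "f p > 0" if "p \<in> topspace ?T" for p
  proof -
    have x: "fst p \<in> topspace (mtop M)" and v: "snd p \<noteq> 0" using that by auto
    have "P (fst p) (snd p) \<noteq> 0"
      using linear_injective_0[OF lin[OF x]] inj[OF x] v by blast
    then show ?thesis using g x unfolding f_def riemannian_metric_def by blast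
  qed
  obtain m where m: "m > 0" "\<And>p. p \<in> topspace ?T \<Longrightarrow> m \<le> f p"
    using compact_space_real_pos[OF compT contf posf] by blast
  obtain B where B: "B > 0" "\<And>p. p \<in> topspace ?T \<Longrightarrow> \<bar>f p\<bar> \<le> B"
    using compact_space_real_bounds[OF compT contf] by blast
  have hom: "m * (norm v)\<^sup>2 \<le> g x (P x v) (P x v) \<and> g x (P x v) (P x v) \<le> B * (norm v)\<^sup>2"
    if x: "x \<in> topspace (mtop M)" for x v
  proof (cases "v = 0")
    case True
    then show ?thesis using bilinear_lzero[OF bil[OF x]] by simp
  next
    case False
    define w where "w = (1 / norm v) *\<^sub>R v"
    have v: "v = norm v *\<^sub>R w" and w: "norm w = 1" using False by (auto simp: w_def)
    have "g x (P x v) (P x v) = (norm v)\<^sup>2 * f (x, w)"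
      by (subst (1 2) v) (simp add: f_def bilinear_lmul[OF bil[OF x]] bilinear_rmul[OF bil[OF x]] power2_eq_square mult.assoc)
    moreover have "m \<le> f (x, w)" "f (x, w) \<le> B" using m(2)[of "(x, w)"] B(2)[of "(x, w)"] x w by auto
    ultimately show ?thesis by (simp add: mult.commute mult_right_mono)
  qed
  define K where "K = max (sqrt B) (1 / sqrt m)"
  have K: "K > 0" "sqrt B \<le> K" "1 / sqrt m \<le> K" using m B by (auto simp: K_def less_max_iff_disj)
  have "metric_norm g x (P x v) \<le> K * norm v" if x: "x \<in> topspace (mtop M)" for x v
  proof -
    have "metric_norm g x (P x v) \<le> sqrt (B * (norm v)\<^sup>2)"
      unfolding metric_norm_def using hom[OF x, of v] by simp
    also have "\<dots> = sqrt B * norm v" by (simp add: real_sqrt_mult)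
    also have "\<dots> \<le> K * norm v" using K by (intro mult_right_mono) auto
    finally show ?thesis .
  qed
  moreover have "norm v \<le> K * metric_norm g x (P x v)" if x: "x \<in> topspace (mtop M)" for x v
  proof -
    have "sqrt m * norm v = sqrt (m * (norm v)\<^sup>2)" by (simp add: real_sqrt_mult)
    also have "\<dots> \<le> metric_norm g x (P x v)"
      unfolding metric_norm_def using hom[OF x, of v] by simp
    finally have "norm v \<le> 1 / sqrt m * metric_norm g x (P x v)" using m by (simp add: field_simps)
    also have "\<dots> \<le> K * metric_norm g x (P x v)"
      using K hom[OF x, of v] m
      by (intro mult_right_mono) (auto simp: metric_norm_def intro: order_trans[rotated])
    finally show ?thesis .
  qed
  ultimately show ?thesis using that K(1) by blast
qed

text \<open>A basis of the constant space \<open>V\<close> is carried by the frame to global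
  sections, so the whole manifold serves as the neighbourhood of each point.\<close>

lemma subbundle_frame_image:
  fixes P :: "'a \<Rightarrow> 'e \<Rightarrow> 'e"
  assumes lin: "\<And>x. x \<in> topspace (mtop M) \<Longrightarrow> linear (P x)"
    and inj: "\<And>x. x \<in> topspace (mtop M) \<Longrightarrow> inj (P x)"
    and cont: "\<And>v. cont_along (mtop M) (\<lambda>x. x) (\<lambda>x. P x v)"
    and V: "subspace V"
  shows "subbundle M (\<lambda>x. P x ` V)"
  unfolding subbundle_def
proof
  fix x0 assume x0: "x0 \<in> topspace (mtop M)"
  obtain B where B: "B \<subseteq> V" "independent B" "span B = V"
    using basis_exists[of V] V span_minimal by (metis subset_antisym)
  have "finite B" using B(2) independent_imp_finite by blast
  then obtain f where f: "bij_betw f {..<card B} B"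
    using ex_bij_betw_nat_finite[of B] by (metis atLeast0LessThan)
  have im: "(\<lambda>i. P x (f i)) ` {..<card B} = P x ` B" for x
    using f unfolding bij_betw_def by (metis image_image)
  have "inj_on (\<lambda>i. P x (f i)) {..<card B} \<and> independent ((\<lambda>i. P x (f i)) ` {..<card B}) \<and>
      span ((\<lambda>i. P x (f i)) ` {..<card B}) = P x ` V" if x: "x \<in> topspace (mtop M)" for x
  proof (intro conjI)
    show "inj_on (\<lambda>i. P x (f i)) {..<card B}"
      using f inj[OF x] unfolding bij_betw_def inj_on_def by blast
    show "independent ((\<lambda>i. P x (f i)) ` {..<card B})"
      unfolding im using linear_independent_injective_image[OF lin[OF x] B(2)] inj[OF x] inj_on_subset by blast
    show "span ((\<lambda>i. P x (f i)) ` {..<card B}) = P x ` V"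
      unfolding im using linear_span_image[OF lin[OF x], of B] B(3) by simp
  qed
  moreover have "continuous_section M (topspace (mtop M)) (\<lambda>x. P x (f i))" for i
    using cont cont_along_section by blast
  ultimately show "\<exists>U (k::nat) s. openin (mtop M) U \<and> x0 \<in> U \<and> (\<forall>i<k. continuous_section M U (s i)) \<and>
      (\<forall>x\<in>U. inj_on (\<lambda>i. s i x) {..<k} \<and> independent ((\<lambda>i. s i x) ` {..<k}) \<and>
        span ((\<lambda>i. s i x) ` {..<k}) = P x ` V)"
    using x0 by (intro exI[of _ "topspace (mtop M)"] exI[of _ "card B"] exI[of _ "\<lambda>i x. P x (f i)"])
      (simp only: openin_topspace simp_thms Ball_def, blast)
qed

end

section \<open>Time changes of smooth flows\<close>

lemma has_mderiv_unique: "has_mderiv M N f x D \<Longrightarrow> has_mderiv M N f x D' \<Longrightarrow> D = D'"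
  using mderiv_eq by metis

lemma has_mderiv_euclidean_iff:
  "has_mderiv M euclidean_manifold f x D \<longleftrightarrow>
    cont_at M euclidean_manifold f x \<and> has_cderiv (chart_at M x) (UNIV, id) f x D"
  by (simp add: has_mderiv_def)

locale time_changed_flow = smooth_mfd N for N :: "('a, 'e::euclidean_space) manifold" +
  fixes \<phi> :: "real \<Rightarrow> 'a \<Rightarrow> 'a" and \<tau> :: "'a \<Rightarrow> real"
  assumes compact: "compact_space (mtop N)"
    and flow: "smooth_flow N \<phi>"
    and \<tau>_smooth: "smooth_map N euclidean_manifold \<tau>"
    and \<tau>_pos: "\<And>x. x \<in> topspace (mtop N) \<Longrightarrow> \<tau> x > 0"
begin

abbreviation "X \<equiv> topspace (mtop N)"

abbreviation "rchart \<equiv> (UNIV, id) :: (real, real) chart"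

lemma \<phi>_cont: "continuous_map (prod_topology euclidean (mtop N)) (mtop N) (\<lambda>(t, x). \<phi> t x)"
  using flow unfolding smooth_flow_def smooth_map_def by (simp add: prod_manifold_def)

lemma \<phi>_in [simp, intro]: "x \<in> X \<Longrightarrow> \<phi> t x \<in> X"
  using funcset_mem[OF continuous_map_funspace[OF \<phi>_cont], of "(t, x)"] by simp

lemma \<phi>_0 [simp]: "x \<in> X \<Longrightarrow> \<phi> 0 x = x"
  using flow unfolding smooth_flow_def by blast

lemma \<phi>_add: "x \<in> X \<Longrightarrow> \<phi> (s + t) x = \<phi> s (\<phi> t x)"
  using flow unfolding smooth_flow_def by blast

lemma \<phi>_comm: "x \<in> X \<Longrightarrow> \<phi> s (\<phi> t x) = \<phi> t (\<phi> s x)"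
  using \<phi>_add[of x s t] \<phi>_add[of x t s] by (simp add: add.commute)

section \<open>The flow in charts, its derivative and its generator\<close>

definition flow_dom :: "('a, 'e) chart \<Rightarrow> ('a, 'e) chart \<Rightarrow> (real \<times> 'e) set" where
  "flow_dom c d = {(t, u). u \<in> snd c ` fst c \<and> \<phi> t (chart_inv c u) \<in> fst d}"

definition flowc :: "('a, 'e) chart \<Rightarrow> ('a, 'e) chart \<Rightarrow> real \<times> 'e \<Rightarrow> 'e" where
  "flowc c d = (\<lambda>(t, u). snd d (\<phi> t (chart_inv c u)))"

lemma
  assumes "c \<in> atlas N" "d \<in> atlas N"
  shows flow_dom_open: "open (flow_dom c d)" and flowc_Ck: "Ck_on n (flow_dom c d) (flowc c d)"
proof -
  have "prod_dom rchart c d (\<lambda>(t, x). \<phi> t x) = flow_dom c d"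
    by (auto simp: prod_dom_def flow_dom_def)
  moreover have "(\<lambda>(t, u). snd d ((\<lambda>(t, x). \<phi> t x) (chart_inv rchart t, chart_inv c u))) = flowc c d"
    by (auto simp: flowc_def)
  moreover have "smooth_map (prod_manifold euclidean_manifold N) N (\<lambda>(t, x). \<phi> t x)"
    using flow unfolding smooth_flow_def by blast
  note smooth_map_prod_Ck[OF smooth_manifold_euclidean smooth smooth this, of rchart c d]
  ultimately show "open (flow_dom c d)" "Ck_on n (flow_dom c d) (flowc c d)"
    using assms by simp_all
qed

lemma flow_dom_iff: "c \<in> atlas N \<Longrightarrow> x \<in> fst c \<Longrightarrow> (t, snd c x) \<in> flow_dom c d \<longleftrightarrow> \<phi> t x \<in> fst d"
  unfolding flow_dom_def by auto

lemma flowc_has_derivative: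
  assumes "c \<in> atlas N" "d \<in> atlas N" "x \<in> fst c" "\<phi> t x \<in> fst d"
  shows "(flowc c d has_derivative frechet_derivative (flowc c d) (at (t, snd c x))) (at (t, snd c x))"
  by (rule Ck_on_Suc_has_derivative[OF flowc_Ck]) (use assms in \<open>simp_all add: flow_dom_iff\<close>)

lemma \<phi>_continuous_map: "continuous_map (mtop N) (mtop N) (\<phi> t)"
proof -
  have "continuous_map (mtop N) (prod_topology euclidean (mtop N)) (\<lambda>x. (t, x))"
    by (intro continuous_map_pairedI) auto
  from continuous_map_compose[OF this \<phi>_cont] show ?thesis by (simp add: comp_def)
qed

lemma curve_continuous_map: "x \<in> X \<Longrightarrow> continuous_map euclidean (mtop N) (\<lambda>t. \<phi> t x)"
proof -
  assume "x \<in> X"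
  then have "continuous_map euclidean (prod_topology euclidean (mtop N)) (\<lambda>t::real. (t, x))"
    by (intro continuous_map_pairedI) auto
  from continuous_map_compose[OF this \<phi>_cont] show ?thesis by (simp add: comp_def)
qed

lemma \<phi>_has_cderiv:
  assumes "c \<in> atlas N" "d \<in> atlas N" "x \<in> fst c" "\<phi> t x \<in> fst d"
  shows "has_cderiv c d (\<phi> t) x (\<lambda>v. frechet_derivative (flowc c d) (at (t, snd c x)) (0, v))"
proof -
  have "((\<lambda>u. flowc c d (t, u)) has_derivative
      (\<lambda>v. frechet_derivative (flowc c d) (at (t, snd c x)) (0, v))) (at (snd c x))"
    by (rule has_derivative_compose[of "\<lambda>u. (t, u)" "\<lambda>v. (0, v)"])
       (auto intro!: derivative_eq_intros flowc_has_derivative assms)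
  moreover have "(\<lambda>u. flowc c d (t, u)) = snd d \<circ> \<phi> t \<circ> chart_inv c" by (auto simp: flowc_def)
  ultimately show ?thesis unfolding has_cderiv_def by simp
qed

lemma curve_has_cderiv:
  assumes "c \<in> atlas N" "d \<in> atlas N" "x \<in> fst c" "\<phi> t x \<in> fst d"
  shows "has_cderiv rchart d (\<lambda>s. \<phi> s x) t (\<lambda>h. frechet_derivative (flowc c d) (at (t, snd c x)) (h, 0))"
proof -
  have "((\<lambda>s. flowc c d (s, snd c x)) has_derivative
      (\<lambda>h. frechet_derivative (flowc c d) (at (t, snd c x)) (h, 0))) (at t)"
    by (rule has_derivative_compose[of "\<lambda>s. (s, snd c x)" "\<lambda>h. (h, 0)"])
       (auto intro!: derivative_eq_intros flowc_has_derivative assms)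
  moreover have "(\<lambda>s. flowc c d (s, snd c x)) = snd d \<circ> (\<lambda>s. \<phi> s x) \<circ> chart_inv rchart"
    using assms by (auto simp: flowc_def)
  ultimately show ?thesis unfolding has_cderiv_def by simp
qed

lemma \<phi>_has_mderiv:
  assumes x: "x \<in> X"
  shows "has_mderiv N N (\<phi> t) x (mderiv N N (\<phi> t) x)"
proof -
  note c = chart_at[OF x] and d = chart_at[OF \<phi>_in[OF x, of t]]
  have "has_mderiv N N (\<phi> t) x (\<lambda>v. frechet_derivative (flowc (chart_at N x) (chart_at N (\<phi> t x)))
      (at (t, snd (chart_at N x) x)) (0, v))"
    unfolding has_mderiv_def
    using \<phi>_has_cderiv[OF c(1) d(1) c(2) d(2)] cont_at_continuous_map[OF \<phi>_continuous_map x] x by blast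
  then show ?thesis using mderiv_eq by metis
qed

lemma mderiv_\<phi>_linear: "x \<in> X \<Longrightarrow> linear (mderiv N N (\<phi> t) x)"
  using linear_has_mderiv[OF \<phi>_has_mderiv] .

definition Z :: "'a \<Rightarrow> 'e" where
  "Z x = mderiv euclidean_manifold N (\<lambda>s. \<phi> s x) 0 1"

text \<open>At time \<open>0\<close> this is the definition of \<open>Z\<close>; the group law
  \<open>\<phi> s x = \<phi> (s - t) (\<phi> t x)\<close> moves it to any other time.\<close>

lemma curve_has_mderiv:
  assumes x: "x \<in> X"
  shows "has_mderiv euclidean_manifold N (\<lambda>s. \<phi> s x) t (\<lambda>h. h *\<^sub>R Z (\<phi> t x))"
proof -
  have zero: "has_mderiv euclidean_manifold N (\<lambda>s. \<phi> s y) 0 (\<lambda>h. h *\<^sub>R Z y)" if y: "y \<in> X" for y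
  proof -
    note c = chart_at[OF y]
    have y0: "\<phi> 0 y \<in> fst (chart_at N y)" using c y by simp
    have "cont_at euclidean_manifold N (\<lambda>s. \<phi> s y) 0"
      by (rule cont_at_continuous_map) (use curve_continuous_map[OF y] in auto)
    then obtain D where D: "has_mderiv euclidean_manifold N (\<lambda>s. \<phi> s y) 0 D"
      unfolding has_mderiv_def using curve_has_cderiv[OF c(1) c(1) c(2) y0] y by auto
    then have "Z y = D 1" unfolding Z_def using mderiv_eq by metis
    have "D = (\<lambda>h. h *\<^sub>R Z y)"
    proof
      fix h show "D h = h *\<^sub>R Z y"
        using linear_cmul[OF linear_has_mderiv[OF D], of h 1] \<open>Z y = D 1\<close> by simp
    qed
    with D show ?thesis by simp
  qed
  have "has_mderiv euclidean_manifold euclidean_manifold (\<lambda>s. s - t) t (\<lambda>h. h)"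
    unfolding has_mderiv_euclidean_iff has_cderiv_def
    by (auto intro!: cont_at_continuous_map continuous_intros derivative_eq_intros simp: comp_def)
  from has_mderiv_compose[OF smooth_manifold_euclidean smooth_manifold_euclidean this, of N "\<lambda>s. \<phi> s (\<phi> t x)"] zero[OF \<phi>_in[OF x, of t]]
  have "has_mderiv euclidean_manifold N (\<lambda>s. \<phi> (s - t) (\<phi> t x)) t (\<lambda>h. h *\<^sub>R Z (\<phi> t x))" by simp
  moreover have "\<phi> (s - t) (\<phi> t x) = \<phi> s x" for s using \<phi>_add[OF x, of "s - t" t] by simp
  ultimately show ?thesis by simp
qed

text \<open>Differentiate \<open>\<phi> t (\<phi> s x) = \<phi> s (\<phi> t x)\<close> in
  \<open>s\<close> at \<open>0\<close>.\<close>

lemma mderiv_\<phi>_Z: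
  assumes x: "x \<in> X"
  shows "mderiv N N (\<phi> t) x (Z x) = Z (\<phi> t x)"
proof -
  have "has_mderiv euclidean_manifold N (\<lambda>s. \<phi> t (\<phi> s x)) 0 (\<lambda>h. mderiv N N (\<phi> t) x (h *\<^sub>R Z x))"
    using has_mderiv_compose[OF smooth_manifold_euclidean smooth curve_has_mderiv[OF x, of 0], of N "\<phi> t"]
      \<phi>_has_mderiv[OF x, of t] x by simp
  moreover have "has_mderiv euclidean_manifold N (\<lambda>s. \<phi> t (\<phi> s x)) 0 (\<lambda>h. h *\<^sub>R Z (\<phi> t x))"
    using curve_has_mderiv[OF \<phi>_in[OF x, of t], of 0] x \<phi>_comm[OF x, of t] by simp
  ultimately have "(\<lambda>h. mderiv N N (\<phi> t) x (h *\<^sub>R Z x)) = (\<lambda>h. h *\<^sub>R Z (\<phi> t x))"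
    by (rule has_mderiv_unique)
  from fun_cong[OF this, of 1] show ?thesis by simp
qed

lemma mderiv_\<phi>_add:
  assumes x: "x \<in> X"
  shows "mderiv N N (\<phi> (s + t)) x v = mderiv N N (\<phi> s) (\<phi> t x) (mderiv N N (\<phi> t) x v)"
proof -
  have "has_mderiv N N (\<lambda>x. \<phi> s (\<phi> t x)) x (\<lambda>v. mderiv N N (\<phi> s) (\<phi> t x) (mderiv N N (\<phi> t) x v))"
    by (rule has_mderiv_compose[OF smooth smooth \<phi>_has_mderiv[OF x] \<phi>_has_mderiv]) (use x in auto)
  moreover have "has_mderiv N N (\<lambda>x. \<phi> s (\<phi> t x)) x (mderiv N N (\<phi> (s + t)) x)"
    by (rule has_mderiv_cong[OF smooth \<phi>_has_mderiv[OF x, of "s + t"] openin_topspace x])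
       (use \<phi>_add in auto)
  ultimately show ?thesis using has_mderiv_unique by metis
qed

lemma mderiv_\<phi>_0: assumes x: "x \<in> X" shows "mderiv N N (\<phi> 0) x v = v"
proof -
  have "has_mderiv N N (\<phi> 0) x (\<lambda>v. v)"
    by (rule has_mderiv_cong[OF smooth has_mderiv_id[OF smooth x] openin_topspace x]) simp
  then show ?thesis using mderiv_eq by metis
qed

section \<open>The integral of \<open>\<tau>\<close> along orbits and its derivatives\<close>

lemma \<tau>_chart_Ck: "c \<in> atlas N \<Longrightarrow> Ck_on n (snd c ` fst c) (\<lambda>u. \<tau> (chart_inv c u))"
  using smooth_map_chart_Ck[OF \<tau>_smooth, of c "(UNIV, id)" n]
  by (simp add: comp_def)

text \<open>An orbit may leave the chart \<open>c\<close>, so near each time and point a chart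
  around \<open>\<phi> t x\<close> is inserted between the flow and \<open>\<tau>\<close>.\<close>

lemma \<tau>_flow_Ck:
  assumes c: "c \<in> atlas N"
  shows "Ck_on n (UNIV \<times> snd c ` fst c) (\<lambda>(t, u). \<tau> (\<phi> t (chart_inv c u)))"
proof (rule Ck_on_local)
  fix p assume "p \<in> (UNIV :: real set) \<times> snd c ` fst c"
  then obtain t x where p: "p = (t, snd c x)" "x \<in> fst c" by auto
  have xX: "x \<in> X" using chart_point[OF c p(2)] .
  define d where "d = chart_at N (\<phi> t x)"
  have d: "d \<in> atlas N" "\<phi> t x \<in> fst d" using chart_at[OF \<phi>_in[OF xX]] unfolding d_def by auto
  have "Ck_on n (flow_dom c d) (\<lambda>q. \<tau> (chart_inv d (flowc c d q)))"
    by (rule Ck_on_compose[OF flow_dom_open[OF c d(1)] \<tau>_chart_Ck[OF d(1)] flowc_Ck[OF c d(1)]])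
       (auto simp: flow_dom_def flowc_def)
  then have "Ck_on n (flow_dom c d) (\<lambda>(t, u). \<tau> (\<phi> t (chart_inv c u)))"
    by (rule Ck_on_cong[OF flow_dom_open[OF c d(1)], rotated])
       (use d in \<open>auto simp: flow_dom_def flowc_def\<close>)
  moreover have "p \<in> flow_dom c d" using p c d by (simp add: flow_dom_iff)
  ultimately show "\<exists>U. open U \<and> p \<in> U \<and> Ck_on n U (\<lambda>(t, u). \<tau> (\<phi> t (chart_inv c u)))"
    using flow_dom_open[OF c d(1)] by blast
qed

lemma \<tau>_curve_cont: assumes x: "x \<in> X" shows "continuous_on S (\<lambda>s. \<tau> (\<phi> s x))"
proof -
  define c where "c = chart_at N x"
  have c: "c \<in> atlas N" "x \<in> fst c" using chart_at[OF x] unfolding c_def by auto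
  have "continuous_on S (\<lambda>s. (\<lambda>(t, u). \<tau> (\<phi> t (chart_inv c u))) (s, snd c x))"
    by (rule continuous_on_compose2[OF Ck_on_continuous_on[OF \<tau>_flow_Ck[OF c(1)]]])
       (use c in \<open>auto intro!: continuous_intros\<close>)
  then show ?thesis using c by simp
qed

definition F :: "real \<Rightarrow> 'a \<Rightarrow> real" where
  "F a x = (LBINT s=ereal 0..ereal a. \<tau> (\<phi> s x))"

lemma F_0 [simp]: "F 0 x = 0"
  by (simp add: F_def)

lemma F_deriv:
  assumes x: "x \<in> X"
  shows "((\<lambda>a. F a x) has_real_derivative \<tau> (\<phi> a x)) (at a)"
proof -
  define R where "R = \<bar>a\<bar> + 1"
  have "((\<lambda>u. LBINT y=ereal 0..ereal u. \<tau> (\<phi> y x)) has_vector_derivative \<tau> (\<phi> a x)) (at a within {-R..R})"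
    by (rule interval_integral_FTC2) (auto simp: R_def intro!: \<tau>_curve_cont[OF x])
  moreover have "at a within {-R..R} = at a"
    by (rule at_within_interior) (auto simp: R_def)
  ultimately show ?thesis
    by (simp add: has_real_derivative_iff_has_vector_derivative F_def)
qed

text \<open>Valid for both signs of \<open>a\<close>, this turns the bounds of \<open>\<tau>\<close>
  into bounds for \<open>F\<close> and thereby for \<open>\<alpha>\<close>.\<close>

lemma F_mvt: assumes x: "x \<in> X" shows "\<exists>z. F a x = a * \<tau> (\<phi> z x)"
proof -
  consider "a = 0" | "a > 0" | "a < 0" by linarith
  then show ?thesis
  proof cases
    case 2
    then obtain z where "F a x - F 0 x = (a - 0) * \<tau> (\<phi> z x)"
      using MVT2[of 0 a "\<lambda>a. F a x" "\<lambda>a. \<tau> (\<phi> a x)"] F_deriv[OF x] by blast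
    then show ?thesis by auto
  next
    case 3
    then obtain z where "F 0 x - F a x = (0 - a) * \<tau> (\<phi> z x)"
      using MVT2[of a 0 "\<lambda>a. F a x" "\<lambda>a. \<tau> (\<phi> a x)"] F_deriv[OF x] by blast
    then show ?thesis by (intro exI[of _ z]) simp
  qed simp
qed

text \<open>
  With fixed limits of integration, smoothness in time and space together follows from
  differentiation under the integral sign.
\<close>

lemma F_integral: assumes x: "x \<in> X" shows "F a x = integral {0..1} (\<lambda>s. a * \<tau> (\<phi> (a * s) x))"
proof -
  have "((\<lambda>s. a * \<tau> (\<phi> (a * s) x)) has_integral (F (a * 1) x - F (a * 0) x)) {0..1}"
  proof (rule fundamental_theorem_of_calculus)
    fix s :: real
    have "((\<lambda>s. F (a * s) x) has_real_derivative \<tau> (\<phi> (a * s) x) * a) (at s)"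
      by (rule DERIV_chain2[OF F_deriv[OF x]]) (auto intro!: derivative_eq_intros)
    then show "((\<lambda>s. F (a * s) x) has_vector_derivative a * \<tau> (\<phi> (a * s) x)) (at s within {0..1})"
      by (simp add: has_real_derivative_iff_has_vector_derivative has_vector_derivative_at_within mult.commute)
  qed simp
  from integral_unique[OF this] show ?thesis by (simp only: mult_1_right mult_zero_right F_0 diff_zero)
qed

lemma F_strict_mono: assumes x: "x \<in> X" shows "strict_mono (\<lambda>a. F a x)"
proof (rule strict_monoI)
  fix a b :: real assume "a < b"
  have "\<exists>y. ((\<lambda>a. F a x) has_real_derivative y) (at z) \<and> y > 0" for z
    using F_deriv[OF x, of z] \<tau>_pos[OF \<phi>_in[OF x, of z]] by blast
  then show "F a x < F b x" using DERIV_pos_imp_increasing[OF \<open>a < b\<close>, of "\<lambda>a. F a x"] by blast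
qed

text \<open>Both sides have the same derivative in \<open>b\<close> and agree at
  \<open>b = 0\<close>.\<close>

lemma F_add: assumes x: "x \<in> X" shows "F (a + b) x = F a x + F b (\<phi> a x)"
proof -
  have "((\<lambda>b. F (a + b) x - F b (\<phi> a x)) has_real_derivative 0) (at b)" for b
  proof -
    have "((\<lambda>b. F (a + b) x) has_real_derivative \<tau> (\<phi> (a + b) x) * 1) (at b)"
      by (rule DERIV_chain2[OF F_deriv[OF x]]) (auto intro!: derivative_eq_intros)
    moreover have "((\<lambda>b. F b (\<phi> a x)) has_real_derivative \<tau> (\<phi> b (\<phi> a x))) (at b)"
      by (rule F_deriv) (use x in auto)
    ultimately have "((\<lambda>b. F (a + b) x - F b (\<phi> a x)) has_real_derivative
        \<tau> (\<phi> (a + b) x) * 1 - \<tau> (\<phi> b (\<phi> a x))) (at b)"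
      by (rule DERIV_diff)
    then show ?thesis using \<phi>_add[OF x, of b a] by (simp add: add.commute)
  qed
  from DERIV_isconst_all[OF allI[OF this], of b 0] show ?thesis by simp
qed

definition Fc :: "('a, 'e) chart \<Rightarrow> real \<times> 'e \<Rightarrow> real" where
  "Fc c = (\<lambda>(a, u). F a (chart_inv c u))"

lemma Fc_Ck: assumes c: "c \<in> atlas N" shows "Ck_on n (UNIV \<times> snd c ` fst c) (Fc c)"
proof -
  let ?W = "(UNIV :: real set) \<times> snd c ` fst c"
  let ?f = "\<lambda>(t, u). \<tau> (\<phi> t (chart_inv c u))"
  have W: "open ?W" using chart_image_open[OF c] by (simp add: open_Times)
  have UW: "open ((UNIV :: real set) \<times> ?W)" by (intro open_Times open_UNIV W)
  note pr = Ck_on_bounded_linear[OF UW bounded_linear_fst, of n]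
    Ck_on_bounded_linear[OF UW bounded_linear_compose[OF bounded_linear_fst bounded_linear_snd], of n]
    Ck_on_bounded_linear[OF UW bounded_linear_compose[OF bounded_linear_snd bounded_linear_snd], of n]
  have "Ck_on n (UNIV \<times> ?W) (\<lambda>p. ?f (fst (snd p) * fst p, snd (snd p)))"
    by (rule Ck_on_compose[OF UW \<tau>_flow_Ck[OF c], where g = "\<lambda>p. (fst (snd p) * fst p, snd (snd p))"])
       (intro Ck_on_Pair Ck_on_mult UW pr, auto)
  then have "Ck_on n (UNIV \<times> ?W) (\<lambda>p. fst (snd p) * ?f (fst (snd p) * fst p, snd (snd p)))"
    by (intro Ck_on_mult UW pr)
  from Ck_on_integral_parameter[OF W this]
  have "Ck_on n ?W (\<lambda>z. integral {0..1} (\<lambda>s. fst z * ?f (fst z * s, snd z)))" by simp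
  then show ?thesis
  proof (rule Ck_on_cong[OF W, rotated])
    fix z assume "z \<in> ?W"
    then have "chart_inv c (snd z) \<in> X" using chart_point[OF c chart_inv_in[of "snd z" c]] by auto
    from F_integral[OF this, of "fst z"]
    show "integral {0..1} (\<lambda>s. fst z * ?f (fst z * s, snd z)) = Fc c z"
      by (simp add: Fc_def case_prod_unfold)
  qed
qed

lemma Fc_has_derivative:
  assumes "c \<in> atlas N" "x \<in> fst c"
  shows "(Fc c has_derivative frechet_derivative (Fc c) (at (a, snd c x))) (at (a, snd c x))"
  by (rule Ck_on_Suc_has_derivative[OF Fc_Ck]) (use assms in auto)

lemma F_has_cderiv:
  assumes "c \<in> atlas N" "x \<in> fst c"
  shows "has_cderiv c rchart (F a) x (\<lambda>v. frechet_derivative (Fc c) (at (a, snd c x)) (0, v))"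
proof -
  have "((\<lambda>u. Fc c (a, u)) has_derivative (\<lambda>v. frechet_derivative (Fc c) (at (a, snd c x)) (0, v))) (at (snd c x))"
    by (rule has_derivative_compose[of "\<lambda>u. (a, u)" "\<lambda>v. (0, v)"])
       (auto intro!: derivative_eq_intros Fc_has_derivative assms)
  moreover have "(\<lambda>u. Fc c (a, u)) = snd rchart \<circ> F a \<circ> chart_inv c" by (auto simp: Fc_def)
  ultimately show ?thesis unfolding has_cderiv_def by simp
qed

lemma F_frechet_time:
  assumes c: "c \<in> atlas N" "x \<in> fst c"
  shows "frechet_derivative (Fc c) (at (a, snd c x)) (1, 0) = \<tau> (\<phi> a x)"
proof -
  have "((\<lambda>a. Fc c (a, snd c x)) has_derivative (\<lambda>h. frechet_derivative (Fc c) (at (a, snd c x)) (h, 0))) (at a)"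
    by (rule has_derivative_compose[of "\<lambda>a. (a, snd c x)" "\<lambda>h. (h, 0)"])
       (auto intro!: derivative_eq_intros Fc_has_derivative c)
  moreover have "(\<lambda>a. Fc c (a, snd c x)) = (\<lambda>a. F a x)" using c by (auto simp: Fc_def)
  moreover have "((\<lambda>a. F a x) has_derivative (*) (\<tau> (\<phi> a x))) (at a)"
    using F_deriv[OF chart_point[OF c]] by (simp add: has_field_derivative_def)
  ultimately have "(\<lambda>h. frechet_derivative (Fc c) (at (a, snd c x)) (h, 0)) = (*) (\<tau> (\<phi> a x))"
    using has_derivative_unique by metis
  from fun_cong[OF this, of 1] show ?thesis by simp
qed

lemma F_cont_map: "continuous_map (prod_topology euclidean (mtop N)) euclidean (\<lambda>(a, x). F a x)"
proof (rule continuous_map_real_prod_charts)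
  fix c assume "c \<in> atlas N"
  from Ck_on_continuous_on[OF Fc_Ck[OF this]]
  show "continuous_on (UNIV \<times> snd c ` fst c) (\<lambda>(t, u). (\<lambda>(a, x). F a x) (t, chart_inv c u))"
    by (simp add: Fc_def)
qed

lemma F_cont_at: assumes "x \<in> X" shows "cont_at N euclidean_manifold (F a) x"
proof (rule cont_at_continuous_map)
  have "continuous_map (mtop N) (prod_topology euclidean (mtop N)) (\<lambda>x. (a, x))"
    by (intro continuous_map_pairedI) auto
  from continuous_map_compose[OF this F_cont_map]
  show "continuous_map (mtop N) (mtop euclidean_manifold) (F a)" by (simp add: comp_def)
qed (rule assms)

abbreviation dF :: "real \<Rightarrow> 'a \<Rightarrow> 'e \<Rightarrow> real" where
  "dF a x \<equiv> mderiv N euclidean_manifold (F a) x"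

lemma F_has_mderiv:
  assumes x: "x \<in> X" shows "has_mderiv N euclidean_manifold (F a) x (dF a x)"
proof -
  have "has_mderiv N euclidean_manifold (F a) x
      (\<lambda>v. frechet_derivative (Fc (chart_at N x)) (at (a, snd (chart_at N x) x)) (0, v))"
    unfolding has_mderiv_euclidean_iff using F_has_cderiv[OF chart_at[OF x]] F_cont_at[OF x] by blast
  then show ?thesis using mderiv_eq by metis
qed

text \<open>The spatial derivative of \<open>F_add\<close>. In the frame it becomes the cocycle
  identity for \<open>\<kappa>\<close>.\<close>

lemma dF_add:
  assumes x: "x \<in> X"
  shows "dF (a + b) x v = dF a x v + dF b (\<phi> a x) (mderiv N N (\<phi> a) x v)"
proof -
  let ?c = "chart_at N x"
  note c = chart_at[OF x]
  have 1: "has_mderiv N euclidean_manifold (\<lambda>x. F b (\<phi> a x)) x (\<lambda>v. dF b (\<phi> a x) (mderiv N N (\<phi> a) x v))"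
    by (rule has_mderiv_compose[OF smooth smooth \<phi>_has_mderiv[OF x] F_has_mderiv]) (use x in auto)
  have "(F a \<circ> chart_inv ?c has_derivative dF a x) (at (snd ?c x))"
    using F_has_mderiv[OF x, of a] unfolding has_mderiv_euclidean_iff has_cderiv_def by simp
  moreover have "((\<lambda>x. F b (\<phi> a x)) \<circ> chart_inv ?c has_derivative (\<lambda>v. dF b (\<phi> a x) (mderiv N N (\<phi> a) x v))) (at (snd ?c x))"
    using 1 unfolding has_mderiv_euclidean_iff has_cderiv_def by (simp add: comp_def)
  ultimately have "((\<lambda>u. (F a \<circ> chart_inv ?c) u + ((\<lambda>x. F b (\<phi> a x)) \<circ> chart_inv ?c) u) has_derivative
      (\<lambda>v. dF a x v + dF b (\<phi> a x) (mderiv N N (\<phi> a) x v))) (at (snd ?c x))"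
    by (rule has_derivative_add)
  then have "(F (a + b) \<circ> chart_inv ?c has_derivative
      (\<lambda>v. dF a x v + dF b (\<phi> a x) (mderiv N N (\<phi> a) x v))) (at (snd ?c x))"
  proof (rule has_derivative_transform_within_open[OF _ chart_image_open[OF c(1)]])
    fix u assume "u \<in> snd ?c ` fst ?c"
    then have "chart_inv ?c u \<in> X" using chart_point[OF c(1) chart_inv_in] by blast
    then show "(F a \<circ> chart_inv ?c) u + ((\<lambda>x. F b (\<phi> a x)) \<circ> chart_inv ?c) u = (F (a + b) \<circ> chart_inv ?c) u"
      using F_add by simp
  qed (use c in auto)
  moreover have "(F (a + b) \<circ> chart_inv ?c has_derivative dF (a + b) x) (at (snd ?c x))"
    using F_has_mderiv[OF x, of "a + b"] unfolding has_mderiv_euclidean_iff has_cderiv_def by simp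
  ultimately have "(\<lambda>v. dF a x v + dF b (\<phi> a x) (mderiv N N (\<phi> a) x v)) = dF (a + b) x"
    by (rule has_derivative_unique)
  from fun_cong[OF this, of v] show ?thesis by simp
qed

lemma dF_linear: "x \<in> X \<Longrightarrow> linear (dF a x)"
  using linear_has_mderiv[OF F_has_mderiv] .

text \<open>Along the orbit, \<open>F a (\<phi> s x) = F (s + a) x - F s x\<close>, so
  differentiation in the flow direction reduces to the two end points of the interval of
  integration.\<close>

lemma dF_Z:
  assumes x: "x \<in> X"
  shows "dF a x (Z x) = \<tau> (\<phi> a x) - \<tau> x"
proof -
  have "has_mderiv euclidean_manifold euclidean_manifold (\<lambda>s. F a (\<phi> s x)) 0 (\<lambda>h. dF a x (h *\<^sub>R Z x))"
    using has_mderiv_compose[OF smooth_manifold_euclidean smooth curve_has_mderiv[OF x, of 0], of euclidean_manifold "F a"]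
      F_has_mderiv[OF x, of a] x by simp
  then have "((\<lambda>s. F a (\<phi> s x)) has_derivative (\<lambda>h. dF a x (h *\<^sub>R Z x))) (at 0)"
    unfolding has_mderiv_euclidean_iff has_cderiv_def by (simp add: comp_def)
  moreover have "((\<lambda>s. F a (\<phi> s x)) has_real_derivative \<tau> (\<phi> a x) - \<tau> x) (at 0)"
  proof -
    have "((\<lambda>s. F (s + a) x) has_real_derivative \<tau> (\<phi> (0 + a) x) * 1) (at 0)"
      by (rule DERIV_chain2[OF F_deriv[OF x]]) (auto intro!: derivative_eq_intros)
    from DERIV_diff[OF this F_deriv[OF x]]
    show ?thesis using F_add[OF x, of _ a] x by simp
  qed
  then have "((\<lambda>s. F a (\<phi> s x)) has_derivative (*) (\<tau> (\<phi> a x) - \<tau> x)) (at 0)"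
    by (simp add: has_field_derivative_def)
  ultimately have "(\<lambda>h. dF a x (h *\<^sub>R Z x)) = (*) (\<tau> (\<phi> a x) - \<tau> x)"
    by (rule has_derivative_unique)
  from fun_cong[OF this, of 1] show ?thesis by simp
qed

lemma \<tau>_bounds: obtains m K where "m > 0" "K > 0" "\<And>x. x \<in> X \<Longrightarrow> m \<le> \<tau> x" "\<And>x. x \<in> X \<Longrightarrow> \<tau> x \<le> K"
proof -
  have cont: "continuous_map (mtop N) euclidean \<tau>"
    using \<tau>_smooth unfolding smooth_map_def by simp
  obtain m where "m > 0" "\<And>x. x \<in> X \<Longrightarrow> m \<le> \<tau> x"
    using compact_space_real_pos[OF compact cont \<tau>_pos] by blast
  moreover obtain K where "K > 0" "\<And>x. x \<in> X \<Longrightarrow> \<bar>\<tau> x\<bar> \<le> K"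
    using compact_space_real_bounds[OF compact cont] by blast
  ultimately show ?thesis using that[of m K] by force
qed

section \<open>The parameter of the time change and smoothness of the new flow\<close>

abbreviation "\<alpha> \<equiv> time_change_param \<phi> \<tau>"
abbreviation "\<psi> \<equiv> time_change \<phi> \<tau>"

lemma F_surj: assumes x: "x \<in> X" shows "\<exists>a. F a x = t"
proof -
  obtain m K where m: "m > 0" "\<And>x. x \<in> X \<Longrightarrow> m \<le> \<tau> x" using \<tau>_bounds by metis
  \<comment> \<open>With this \<open>R\<close> the lower bound \<open>m\<close> of
    \<open>\<tau>\<close> forces \<open>F (- R) x \<le> t \<le> F R x\<close>, ready for the
    intermediate value theorem.\<close>
  define R where "R = \<bar>t\<bar> / m"
  have R: "R \<ge> 0" "R * m = \<bar>t\<bar>" using m(1) by (auto simp: R_def)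
  obtain z where z: "F R x = R * \<tau> (\<phi> z x)" using F_mvt[OF x] by blast
  have up: "t \<le> F R x"
    using mult_left_mono[OF m(2)[OF \<phi>_in[OF x, of z]] R(1)] R(2) z by linarith
  obtain w where w: "F (- R) x = - R * \<tau> (\<phi> w x)" using F_mvt[OF x] by blast
  have lo: "F (- R) x \<le> t"
    using mult_left_mono[OF m(2)[OF \<phi>_in[OF x, of w]] R(1)] R(2) w by linarith
  have "continuous_on {- R..R} (\<lambda>a. F a x)"
    using F_deriv[OF x] by (meson DERIV_continuous_on has_field_derivative_at_within)
  from IVT'[OF lo up _ this] R(1) show ?thesis by auto
qed

lemma F_inj: "x \<in> X \<Longrightarrow> F a x = F b x \<Longrightarrow> a = b"
  using strict_mono_eq[OF F_strict_mono] by blast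

lemma F_\<alpha>: assumes x: "x \<in> X" shows "F (\<alpha> x t) x = t"
proof -
  have "\<exists>!a. F a x = t" using F_surj[OF x] F_inj[OF x] by metis
  from theI'[OF this] show ?thesis unfolding time_change_param_def F_def .
qed

lemma \<alpha>_F: assumes x: "x \<in> X" shows "\<alpha> x (F a x) = a"
  using F_inj[OF x F_\<alpha>[OF x]] .

lemma \<psi>_eq: "\<psi> t x = \<phi> (\<alpha> x t) x"
  by (simp add: time_change_def)

lemma \<psi>_in [simp, intro]: "x \<in> X \<Longrightarrow> \<psi> t x \<in> X"
  by (simp add: \<psi>_eq)

lemma \<alpha>_add: assumes x: "x \<in> X" shows "\<alpha> x (s + t) = \<alpha> x t + \<alpha> (\<psi> t x) s"
proof -
  have "F (\<alpha> x t + \<alpha> (\<psi> t x) s) x = s + t"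
    using F_add[OF x] F_\<alpha>[OF x] F_\<alpha>[OF \<psi>_in[OF x]] by (simp add: \<psi>_eq)
  then show ?thesis using \<alpha>_F[OF x] by metis
qed

lemma \<alpha>_0: "x \<in> X \<Longrightarrow> \<alpha> x 0 = 0"
  using \<alpha>_F[of x 0] by simp

lemma \<psi>_0: "x \<in> X \<Longrightarrow> \<psi> 0 x = x"
  by (simp add: \<psi>_eq \<alpha>_0)

lemma \<psi>_add: assumes x: "x \<in> X" shows "\<psi> (s + t) x = \<psi> s (\<psi> t x)"
  using \<alpha>_add[OF x, of s t] \<phi>_add[OF x, of "\<alpha> (\<psi> t x) s" "\<alpha> x t"]
  by (simp add: \<psi>_eq add.commute)

text \<open>The constants are reciprocals of bounds of \<open>\<tau>\<close>. The lower estimate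
  preserves exponential rates, the two-sided upper one preserves subexponential growth.\<close>

lemma \<alpha>_bounds:
  obtains m K where "0 < m" "0 < K" "\<And>x t. x \<in> X \<Longrightarrow> t \<ge> 0 \<Longrightarrow> m * t \<le> \<alpha> x t"
    "\<And>x t. x \<in> X \<Longrightarrow> \<bar>\<alpha> x t\<bar> \<le> K * \<bar>t\<bar>"
proof -
  obtain m K where mK: "m > 0" "K > 0" "\<And>x. x \<in> X \<Longrightarrow> m \<le> \<tau> x" "\<And>x. x \<in> X \<Longrightarrow> \<tau> x \<le> K"
    using \<tau>_bounds by metis
  have lower: "1 / K * t \<le> \<alpha> x t" if x: "x \<in> X" and t: "t \<ge> 0" for x t
  proof -
    obtain z where z: "t = \<alpha> x t * \<tau> (\<phi> z x)" using F_mvt[OF x, of "\<alpha> x t"] F_\<alpha>[OF x] by auto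
    have p: "\<tau> (\<phi> z x) > 0" using \<tau>_pos x by blast
    have "\<alpha> x t \<ge> 0" using z t p by (metis mult_neg_pos not_less)
    then have "t \<le> \<alpha> x t * K" using z mK(4)[OF \<phi>_in[OF x, of z]] by (metis mult_left_mono)
    then show ?thesis using mK(2) by (simp add: field_simps)
  qed
  moreover have "\<bar>\<alpha> x t\<bar> \<le> 1 / m * \<bar>t\<bar>" if x: "x \<in> X" for x t
  proof -
    obtain z where z: "t = \<alpha> x t * \<tau> (\<phi> z x)" using F_mvt[OF x, of "\<alpha> x t"] F_\<alpha>[OF x] by auto
    have p: "\<tau> (\<phi> z x) \<ge> m" using mK(3) x by blast
    have "\<bar>t\<bar> = \<bar>\<alpha> x t\<bar> * \<tau> (\<phi> z x)" using arg_cong[OF z, of abs] p mK(1) by (simp add: abs_mult)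
    then have "\<bar>\<alpha> x t\<bar> * m \<le> \<bar>t\<bar>" using p by (metis abs_ge_zero mult_left_mono)
    then show ?thesis using mK(1) by (simp add: field_simps)
  qed
  ultimately show ?thesis using that[of "1 / K" "1 / m"] mK by simp
qed

definition \<alpha>c :: "('a, 'e) chart \<Rightarrow> real \<times> 'e \<Rightarrow> real" where
  "\<alpha>c c = (\<lambda>(t, u). \<alpha> (chart_inv c u) t)"

lemma \<alpha>c_pos:
  assumes "c \<in> atlas N" "u \<in> snd c ` fst c"
  shows "frechet_derivative (Fc c) (at (a, u)) (1, 0) > 0" "Fc c (\<alpha>c c (t, u), u) = t"
proof -
  obtain x where x: "x \<in> fst c" "u = snd c x" using assms by auto
  have X: "x \<in> X" using chart_point[OF assms(1) x(1)] .
  show "frechet_derivative (Fc c) (at (a, u)) (1, 0) > 0"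
    using F_frechet_time[OF assms(1) x(1), of a] \<tau>_pos[OF \<phi>_in[OF X]] x(2) by simp
  show "Fc c (\<alpha>c c (t, u), u) = t"
    using F_\<alpha>[OF X] x assms(1) by (simp add: Fc_def \<alpha>c_def)
qed

lemma \<alpha>c_Ck: assumes c: "c \<in> atlas N" shows "Ck_on n (UNIV \<times> snd c ` fst c) (\<alpha>c c)"
  by (rule Ck_on_implicit_monotone[OF chart_image_open[OF c] Fc_Ck[OF c] \<alpha>c_pos[OF c]])

lemma \<alpha>c_has_derivative:
  assumes c: "c \<in> atlas N" "x \<in> fst c"
  shows "(\<alpha>c c has_derivative (\<lambda>(dt, du).
      (dt - frechet_derivative (Fc c) (at (\<alpha> x t, snd c x)) (0, du)) * inverse (\<tau> (\<psi> t x)))) (at (t, snd c x))"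
  using has_derivative_implicit_monotone[OF chart_image_open[OF c(1)] Fc_Ck[OF c(1)] \<alpha>c_pos[OF c(1)], of "snd c x" t]
    F_frechet_time[OF c, of "\<alpha> x t"] c by (simp add: \<alpha>c_def \<psi>_eq)

lemma \<psi>_cont: "continuous_map (prod_topology euclidean (mtop N)) (mtop N) (\<lambda>(t, x). \<psi> t x)"
proof -
  have "continuous_map (prod_topology euclidean (mtop N)) euclidean (\<lambda>(t, x). \<alpha> x t)"
  proof (rule continuous_map_real_prod_charts)
    fix c assume "c \<in> atlas N"
    from Ck_on_continuous_on[OF \<alpha>c_Ck[OF this]]
    show "continuous_on (UNIV \<times> snd c ` fst c) (\<lambda>(t, u). (\<lambda>(t, x). \<alpha> x t) (t, chart_inv c u))"
      by (simp add: \<alpha>c_def)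
  qed
  then have "continuous_map (prod_topology euclidean (mtop N)) (prod_topology euclidean (mtop N))
      (\<lambda>p. (case p of (t, x) \<Rightarrow> \<alpha> x t, snd p))"
    by (intro continuous_map_pairedI continuous_map_snd)
  from continuous_map_compose[OF this \<phi>_cont]
  show ?thesis by (simp add: comp_def case_prod_unfold \<psi>_eq)
qed

lemma \<psi>_smooth_flow: "smooth_flow N \<psi>"
  unfolding smooth_flow_def
proof (intro conjI ballI allI)
  show "smooth_map (prod_manifold euclidean_manifold N) N (\<lambda>(t, x). \<psi> t x)"
  proof (rule smooth_map_prodI[OF smooth_manifold_euclidean smooth smooth])
    show cont: "continuous_map (prod_topology (mtop euclidean_manifold) (mtop N)) (mtop N) (\<lambda>(t, x). \<psi> t x)"
      using \<psi>_cont by simp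
    fix r :: "(real, real) chart" and c d n
    assume r: "r \<in> atlas euclidean_manifold" and c: "c \<in> atlas N" and d: "d \<in> atlas N"
    let ?W = "prod_dom r c d (\<lambda>(t, x). \<psi> t x)"
    have W: "open ?W" by (rule prod_dom_open[OF smooth_manifold_euclidean smooth smooth cont r c d])
    have sub: "?W \<subseteq> UNIV \<times> snd c ` fst c" by (auto simp: prod_dom_def)
    have "Ck_on n ?W (\<lambda>p. flowc c d (\<alpha>c c p, snd p))"
    proof (rule Ck_on_compose[OF W flowc_Ck[OF c d]])
      show "Ck_on n ?W (\<lambda>p. (\<alpha>c c p, snd p))"
        by (intro Ck_on_Pair W Ck_on_snd Ck_on_subset[OF \<alpha>c_Ck[OF c] sub])
      show "(\<lambda>p. (\<alpha>c c p, snd p)) ` ?W \<subseteq> flow_dom c d"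
        using r by (auto simp: prod_dom_def flow_dom_def \<alpha>c_def \<psi>_eq)
    qed
    then show "Ck_on n ?W (\<lambda>(u, v). snd d (case (chart_inv r u, chart_inv c v) of (t, x) \<Rightarrow> \<psi> t x))"
      by (rule Ck_on_cong[OF W, rotated]) (use r in \<open>auto simp: flowc_def \<alpha>c_def \<psi>_eq\<close>)
  qed
qed (use \<psi>_0 \<psi>_add in auto)

text \<open>The point \<open>x\<close> enters \<open>\<phi> (\<alpha> x t) x\<close> twice: as
  initial point, which gives the derivative of \<open>\<phi>\<close>, and through the stopping time,
  which gives a multiple of the generator at the end point. Differentiating
  \<open>F (\<alpha> x t) x = t\<close> determines that multiple.\<close>

lemma \<psi>_has_mderiv:
  assumes x: "x \<in> X"
  shows "has_mderiv N N (\<psi> t) x (\<lambda>v. mderiv N N (\<phi> (\<alpha> x t)) x v - (dF (\<alpha> x t) x v / \<tau> (\<psi> t x)) *\<^sub>R Z (\<psi> t x))"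
proof -
  define c d a where "c = chart_at N x" and "d = chart_at N (\<psi> t x)" and "a = \<alpha> x t"
  have \<psi>a: "\<psi> t x = \<phi> a x" by (simp add: a_def \<psi>_eq)
  have c: "c \<in> atlas N" "x \<in> fst c" unfolding c_def using chart_at[OF x] by auto
  have d: "d \<in> atlas N" "\<psi> t x \<in> fst d" unfolding d_def using chart_at[OF \<psi>_in[OF x]] by auto
  let ?D = "frechet_derivative (flowc c d) (at (a, snd c x))"
  let ?H = "frechet_derivative (Fc c) (at (a, snd c x))"
  have hd: "(flowc c d has_derivative ?D) (at (a, snd c x))"
    by (rule flowc_has_derivative) (use c d \<psi>a in auto)
  have "((\<lambda>u. (\<alpha>c c (t, u), u)) has_derivative (\<lambda>v. ((0 - ?H (0, v)) * inverse (\<tau> (\<psi> t x)), v))) (at (snd c x))"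
  proof (rule has_derivative_Pair[OF _ has_derivative_ident])
    have 1: "(Pair t has_derivative (\<lambda>v. (0, v))) (at (snd c x))"
      by (auto intro!: derivative_eq_intros)
    show "((\<lambda>u. \<alpha>c c (t, u)) has_derivative (\<lambda>v. (0 - ?H (0, v)) * inverse (\<tau> (\<psi> t x)))) (at (snd c x))"
      using has_derivative_compose[OF 1 \<alpha>c_has_derivative[OF c]] by (simp add: a_def)
  qed
  moreover have "(\<alpha>c c (t, snd c x), snd c x) = (a, snd c x)" using c by (simp add: \<alpha>c_def a_def)
  ultimately have "((\<lambda>u. flowc c d (\<alpha>c c (t, u), u)) has_derivative
      (\<lambda>v. ?D ((0 - ?H (0, v)) * inverse (\<tau> (\<psi> t x)), v))) (at (snd c x))"
    using has_derivative_compose[of "\<lambda>u. (\<alpha>c c (t, u), u)" _ "snd c x" UNIV "flowc c d" ?D] hd by simp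
  moreover have "(\<lambda>u. flowc c d (\<alpha>c c (t, u), u)) = snd d \<circ> \<psi> t \<circ> chart_inv c"
    by (auto simp: flowc_def \<alpha>c_def \<psi>_eq)
  moreover have "?D ((0 - ?H (0, v)) * inverse (\<tau> (\<psi> t x)), v)
      = mderiv N N (\<phi> a) x v - (dF a x v / \<tau> (\<psi> t x)) *\<^sub>R Z (\<psi> t x)" for v
  proof -
    have lin: "linear ?D" using has_derivative_linear[OF hd] .
    have "has_cderiv c d (\<phi> a) x (mderiv N N (\<phi> a) x)"
      using \<phi>_has_mderiv[OF x, of a] unfolding has_mderiv_def c_def d_def \<psi>a by blast
    moreover have "has_cderiv c d (\<phi> a) x (\<lambda>v. ?D (0, v))"
      by (rule \<phi>_has_cderiv) (use c d \<psi>a in auto)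
    ultimately have 1: "mderiv N N (\<phi> a) x v = ?D (0, v)"
      unfolding has_cderiv_def using has_derivative_unique by metis
    have "has_cderiv rchart d (\<lambda>s. \<phi> s x) a (\<lambda>h. h *\<^sub>R Z (\<phi> a x))"
      using curve_has_mderiv[OF x, of a] unfolding has_mderiv_def d_def \<psi>a by simp
    moreover have "has_cderiv rchart d (\<lambda>s. \<phi> s x) a (\<lambda>h. ?D (h, 0))"
      by (rule curve_has_cderiv) (use c d \<psi>a in auto)
    ultimately have 2: "?D (h, 0) = h *\<^sub>R Z (\<psi> t x)" for h
      unfolding has_cderiv_def \<psi>a using has_derivative_unique by metis
    have "has_cderiv c rchart (F a) x (dF a x)"
      using F_has_mderiv[OF x, of a] unfolding has_mderiv_euclidean_iff c_def by blast
    then have 3: "dF a x v = ?H (0, v)"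
      using F_has_cderiv[OF c, of a] unfolding has_cderiv_def using has_derivative_unique by metis
    let ?h = "(0 - ?H (0, v)) * inverse (\<tau> (\<psi> t x))"
    have "?D (?h, v) = ?D (?h, 0) + ?D (0, v)"
      using linear_add[OF lin, of "(?h, 0)" "(0, v)"] by simp
    then show ?thesis unfolding 1[symmetric] 2 3[symmetric] by (simp add: divide_inverse)
  qed
  ultimately have "has_cderiv c d (\<psi> t) x (\<lambda>v. mderiv N N (\<phi> a) x v - (dF a x v / \<tau> (\<psi> t x)) *\<^sub>R Z (\<psi> t x))"
    unfolding has_cderiv_def by simp
  moreover have "cont_at N N (\<psi> t) x"
  proof (rule cont_at_continuous_map[OF _ x])
    have "continuous_map (mtop N) (prod_topology euclidean (mtop N)) (\<lambda>x. (t, x))"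
      by (intro continuous_map_pairedI) auto
    from continuous_map_compose[OF this \<psi>_cont] show "continuous_map (mtop N) (mtop N) (\<psi> t)"
      by (simp add: comp_def)
  qed
  ultimately show ?thesis
    unfolding has_mderiv_def c_def d_def a_def using x by blast
qed

lemmas mderiv_\<psi> = mderiv_eq[OF \<psi>_has_mderiv]

end

section \<open>Flows with an invariant frame\<close>

text \<open>\<open>\<theta> x\<close> identifies a fixed vector space with the tangent space at
  \<open>x\<close>, and in this frame the derivative of the flow is \<open>L t\<close> at every
  point. Nothing else is demanded of \<open>L\<close>; that it is a \<open>linear_flow\<close> is
  deduced. Nonemptiness supplies a point at which to read off its properties.\<close>

locale framed_flow = time_changed_flow N \<phi> \<tau>
  for N :: "('a, 'e::euclidean_space) manifold" and \<phi> :: "real \<Rightarrow> 'a \<Rightarrow> 'a" and \<tau> :: "'a \<Rightarrow> real" +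
  fixes g :: "'a \<Rightarrow> 'e \<Rightarrow> 'e \<Rightarrow> real" and \<theta> :: "'a \<Rightarrow> 'e \<Rightarrow> 'e" and L :: "real \<Rightarrow> 'e \<Rightarrow> 'e"
  assumes metric: "riemannian_metric N g"
    and \<theta>_linear: "\<And>x. x \<in> topspace (mtop N) \<Longrightarrow> linear (\<theta> x)"
    and \<theta>_inj: "\<And>x. x \<in> topspace (mtop N) \<Longrightarrow> inj (\<theta> x)"
    and \<theta>_section: "\<And>v. continuous_section N (topspace (mtop N)) (\<lambda>x. \<theta> x v)"
    and \<theta>_equivariant: "\<And>x t v. x \<in> topspace (mtop N) \<Longrightarrow> mderiv N N (\<phi> t) x (\<theta> x v) = \<theta> (\<phi> t x) (L t v)"
    and nonempty: "topspace (mtop N) \<noteq> {}"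
begin

lemma \<theta>_cont: "cont_along (mtop N) (\<lambda>x. x) (\<lambda>x. \<theta> x v)"
  using \<theta>_section cont_along_section by blast

lemma \<theta>_bounds:
  obtains K where "K > 0" "\<And>x v. x \<in> X \<Longrightarrow> norm v \<le> K * metric_norm g x (\<theta> x v)"
    "\<And>x v. x \<in> X \<Longrightarrow> metric_norm g x (\<theta> x v) \<le> K * norm v"
proof -
  show ?thesis by (rule frame_norm_bounds[OF compact metric \<theta>_linear \<theta>_inj \<theta>_cont that])
qed

lemma \<theta>_lower:
  obtains K where "K > 0" "\<And>x v. x \<in> X \<Longrightarrow> norm v \<le> K * metric_norm g x (\<theta> x v)"
  by (rule \<theta>_bounds) (rule that)

lemma \<theta>_injD: "x \<in> X \<Longrightarrow> \<theta> x v = \<theta> x w \<Longrightarrow> v = w"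
  using \<theta>_inj by (meson injD)

lemma \<theta>_add: "x \<in> X \<Longrightarrow> \<theta> x (v + w) = \<theta> x v + \<theta> x w"
  using linear_add[OF \<theta>_linear] .

lemma \<theta>_scale: "x \<in> X \<Longrightarrow> \<theta> x (c *\<^sub>R v) = c *\<^sub>R \<theta> x v"
  using linear_cmul[OF \<theta>_linear] .

lemma flowc_deriv_cont:
  "c \<in> atlas N \<Longrightarrow> d \<in> atlas N \<Longrightarrow>
    continuous_on (flow_dom c d) (\<lambda>p. frechet_derivative (flowc c d) (at p) w)"
  by (rule Ck_on_continuous_on[OF Ck_on_Suc_derivative[OF flowc_Ck]])

lemma Fc_deriv_cont:
  "c \<in> atlas N \<Longrightarrow> continuous_on (UNIV \<times> snd c ` fst c) (\<lambda>p. frechet_derivative (Fc c) (at p) w)"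
  by (rule Ck_on_continuous_on[OF Ck_on_Suc_derivative[OF Fc_Ck]])

text \<open>The derivative of the flow is continuous along the compact piece of orbit over
  \<open>{-1..1}\<close>. This is the source of the local boundedness of \<open>L\<close>.\<close>

lemma orbit_bounded:
  assumes x: "x \<in> X"
  shows "\<exists>B. \<forall>t. \<bar>t\<bar> \<le> 1 \<longrightarrow> metric_norm g (\<phi> t x) (mderiv N N (\<phi> t) x v) \<le> B"
proof -
  let ?s = "\<lambda>t. mderiv N N (\<phi> t) x v"
  have "cont_along euclidean (\<lambda>t. \<phi> t x) ?s"
    unfolding cont_along_def
  proof
    fix d assume d: "d \<in> atlas N"
    define c where "c = chart_at N x"
    have c: "c \<in> atlas N" "x \<in> fst c" unfolding c_def using chart_at[OF x] by auto
    let ?U = "{t. \<phi> t x \<in> fst d}"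
    have "continuous_on ?U (\<lambda>t. frechet_derivative (flowc c d) (at (t, snd c x)) (0, v))"
      by (rule continuous_on_compose2[OF flowc_deriv_cont[OF c(1) d]])
         (use c in \<open>auto intro!: continuous_intros simp: flow_dom_iff\<close>)
    moreover have "frechet_derivative (flowc c d) (at (t, snd c x)) (0, v)
        = coord_change (chart_at N (\<phi> t x)) d (\<phi> t x) (?s t)" if "t \<in> ?U" for t
    proof -
      have "has_cderiv c d (\<phi> t) x (\<lambda>w. coord_change (chart_at N (\<phi> t x)) d (\<phi> t x)
          (mderiv N N (\<phi> t) x (coord_change c (chart_at N x) x w)))"
        by (rule has_mderivD[where f = "\<phi> t", OF smooth smooth \<phi>_has_mderiv[OF x] c d]) (use that in auto)
      moreover have "has_cderiv c d (\<phi> t) x (\<lambda>w. frechet_derivative (flowc c d) (at (t, snd c x)) (0, w))"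
        by (rule \<phi>_has_cderiv[OF c(1) d c(2)]) (use that in auto)
      ultimately have "(\<lambda>w. frechet_derivative (flowc c d) (at (t, snd c x)) (0, w)) =
          (\<lambda>w. coord_change (chart_at N (\<phi> t x)) d (\<phi> t x)
          (mderiv N N (\<phi> t) x (coord_change c (chart_at N x) x w)))"
        unfolding has_cderiv_def using has_derivative_unique by metis
      from fun_cong[OF this, of v] show ?thesis using coord_change_self[OF c] by (simp add: c_def)
    qed
    ultimately have "continuous_on ?U (\<lambda>t. coord_change (chart_at N (\<phi> t x)) d (\<phi> t x) (?s t))"
      by (rule continuous_on_eq)
    then show "continuous_map (subtopology euclidean {z \<in> topspace euclidean. \<phi> z x \<in> fst d}) euclidean
        (\<lambda>z. coord_change (chart_at N (\<phi> z x)) d (\<phi> z x) (?s z))" by simp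
  qed
  from continuous_map_metric_along[OF metric curve_continuous_map[OF x] this this]
  have "continuous_on UNIV (\<lambda>t. metric_norm g (\<phi> t x) (?s t))"
    unfolding metric_norm_def by (auto intro!: continuous_intros)
  then have "compact ((\<lambda>t. metric_norm g (\<phi> t x) (?s t)) ` {-1..1})"
    by (intro compact_continuous_image) (auto intro: continuous_on_subset)
  then obtain B where B: "\<And>y. y \<in> (\<lambda>t. metric_norm g (\<phi> t x) (?s t)) ` {-1..1} \<Longrightarrow> norm y \<le> B"
    using compact_imp_bounded bounded_iff by metis
  have "metric_norm g (\<phi> t x) (?s t) \<le> B" if "\<bar>t\<bar> \<le> 1" for t
  proof -
    have "t \<in> {-1..1}" using that by (auto simp: abs_le_iff)
    from B[OF imageI[OF this]] show ?thesis by simp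
  qed
  then show ?thesis by blast
qed

text \<open>All properties are inherited from the derivatives of \<open>\<phi>\<close> at a single
  point, because \<open>\<theta>\<close> is injective there and along its orbit.\<close>

lemma linear_flow_L: "linear_flow L"
proof (rule linear_flow.intro)
  obtain x where x: "x \<in> X" using nonempty by blast
  have lin: "linear (mderiv N N (\<phi> t) x)" for t using mderiv_\<phi>_linear[OF x] .
  show "linear (L t)" for t
  proof (rule linearI)
    fix v w c
    have "\<theta> (\<phi> t x) (L t (v + w)) = \<theta> (\<phi> t x) (L t v + L t w)"
      using x by (simp add: \<theta>_equivariant[symmetric] \<theta>_add linear_add[OF lin])
    then show "L t (v + w) = L t v + L t w" using \<theta>_injD x by blast
    have "\<theta> (\<phi> t x) (L t (c *\<^sub>R v)) = \<theta> (\<phi> t x) (c *\<^sub>R L t v)"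
      using x by (simp add: \<theta>_equivariant[symmetric] \<theta>_scale linear_cmul[OF lin])
    then show "L t (c *\<^sub>R v) = c *\<^sub>R L t v" using \<theta>_injD x by blast
  qed
  show "L 0 v = v" for v
    using \<theta>_equivariant[OF x, of 0 v] mderiv_\<phi>_0[OF x] \<theta>_injD[OF x] x by simp
  show "L (s + t) v = L s (L t v)" for s t v
  proof -
    have "\<theta> (\<phi> s (\<phi> t x)) (L (s + t) v) = \<theta> (\<phi> s (\<phi> t x)) (L s (L t v))"
      using \<theta>_equivariant[OF x, of "s + t" v] mderiv_\<phi>_add[OF x, of s t "\<theta> x v"] x
      by (simp add: \<theta>_equivariant \<phi>_add)
    then show ?thesis using \<theta>_injD x by blast
  qed
  show "\<exists>K. \<forall>t. \<bar>t\<bar> \<le> 1 \<longrightarrow> norm (L t v) \<le> K" for v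
  proof -
    obtain K where K: "K > 0" "\<And>x v. x \<in> X \<Longrightarrow> norm v \<le> K * metric_norm g x (\<theta> x v)"
      by (rule \<theta>_lower) (rule that)
    obtain B where B: "\<And>t. \<bar>t\<bar> \<le> 1 \<Longrightarrow> metric_norm g (\<phi> t x) (mderiv N N (\<phi> t) x (\<theta> x v)) \<le> B"
      using orbit_bounded[OF x] by blast
    have "norm (L t v) \<le> K * B" if "\<bar>t\<bar> \<le> 1" for t
      using K(2)[OF \<phi>_in[OF x, of t], of "L t v"] B[OF that] K(1) unfolding \<theta>_equivariant[OF x]
      by (meson mult_left_mono less_imp_le order_trans)
    then show ?thesis by blast
  qed
qed

sublocale linear_flow L by (rule linear_flow_L)

text \<open>The coordinates of the generator in the frame. They vary with \<open>x\<close>, but stay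
  within \<open>Center\<close> (\<open>W_Center\<close>).\<close>

definition W :: "'a \<Rightarrow> 'e" where "W x = (SOME w. \<theta> x w = Z x)"

lemma \<theta>_W: assumes x: "x \<in> X" shows "\<theta> x (W x) = Z x"
proof -
  have "surj (\<theta> x)" by (rule linear_inj_imp_surj[OF \<theta>_linear[OF x] \<theta>_inj[OF x]])
  then have "\<exists>w. \<theta> x w = Z x" by (metis surjD)
  then show ?thesis unfolding W_def by (rule someI_ex)
qed

lemma Z_cont: "cont_along (mtop N) (\<lambda>x. x) Z"
  unfolding cont_along_def
proof
  fix c assume c: "c \<in> atlas N"
  have eq: "{z \<in> X. z \<in> fst c} = fst c" using chart_point[OF c] by auto
  have "continuous_on (snd c ` fst c) (\<lambda>u. frechet_derivative (flowc c c) (at (0, u)) (1, 0))"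
    by (rule continuous_on_compose2[OF flowc_deriv_cont[OF c c]])
       (use c chart_point[OF c] in \<open>auto intro!: continuous_intros simp: flow_dom_iff\<close>)
  then have "continuous_map (top_of_set (snd c ` fst c)) euclidean (\<lambda>u. frechet_derivative (flowc c c) (at (0, u)) (1, 0))"
    by simp
  from continuous_map_compose[OF homeomorphic_imp_continuous_map[OF chart_homeo[OF c]] this]
  have "continuous_map (subtopology (mtop N) (fst c)) euclidean
      (\<lambda>x. frechet_derivative (flowc c c) (at (0, snd c x)) (1, 0))" by (simp add: comp_def)
  then have "continuous_map (subtopology (mtop N) (fst c)) euclidean
      (\<lambda>x. coord_change (chart_at N x) c x (Z x))"
  proof (rule continuous_map_eq)
    fix x assume "x \<in> topspace (subtopology (mtop N) (fst c))"
    then have x: "x \<in> fst c" "x \<in> X" by auto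
    have x0: "\<phi> 0 x \<in> fst c" using x by simp
    have "has_cderiv rchart c (\<lambda>s. \<phi> s x) 0 (\<lambda>h. frechet_derivative (flowc c c) (at (0, snd c x)) (h, 0))"
      by (rule curve_has_cderiv[OF c c x(1) x0])
    moreover have "has_cderiv rchart c (\<lambda>s. \<phi> s x) 0 (\<lambda>h. coord_change (chart_at N (\<phi> 0 x)) c (\<phi> 0 x)
        (coord_change rchart (chart_at euclidean_manifold (0::real)) 0 h *\<^sub>R Z (\<phi> 0 x)))"
      by (rule has_mderivD[where f = "\<lambda>s. \<phi> s x", OF smooth_manifold_euclidean smooth curve_has_mderiv[OF x(2), of 0]])
         (use c x0 in auto)
    ultimately have "(\<lambda>h. frechet_derivative (flowc c c) (at (0, snd c x)) (h, 0)) =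
        (\<lambda>h. coord_change (chart_at N (\<phi> 0 x)) c (\<phi> 0 x)
        (coord_change rchart (chart_at euclidean_manifold (0::real)) 0 h *\<^sub>R Z (\<phi> 0 x)))"
      unfolding has_cderiv_def by (rule has_derivative_unique)
    from fun_cong[OF this, of 1]
    show "frechet_derivative (flowc c c) (at (0, snd c x)) (1, 0) = coord_change (chart_at N x) c x (Z x)"
      using smooth_mfd.coord_change_self[OF smooth_mfd.intro[OF smooth_manifold_euclidean], of rchart 0 1] x by simp
  qed
  then show "continuous_map (subtopology (mtop N) {z \<in> X. z \<in> fst c}) euclidean
      (\<lambda>z. coord_change (chart_at N z) c z (Z z))" unfolding eq .
qed

lemma W_bounded: obtains B where "B > 0" "\<And>x. x \<in> X \<Longrightarrow> norm (W x) \<le> B"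
proof -
  obtain K where K: "K > 0" "\<And>x v. x \<in> X \<Longrightarrow> norm v \<le> K * metric_norm g x (\<theta> x v)"
    by (rule \<theta>_lower) (rule that)
  have "continuous_map (mtop N) euclidean (\<lambda>x. g x (Z x) (Z x))"
    by (rule continuous_map_metric_along[OF metric _ Z_cont Z_cont]) auto
  then obtain B where B: "B > 0" "\<And>x. x \<in> X \<Longrightarrow> \<bar>g x (Z x) (Z x)\<bar> \<le> B"
    using compact_space_real_bounds[OF compact] by blast
  have "norm (W x) \<le> K * sqrt B" if x: "x \<in> X" for x
  proof -
    have "metric_norm g x (Z x) \<le> sqrt B" unfolding metric_norm_def using B(2)[OF x] by simp
    then show ?thesis
      using K(2)[OF x, of "W x"] K(1) unfolding \<theta>_W[OF x] by (meson mult_left_mono less_imp_le order_trans)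
  qed
  then show ?thesis using that[of "K * sqrt B"] K(1) B(1) by simp
qed

lemma L_W: assumes x: "x \<in> X" shows "L t (W x) = W (\<phi> t x)"
proof -
  have "\<theta> (\<phi> t x) (L t (W x)) = \<theta> (\<phi> t x) (W (\<phi> t x))"
    using \<theta>_equivariant[OF x, of t "W x"] mderiv_\<phi>_Z[OF x, of t] \<theta>_W x by simp
  then show ?thesis using \<theta>_injD x by blast
qed

text \<open>The orbit of \<open>W x\<close> under \<open>L\<close> consists of values of \<open>W\<close>, so it is bounded.\<close>

lemma W_Center: assumes x: "x \<in> X" shows "W x \<in> Center"
proof -
  obtain B where B: "B > 0" "\<And>x. x \<in> X \<Longrightarrow> norm (W x) \<le> B" using W_bounded by blast
  have "norm (L t (W x)) \<le> B * exp (\<epsilon> * \<bar>t\<bar>)" if "\<epsilon> > 0" for \<epsilon> t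
  proof -
    have "norm (L t (W x)) \<le> B * 1" using B(2)[OF \<phi>_in[OF x]] L_W[OF x] by simp
    also have "\<dots> \<le> B * exp (\<epsilon> * \<bar>t\<bar>)" using B(1) that by (intro mult_left_mono) auto
    finally show ?thesis .
  qed
  then show ?thesis unfolding Center_def by blast
qed

section \<open>The cocycle in the frame and its limits\<close>

definition \<kappa> :: "'a \<Rightarrow> real \<Rightarrow> 'e \<Rightarrow> real" where "\<kappa> x a v = dF a x (\<theta> x v)"

lemma dF_chart:
  assumes c: "c \<in> atlas N" "x \<in> fst c"
  shows "dF a x v = (\<Sum>b\<in>Basis. (coord_change (chart_at N x) c x v \<bullet> b) *
    frechet_derivative (Fc c) (at (a, snd c x)) (0, b))"
proof -
  note x = chart_point[OF c] note d = chart_at[OF x]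
  let ?H = "frechet_derivative (Fc c) (at (a, snd c x))"
  have hd: "(Fc c has_derivative ?H) (at (a, snd c x))" by (rule Fc_has_derivative[OF c])
  have "has_mderiv N euclidean_manifold (F a) x
     (\<lambda>v. coord_change rchart (chart_at euclidean_manifold (F a x)) (F a x) (?H (0, coord_change (chart_at N x) c x v)))"
    by (rule has_mderivI[OF smooth smooth_manifold_euclidean F_cont_at[OF x] c _ _ F_has_cderiv[OF c]]) auto
  from fun_cong[OF mderiv_eq[OF this], of v]
  have "dF a x v = ?H (0, coord_change (chart_at N x) c x v)"
    using smooth_mfd.coord_change_self[OF smooth_mfd.intro[OF smooth_manifold_euclidean], of rchart "F a x"] by simp
  also have "\<dots> = (\<Sum>b\<in>Basis. (coord_change (chart_at N x) c x v \<bullet> b) *\<^sub>R ?H (0, b))"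
  proof (rule linear_sum_Basis[of "\<lambda>w. ?H (0, w)"])
    have "linear (\<lambda>w::'e. (0::real, w))" by (rule linearI) auto
    from linear_compose[OF this has_derivative_linear[OF hd]]
    show "linear (\<lambda>w. ?H (0, w))" by (simp add: comp_def)
  qed
  finally show ?thesis by simp
qed

lemma \<kappa>_cont: "continuous_map (prod_topology euclidean (mtop N)) euclidean (\<lambda>(a, x). \<kappa> x a v)"
proof (rule continuous_map_real_prod_charts)
  fix c assume c: "c \<in> atlas N"
  let ?W = "(UNIV :: real set) \<times> snd c ` fst c"
  define \<sigma> where "\<sigma> u = coord_change (chart_at N (chart_inv c u)) c (chart_inv c u) (\<theta> (chart_inv c u) v)" for u
  have "continuous_on (snd c ` fst c) \<sigma>"
    unfolding \<sigma>_def by (rule section_chart_continuous[OF \<theta>_cont c])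
  then have "continuous_on ?W (\<lambda>p. \<sigma> (snd p))"
    by (rule continuous_on_compose2) (auto intro!: continuous_intros)
  moreover have "continuous_on ?W (\<lambda>p. frechet_derivative (Fc c) (at p) (0, b))" for b
    by (rule Fc_deriv_cont[OF c])
  ultimately have "continuous_on ?W (\<lambda>p. \<Sum>b\<in>Basis. (\<sigma> (snd p) \<bullet> b) * frechet_derivative (Fc c) (at p) (0, b))"
    by (intro continuous_intros)
  moreover have "(\<Sum>b\<in>Basis. (\<sigma> (snd p) \<bullet> b) * frechet_derivative (Fc c) (at p) (0, b))
      = (\<lambda>(t, u). (\<lambda>(a, x). \<kappa> x a v) (t, chart_inv c u)) p" if pW: "p \<in> ?W" for p
  proof -
    obtain a x where p: "p = (a, snd c x)" "x \<in> fst c" using pW by (cases p) auto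
    then show ?thesis using c by (simp add: \<kappa>_def dF_chart[OF c p(2)] \<sigma>_def)
  qed
  ultimately show "continuous_on ?W (\<lambda>(t, u). (\<lambda>(a, x). \<kappa> x a v) (t, chart_inv c u))"
    by (rule continuous_on_eq)
qed

lemma \<kappa>_cont_space: "continuous_map (mtop N) euclidean (\<lambda>x. \<kappa> x a v)"
proof -
  have "continuous_map (mtop N) (prod_topology euclidean (mtop N)) (\<lambda>x. (a, x))"
    by (intro continuous_map_pairedI) auto
  from continuous_map_compose[OF this \<kappa>_cont[of v]] show ?thesis by (simp add: comp_def)
qed

lemma \<kappa>_lin: "x \<in> X \<Longrightarrow> linear (\<kappa> x a)"
  using linear_compose[OF \<theta>_linear dF_linear, of x x a] unfolding \<kappa>_def comp_def .

sublocale cocycle L X \<phi> \<kappa>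
proof (rule cocycle.intro[OF linear_flow_L], rule cocycle_axioms.intro)
  show "\<kappa> x (a + b) v = \<kappa> x a v + \<kappa> (\<phi> a x) b (L a v)" if "x \<in> X" for x a b v
    using dF_add[OF that, of a b "\<theta> x v"] \<theta>_equivariant[OF that] by (simp add: \<kappa>_def)
  show "\<exists>K. \<forall>x\<in>X. \<forall>a. \<bar>a\<bar> \<le> R \<longrightarrow> (\<forall>v. \<bar>\<kappa> x a v\<bar> \<le> K * norm v)" for R
  proof -
    \<comment> \<open>On each basis vector \<open>\<kappa>\<close> is continuous on a compact
      product of times and points, hence bounded; linearity in \<open>v\<close> extends the
      bound.\<close>
    let ?T = "prod_topology (top_of_set {- R..R}) (mtop N)"
    have T: "?T = subtopology (prod_topology euclidean (mtop N)) ({- R..R} \<times> X)"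
      by (simp add: prod_topology_subtopology)
    have "compact_space ?T"
      using compact by (simp add: compact_space_prod_topology compact_space_subtopology compactin_euclidean_iff)
    moreover have "continuous_map ?T euclidean (\<lambda>(a, x). \<kappa> x a b)" for b
      unfolding T by (rule continuous_map_from_subtopology[OF \<kappa>_cont])
    ultimately have "\<exists>K. \<forall>p\<in>topspace ?T. \<bar>(\<lambda>(a, x). \<kappa> x a b) p\<bar> \<le> K" for b
      using compact_space_real_bounds by metis
    then obtain K where K: "\<And>b p. p \<in> topspace ?T \<Longrightarrow> \<bar>(\<lambda>(a, x). \<kappa> x a b) p\<bar> \<le> K b" by metis
    have "\<bar>\<kappa> x a v\<bar> \<le> (\<Sum>b\<in>Basis. K b) * norm v" if "x \<in> X" "\<bar>a\<bar> \<le> R" for x a v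
    proof -
      have Kb: "\<bar>\<kappa> x a b\<bar> \<le> K b" for b using K[of "(a, x)" b] that by (auto simp: abs_le_iff)
      have "\<kappa> x a v = (\<Sum>b\<in>Basis. (v \<bullet> b) *\<^sub>R \<kappa> x a b)" by (rule linear_sum_Basis[OF \<kappa>_lin[OF that(1)]])
      then have "\<bar>\<kappa> x a v\<bar> \<le> (\<Sum>b\<in>Basis. \<bar>(v \<bullet> b) * \<kappa> x a b\<bar>)" by (simp add: sum_abs)
      also have "\<dots> \<le> (\<Sum>b\<in>Basis. K b * norm v)"
      proof (rule sum_mono)
        fix b :: 'e assume "b \<in> Basis"
        then have "\<bar>v \<bullet> b\<bar> \<le> norm v" by (rule Basis_le_norm)
        then have "\<bar>v \<bullet> b\<bar> * \<bar>\<kappa> x a b\<bar> \<le> norm v * K b" using Kb by (intro mult_mono) auto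
        then show "\<bar>(v \<bullet> b) * \<kappa> x a b\<bar> \<le> K b * norm v" by (simp add: abs_mult mult.commute)
      qed
      finally show ?thesis by (simp add: sum_distrib_right)
    qed
    then show ?thesis by blast
  qed
qed (use \<phi>_add \<kappa>_lin in auto)

interpretation rev: cocycle "\<lambda>t. L (- t)" X "\<lambda>t. \<phi> (- t)" "\<lambda>x a. \<kappa> x (- a)"
  by (rule cocycle_minus)

definition \<eta>u :: "'a \<Rightarrow> 'e \<Rightarrow> real" where
  "\<eta>u x v = cocycle.\<eta> (\<lambda>x a. \<kappa> x (- a)) x v"

text \<open>A uniform limit of continuous functions is continuous. The formulation with a general
  \<open>\<kappa>'\<close> covers forward and backward time.\<close>

lemma continuous_map_geometric_limit:
  assumes \<kappa>': "\<And>n. continuous_map (mtop N) euclidean (\<lambda>x. \<kappa>' x (real n))"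
    and q: "0 < q" "q < 1" and bound: "\<And>x n. x \<in> X \<Longrightarrow> \<bar>h x - \<kappa>' x (real n)\<bar> \<le> C * q ^ n * D"
  shows "continuous_map (mtop N) euclidean (h :: 'a \<Rightarrow> real)"
proof -
  have "continuous_map (mtop N) Met_TC.mtopology h"
  proof (rule Met_TC.continuous_map_uniform_limit[where F = sequentially and f = "\<lambda>n x. \<kappa>' x (real n)"])
    show "\<forall>\<^sub>F n in sequentially. continuous_map (mtop N) Met_TC.mtopology (\<lambda>x. \<kappa>' x (real n))"
      using \<kappa>' by (simp add: mtopology_is_euclidean)
    fix e :: real assume e: "0 < e"
    have "(\<lambda>n. C * q ^ n * D) \<longlonglongrightarrow> C * 0 * D"
      using q by (intro tendsto_intros LIMSEQ_power_zero) auto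
    then have "\<forall>\<^sub>F n in sequentially. C * q ^ n * D < e"
      using order_tendstoD(2)[of _ 0 sequentially e] e by simp
    then show "\<forall>\<^sub>F n in sequentially. \<forall>x\<in>X. h x \<in> UNIV \<and> dist (\<kappa>' x (real n)) (h x) < e"
    proof (rule eventually_mono, intro ballI conjI UNIV_I)
      fix n x assume "C * q ^ n * D < e" "x \<in> X"
      then show "dist (\<kappa>' x (real n)) (h x) < e"
        using bound[of x n] by (simp add: dist_real_def abs_minus_commute)
    qed
  qed simp
  then show ?thesis by (simp add: mtopology_is_euclidean)
qed

lemma \<eta>_cont: assumes v: "v \<in> Stable" shows "continuous_map (mtop N) euclidean (\<lambda>x. \<eta> x v)"
proof -
  obtain C q where q: "0 < q" "q < 1"
    "\<And>x v n. x \<in> X \<Longrightarrow> v \<in> Stable \<Longrightarrow> \<bar>\<eta> x v - \<kappa> x (real n) v\<bar> \<le> C * q ^ n * norm v"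
    by (rule \<eta>_convergence) (rule that)
  show ?thesis
    by (rule continuous_map_geometric_limit[where \<kappa>' = "\<lambda>x a. \<kappa> x a v", OF \<kappa>_cont_space q(1,2) q(3)]) (use v in auto)
qed

lemma \<eta>u_cont: assumes v: "v \<in> Unstable" shows "continuous_map (mtop N) euclidean (\<lambda>x. \<eta>u x v)"
proof -
  have v': "v \<in> rev.Stable" using v by (simp add: Stable_minus)
  obtain C q where q: "0 < q" "q < 1"
    "\<And>x v n. x \<in> X \<Longrightarrow> v \<in> rev.Stable \<Longrightarrow> \<bar>rev.\<eta> x v - \<kappa> x (- real n) v\<bar> \<le> C * q ^ n * norm v"
    by (rule rev.\<eta>_convergence) (rule that)
  show ?thesis
    unfolding \<eta>u_def
    by (rule continuous_map_geometric_limit[where \<kappa>' = "\<lambda>x a. \<kappa> x (- a) v", OF \<kappa>_cont_space q(1,2) q(3)]) (use v' in auto)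
qed

lemma \<eta>u_linear:
  assumes "x \<in> X" "v \<in> Unstable" "w \<in> Unstable"
  shows "\<eta>u x (v + w) = \<eta>u x v + \<eta>u x w" "\<eta>u x (c *\<^sub>R v) = c * \<eta>u x v"
  using rev.\<eta>_linear(1)[of x v w] rev.\<eta>_linear(2)[of x v w c] assms unfolding \<eta>u_def Stable_minus by auto

lemma \<eta>u_invariance:
  assumes "x \<in> X" "v \<in> Unstable"
  shows "\<eta>u (\<phi> a x) (L a v) = \<eta>u x v - \<kappa> x a v"
  using rev.\<eta>_invariance[of x v "- a"] assms unfolding \<eta>u_def Stable_minus by simp

text \<open>The two limits are joined into one functional that vanishes on \<open>Center\<close>, so
  that a single frame \<open>P\<close> describes all three bundles of the time change.\<close>

definition \<zeta> :: "'a \<Rightarrow> 'e \<Rightarrow> real" where "\<zeta> x v = \<eta> x (\<pi>s v) + \<eta>u x (\<pi>u v)"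

lemma \<zeta>_linear: assumes x: "x \<in> X" shows "linear (\<zeta> x)"
proof (rule linearI)
  show "\<zeta> x (v + w) = \<zeta> x v + \<zeta> x w" for v w
    using \<eta>_linear(1)[OF x \<pi>(1)[of v] \<pi>(1)[of w]] \<eta>u_linear(1)[OF x \<pi>(3)[of v] \<pi>(3)[of w]]
    by (simp add: \<zeta>_def linear_add[OF linear_\<pi>(1)] linear_add[OF linear_\<pi>(2)])
  show "\<zeta> x (c *\<^sub>R v) = c *\<^sub>R \<zeta> x v" for c v
    using \<eta>_linear(2)[OF x \<pi>(1)[of v] \<pi>(1)[of v], of c] \<eta>u_linear(2)[OF x \<pi>(3)[of v] \<pi>(3)[of v], of c]
    by (simp add: \<zeta>_def linear_cmul[OF linear_\<pi>(1)] linear_cmul[OF linear_\<pi>(2)] distrib_left)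
qed

lemma \<eta>_zeros: "x \<in> X \<Longrightarrow> \<eta> x 0 = 0" "x \<in> X \<Longrightarrow> \<eta>u x 0 = 0"
  using \<eta>_linear(2)[of x 0 0 0] \<eta>u_linear(2)[of x 0 0 0] by auto

lemma \<zeta>_Stable: "x \<in> X \<Longrightarrow> v \<in> Stable \<Longrightarrow> \<zeta> x v = \<eta> x v"
  by (simp add: \<zeta>_def \<pi>_Stable \<eta>_zeros)

lemma \<zeta>_Unstable: "x \<in> X \<Longrightarrow> v \<in> Unstable \<Longrightarrow> \<zeta> x v = \<eta>u x v"
  by (simp add: \<zeta>_def \<pi>_Unstable \<eta>_zeros)

lemma \<zeta>_Center: "x \<in> X \<Longrightarrow> v \<in> Center \<Longrightarrow> \<zeta> x v = 0"
  by (simp add: \<zeta>_def \<pi>_Center \<eta>_zeros)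

lemma \<zeta>_invariance:
  assumes "x \<in> X" "v \<in> Stable \<or> v \<in> Unstable"
  shows "\<zeta> (\<phi> a x) (L a v) = \<zeta> x v - \<kappa> x a v"
  using assms \<eta>_invariance[of x v a] \<eta>u_invariance[of x v a]
    Stable_invariant[of v a] Unstable_invariant[of v a]
  by (auto simp: \<zeta>_Stable \<zeta>_Unstable)

lemma \<zeta>_cont: "continuous_map (mtop N) euclidean (\<lambda>x. \<zeta> x v)"
  unfolding \<zeta>_def by (intro continuous_map_add \<eta>_cont \<eta>u_cont \<pi>)

text \<open>
  Shearing the frame along the flow direction by \<open>\<zeta> / \<tau>\<close> makes the images of the stable and
  unstable subspaces invariant under the time change; central vectors are not moved.
\<close>

definition P :: "'a \<Rightarrow> 'e \<Rightarrow> 'e" where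
  "P x v = \<theta> x v + (\<zeta> x v / \<tau> x) *\<^sub>R Z x"

lemma P_linear: assumes x: "x \<in> X" shows "linear (P x)"
proof (rule linearI)
  show "P x (v + w) = P x v + P x w" for v w
    by (simp add: P_def \<theta>_add[OF x] linear_add[OF \<zeta>_linear[OF x]] add_divide_distrib scaleR_add_left)
  show "P x (c *\<^sub>R v) = c *\<^sub>R P x v" for c v
    by (simp add: P_def \<theta>_scale[OF x] linear_cmul[OF \<zeta>_linear[OF x]] scaleR_add_right)
qed

text \<open>A vector in the kernel is a multiple of \<open>W x\<close>, hence central. There
  \<open>\<zeta>\<close> vanishes and \<open>P\<close> agrees with the injective
  \<open>\<theta>\<close>.\<close>

lemma P_inj: assumes x: "x \<in> X" shows "inj (P x)"
  unfolding linear_injective_0[OF P_linear[OF x]]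
proof (intro allI impI)
  fix v assume "P x v = 0"
  then have "\<theta> x (v + (\<zeta> x v / \<tau> x) *\<^sub>R W x) = \<theta> x 0"
    by (simp add: P_def \<theta>_add[OF x] \<theta>_scale[OF x] \<theta>_W[OF x] linear_0[OF \<theta>_linear[OF x]])
  then have v: "v + (\<zeta> x v / \<tau> x) *\<^sub>R W x = 0" by (rule \<theta>_injD[OF x])
  then have "v = - (\<zeta> x v / \<tau> x) *\<^sub>R W x" by (simp add: eq_neg_iff_add_eq_0)
  moreover have "- (\<zeta> x v / \<tau> x) *\<^sub>R W x \<in> Center"
    by (rule subspace_scale[OF subspace_Center W_Center[OF x]])
  ultimately have "v \<in> Center" by metis
  then show "v = 0" using v \<zeta>_Center[OF x] by simp
qed

lemma P_cont: "cont_along (mtop N) (\<lambda>x. x) (\<lambda>x. P x v)"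
  unfolding P_def
proof (rule cont_along_add_scale[OF _ \<theta>_cont Z_cont])
  have "continuous_map (mtop N) euclidean \<tau>" using \<tau>_smooth unfolding smooth_map_def by simp
  then show "continuous_map (mtop N) euclidean (\<lambda>x. \<zeta> x v / \<tau> x)"
    using \<tau>_pos by (intro continuous_map_real_divide \<zeta>_cont) (auto simp: less_imp_neq[symmetric])
qed simp

lemma P_Center: "x \<in> X \<Longrightarrow> v \<in> Center \<Longrightarrow> P x v = \<theta> x v"
  by (simp add: P_def \<zeta>_Center)

text \<open>By \<open>dF_Z\<close>, the generator part contributes
  \<open>c * (\<tau> (\<psi> t x) - \<tau> x)\<close> to the derivative of \<open>F\<close>; after
  division by \<open>\<tau> (\<psi> t x)\<close> only \<open>c * \<tau> x\<close> is left of
  \<open>c\<close>. Hence the product of the coefficient with \<open>\<tau>\<close> is transported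
  unchanged, up to the defect \<open>\<kappa>\<close>.\<close>

lemma mderiv_\<psi>_\<theta>:
  assumes x: "x \<in> X"
  shows "mderiv N N (\<psi> t) x (\<theta> x v + c *\<^sub>R Z x) =
    \<theta> (\<psi> t x) (L (\<alpha> x t) v) + ((c * \<tau> x - \<kappa> x (\<alpha> x t) v) / \<tau> (\<psi> t x)) *\<^sub>R Z (\<psi> t x)"
proof -
  let ?a = "\<alpha> x t" and ?y = "\<psi> t x"
  have y: "\<phi> ?a x = ?y" by (simp add: \<psi>_eq)
  have p: "\<tau> ?y > 0" using \<tau>_pos x by blast
  have 1: "mderiv N N (\<phi> ?a) x (\<theta> x v + c *\<^sub>R Z x) = \<theta> ?y (L ?a v) + c *\<^sub>R Z ?y"
    using \<theta>_equivariant[OF x, of ?a v] mderiv_\<phi>_Z[OF x, of ?a]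
    by (simp add: linear_add[OF mderiv_\<phi>_linear[OF x]] linear_cmul[OF mderiv_\<phi>_linear[OF x]] y)
  have 2: "dF ?a x (\<theta> x v + c *\<^sub>R Z x) = \<kappa> x ?a v + c * (\<tau> ?y - \<tau> x)"
    using dF_Z[OF x, of ?a] by (simp add: linear_add[OF dF_linear[OF x]] linear_cmul[OF dF_linear[OF x]] y \<kappa>_def)
  have "mderiv N N (\<psi> t) x (\<theta> x v + c *\<^sub>R Z x)
    = \<theta> ?y (L ?a v) + (c - (\<kappa> x ?a v + c * (\<tau> ?y - \<tau> x)) / \<tau> ?y) *\<^sub>R Z ?y"
    unfolding mderiv_\<psi>[OF x] 1 2 by (simp add: algebra_simps)
  also have "c - (\<kappa> x ?a v + c * (\<tau> ?y - \<tau> x)) / \<tau> ?y = (c * \<tau> x - \<kappa> x ?a v) / \<tau> ?y"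
    using p by (simp add: field_simps)
  finally show ?thesis .
qed

text \<open>For \<open>c = \<zeta> x v / \<tau> x\<close> the new coefficient is \<open>(\<zeta> x v
  - \<kappa> x (\<alpha> x t) v) / \<tau> (\<psi> t x)\<close>, and
  \<open>\<zeta>_invariance\<close> recognizes it as the shear at the image point.\<close>

lemma mderiv_\<psi>_P:
  assumes x: "x \<in> X" and v: "v \<in> Stable \<or> v \<in> Unstable"
  shows "mderiv N N (\<psi> t) x (P x v) = P (\<psi> t x) (L (\<alpha> x t) v)"
proof -
  have "\<tau> x > 0" using \<tau>_pos[OF x] .
  then have "mderiv N N (\<psi> t) x (P x v) =
      \<theta> (\<psi> t x) (L (\<alpha> x t) v) + ((\<zeta> x v - \<kappa> x (\<alpha> x t) v) / \<tau> (\<psi> t x)) *\<^sub>R Z (\<psi> t x)"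
    unfolding P_def mderiv_\<psi>_\<theta>[OF x] by simp
  then show ?thesis
    using \<zeta>_invariance[OF x v, of "\<alpha> x t"] by (simp add: P_def \<psi>_eq)
qed

text \<open>On central vectors \<open>\<kappa>\<close> need not converge, but the defect is a
  multiple of \<open>W\<close>, which is itself central. The bundle is invariant even though the
  action on it is no longer \<open>L\<close>.\<close>

lemma mderiv_\<psi>_Center:
  fixes t :: real
  assumes x: "x \<in> X" and v: "v \<in> Center"
  defines "w \<equiv> L (\<alpha> x t) v - (\<kappa> x (\<alpha> x t) v / \<tau> (\<psi> t x)) *\<^sub>R W (\<psi> t x)"
  shows "mderiv N N (\<psi> t) x (P x v) = P (\<psi> t x) w" "w \<in> Center"
proof -
  have y: "\<psi> t x \<in> X" using x by blast
  show w: "w \<in> Center"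
    unfolding w_def by (intro subspace_diff subspace_Center Center_invariant v subspace_scale W_Center y)
  have "mderiv N N (\<psi> t) x (P x v) = mderiv N N (\<psi> t) x (\<theta> x v + 0 *\<^sub>R Z x)"
    by (simp add: P_Center[OF x v])
  also have "\<dots> = \<theta> (\<psi> t x) w"
    unfolding mderiv_\<psi>_\<theta>[OF x] w_def
    by (simp add: linear_diff[OF \<theta>_linear[OF y]] \<theta>_scale[OF y] \<theta>_W[OF y])
  finally show "mderiv N N (\<psi> t) x (P x v) = P (\<psi> t x) w" using P_Center[OF y w] by simp
qed

lemma mderiv_\<psi>_inverse:
  assumes x: "x \<in> X"
  shows "\<psi> t (\<psi> (- t) x) = x" "mderiv N N (\<psi> t) (\<psi> (- t) x) (mderiv N N (\<psi> (- t)) x v) = v"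
proof -
  have y: "\<psi> (- t) x \<in> X" using x by blast
  have inv: "\<psi> t (\<psi> (- t) x) = x" if "x \<in> X" for x
    using \<psi>_add[OF that, of t "- t"] \<psi>_0[OF that] by simp
  show "\<psi> t (\<psi> (- t) x) = x" by (rule inv[OF x])
  have h: "has_mderiv N N (\<psi> s) z (mderiv N N (\<psi> s) z)" if "z \<in> X" for s z
    using \<psi>_has_mderiv[OF that, of s] mderiv_\<psi>[OF that, of s] by simp
  have "has_mderiv N N (\<lambda>x. \<psi> t (\<psi> (- t) x)) x
      (\<lambda>v. mderiv N N (\<psi> t) (\<psi> (- t) x) (mderiv N N (\<psi> (- t)) x v))"
    by (rule has_mderiv_compose[OF smooth smooth h[OF x] h[OF y]])
  moreover have "has_mderiv N N (\<lambda>x. \<psi> t (\<psi> (- t) x)) x (\<lambda>v. v)"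
    by (rule has_mderiv_cong[OF smooth has_mderiv_id[OF smooth x] openin_topspace x]) (simp add: inv)
  ultimately have "(\<lambda>v. mderiv N N (\<psi> t) (\<psi> (- t) x) (mderiv N N (\<psi> (- t)) x v)) = (\<lambda>v. v)"
    by (rule has_mderiv_unique)
  from fun_cong[OF this, of v]
  show "mderiv N N (\<psi> t) (\<psi> (- t) x) (mderiv N N (\<psi> (- t)) x v) = v" .
qed

text \<open>One inclusion for all times is enough: applied at time \<open>- t\<close> it gives the
  reverse inclusion.\<close>

lemma bundle_invariant:
  assumes x: "x \<in> X" and V: "V = Stable \<or> V = Center \<or> V = Unstable"
  shows "mderiv N N (\<psi> t) x ` (P x ` V) = P (\<psi> t x) ` V"
proof -
  have sub: "mderiv N N (\<psi> t) x ` (P x ` V) \<subseteq> P (\<psi> t x) ` V" if x: "x \<in> X" for x t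
  proof
    fix w assume "w \<in> mderiv N N (\<psi> t) x ` (P x ` V)"
    then obtain v where v: "v \<in> V" "w = mderiv N N (\<psi> t) x (P x v)" by blast
    show "w \<in> P (\<psi> t x) ` V"
    proof (cases "V = Center")
      case True
      then show ?thesis using mderiv_\<psi>_Center[OF x, of v t] v by auto
    next
      case False
      then have "v \<in> Stable \<or> v \<in> Unstable" using V v(1) by auto
      from mderiv_\<psi>_P[OF x this, of t] v False V
      show ?thesis using Stable_invariant[of v] Unstable_invariant[of v] by auto
    qed
  qed
  show ?thesis
  proof
    show "P (\<psi> t x) ` V \<subseteq> mderiv N N (\<psi> t) x ` (P x ` V)"
    proof
      fix w assume w: "w \<in> P (\<psi> t x) ` V"
      have y: "\<psi> t x \<in> X" using x by blast
      have xy: "\<psi> (- t) (\<psi> t x) = x" using mderiv_\<psi>_inverse(1)[OF x, of "- t"] by simp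
      have "mderiv N N (\<psi> (- t)) (\<psi> t x) w \<in> P x ` V"
        using sub[OF y, of "- t"] w unfolding xy by blast
      moreover have "mderiv N N (\<psi> t) x (mderiv N N (\<psi> (- t)) (\<psi> t x) w) = w"
        using mderiv_\<psi>_inverse(2)[OF y, of t w] unfolding xy .
      ultimately show "w \<in> mderiv N N (\<psi> t) x ` (P x ` V)" by (metis imageI)
    qed
  qed (rule sub[OF x])
qed

lemma \<psi>_splitting:
  "invariant_splitting N \<psi> (\<lambda>x. P x ` Stable) (\<lambda>x. P x ` Center) (\<lambda>x. P x ` Unstable)"
  unfolding invariant_splitting_def
proof (intro conjI ballI allI)
  show "subbundle N (\<lambda>x. P x ` Stable)"
    by (rule subbundle_frame_image[OF P_linear P_inj P_cont subspace_Stable])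
  show "subbundle N (\<lambda>x. P x ` Center)"
    by (rule subbundle_frame_image[OF P_linear P_inj P_cont subspace_Center])
  show "subbundle N (\<lambda>x. P x ` Unstable)"
    by (rule subbundle_frame_image[OF P_linear P_inj P_cont subspace_Unstable])
next
  fix x v assume x: "x \<in> X"
  have "surj (P x)" by (rule linear_inj_imp_surj[OF P_linear[OF x] P_inj[OF x]])
  then obtain w where w: "v = P x w" by (metis surjD)
  note add = linear_add[OF P_linear[OF x]]
  show "\<exists>!p. fst p \<in> P x ` Stable \<and> fst (snd p) \<in> P x ` Center \<and> snd (snd p) \<in> P x ` Unstable \<and>
      v = fst p + fst (snd p) + snd (snd p)"
  proof (rule ex1I[of _ "(P x (\<pi>s w), P x (\<pi>c w), P x (\<pi>u w))"])
    show "fst (P x (\<pi>s w), P x (\<pi>c w), P x (\<pi>u w)) \<in> P x ` Stable \<and>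
      fst (snd (P x (\<pi>s w), P x (\<pi>c w), P x (\<pi>u w))) \<in> P x ` Center \<and>
      snd (snd (P x (\<pi>s w), P x (\<pi>c w), P x (\<pi>u w))) \<in> P x ` Unstable \<and>
      v = fst (P x (\<pi>s w), P x (\<pi>c w), P x (\<pi>u w)) + fst (snd (P x (\<pi>s w), P x (\<pi>c w), P x (\<pi>u w)))
        + snd (snd (P x (\<pi>s w), P x (\<pi>c w), P x (\<pi>u w)))"
      using \<pi>(1-3)[of w] arg_cong[OF \<pi>(4)[of w], of "P x"] by (simp add: w add)
  next
    fix p assume "fst p \<in> P x ` Stable \<and> fst (snd p) \<in> P x ` Center \<and> snd (snd p) \<in> P x ` Unstable \<and>
      v = fst p + fst (snd p) + snd (snd p)"
    then obtain s c u where p: "s \<in> Stable" "c \<in> Center" "u \<in> Unstable" "p = (P x s, P x c, P x u)"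
      "v = P x s + P x c + P x u" by (cases p) auto
    then have "P x w = P x (s + c + u)" by (simp add: w add)
    then have "w = s + c + u" using P_inj[OF x] by (meson injD)
    from \<pi>_unique[OF p(1-3) this] show "p = (P x (\<pi>s w), P x (\<pi>c w), P x (\<pi>u w))"
      using p(4) by simp
  qed
next
  fix x t assume x: "x \<in> X"
  show "mderiv N N (\<psi> t) x ` (P x ` Stable) = P (\<psi> t x) ` Stable"
    "mderiv N N (\<psi> t) x ` (P x ` Center) = P (\<psi> t x) ` Center"
    "mderiv N N (\<psi> t) x ` (P x ` Unstable) = P (\<psi> t x) ` Unstable"
    by (rule bundle_invariant[OF x]; simp)+
qed

section \<open>Growth rates of the time change\<close>

lemma P_bounds:
  obtains K where "K > 0" "\<And>x v. x \<in> X \<Longrightarrow> norm v \<le> K * metric_norm g x (P x v)"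
    "\<And>x v. x \<in> X \<Longrightarrow> metric_norm g x (P x v) \<le> K * norm v"
proof -
  show ?thesis by (rule frame_norm_bounds[OF compact metric P_linear P_inj P_cont that])
qed

lemma Center_growth:
  assumes "\<epsilon> > 0"
  obtains D where "D > 0" "\<And>x v t. x \<in> X \<Longrightarrow> v \<in> Center \<Longrightarrow>
    metric_norm g (\<psi> t x) (mderiv N N (\<psi> t) x (P x v)) \<le> D * exp (\<epsilon> * \<bar>t\<bar>) * metric_norm g x (P x v)"
proof -
  obtain K where K: "K > 0" "\<And>x v. x \<in> X \<Longrightarrow> norm v \<le> K * metric_norm g x (P x v)"
    "\<And>x v. x \<in> X \<Longrightarrow> metric_norm g x (P x v) \<le> K * norm v"
    by (rule P_bounds) (rule that)
  obtain B where B: "B > 0" "\<And>x. x \<in> X \<Longrightarrow> norm (W x) \<le> B" by (rule W_bounded) (rule that)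
  obtain m where m: "m > 0" "\<And>x. x \<in> X \<Longrightarrow> m \<le> \<tau> x" by (rule \<tau>_bounds) (rule that)
  obtain R where R: "R > 0" "\<And>x t. x \<in> X \<Longrightarrow> \<bar>\<alpha> x t\<bar> \<le> R * \<bar>t\<bar>"
    by (rule \<alpha>_bounds) (rule that)
  \<comment> \<open>Flow time is at most \<open>R * \<bar>t\<bar>\<close>, so the rate
    \<open>\<delta>\<close> in flow time becomes \<open>\<epsilon>\<close> in the new time.\<close>
  define \<delta> where "\<delta> = \<epsilon> / R"
  have \<delta>: "\<delta> > 0" "\<delta> * R = \<epsilon>" using assms R(1) by (auto simp: \<delta>_def)
  obtain C where C: "C > 0" "\<And>v t. v \<in> Center \<Longrightarrow> norm (L t v) \<le> C * exp (\<delta> * \<bar>t\<bar>) * norm v"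
    by (rule Center_uniform[OF \<delta>(1)]) (rule that)
  obtain C' where C': "C' > 0" "\<And>x v a. x \<in> X \<Longrightarrow> \<phi> 0 x = x \<Longrightarrow> v \<in> Center \<Longrightarrow> \<bar>\<kappa> x a v\<bar> \<le> C' * exp (\<delta> * \<bar>a\<bar>) * norm v"
    by (rule \<kappa>_center[OF \<delta>(1)]) (rule that)
  \<comment> \<open>The first summand bounds the action of \<open>L\<close>, the second the
    correction along \<open>W\<close>, where \<open>m\<close> bounds \<open>\<tau>\<close> below and
    \<open>B\<close> bounds the norm of \<open>W\<close>.\<close>
  define E where "E = C + C' / m * B"
  have E: "E > 0" unfolding E_def using C C' m B by (simp add: add_pos_pos)
  have "metric_norm g (\<psi> t x) (mderiv N N (\<psi> t) x (P x v)) \<le> (K * E * K) * exp (\<epsilon> * \<bar>t\<bar>) * metric_norm g x (P x v)"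
    if x: "x \<in> X" and v: "v \<in> Center" for x v t
  proof -
    let ?a = "\<alpha> x t" and ?y = "\<psi> t x"
    let ?w = "L ?a v - (\<kappa> x ?a v / \<tau> ?y) *\<^sub>R W ?y"
    have y: "?y \<in> X" using x by blast
    have "norm ?w \<le> norm (L ?a v) + \<bar>\<kappa> x ?a v\<bar> / \<tau> ?y * norm (W ?y)"
      using norm_triangle_ineq4[of "L ?a v" "(\<kappa> x ?a v / \<tau> ?y) *\<^sub>R W ?y"] \<tau>_pos[OF y] by simp
    also have "\<dots> \<le> C * exp (\<delta> * \<bar>?a\<bar>) * norm v + (C' * exp (\<delta> * \<bar>?a\<bar>) * norm v) / m * B"
    proof (intro add_mono mult_mono)
      show "norm (L ?a v) \<le> C * exp (\<delta> * \<bar>?a\<bar>) * norm v" by (rule C(2)[OF v])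
      show "\<bar>\<kappa> x ?a v\<bar> / \<tau> ?y \<le> C' * exp (\<delta> * \<bar>?a\<bar>) * norm v / m"
        by (intro frac_le C'(2) x v m y \<phi>_0 mult_nonneg_nonneg norm_ge_zero exp_ge_zero less_imp_le[OF C'(1)])
    qed (use B(2)[OF y] C' m in \<open>auto\<close>)
    also have "\<dots> = E * exp (\<delta> * \<bar>?a\<bar>) * norm v" using m by (simp add: E_def field_simps)
    also have "\<dots> \<le> E * exp (\<epsilon> * \<bar>t\<bar>) * norm v"
    proof -
      have "\<delta> * \<bar>?a\<bar> \<le> \<delta> * (R * \<bar>t\<bar>)" using R(2)[OF x, of t] \<delta>(1) by (intro mult_left_mono) auto
      also have "\<dots> = \<epsilon> * \<bar>t\<bar>" using \<delta>(2) by (simp add: mult.assoc[symmetric])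
      finally show ?thesis using E by (intro mult_right_mono mult_left_mono) auto
    qed
    also have "\<dots> \<le> E * exp (\<epsilon> * \<bar>t\<bar>) * (K * metric_norm g x (P x v))"
      using E K(2)[OF x] by (intro mult_left_mono) auto
    finally have w: "norm ?w \<le> E * exp (\<epsilon> * \<bar>t\<bar>) * (K * metric_norm g x (P x v))" .
    have "metric_norm g ?y (mderiv N N (\<psi> t) x (P x v)) = metric_norm g ?y (P ?y ?w)"
      using mderiv_\<psi>_Center(1)[OF x v, of t] by simp
    also have "\<dots> \<le> K * norm ?w" by (rule K(3)[OF y])
    also have "\<dots> \<le> K * (E * exp (\<epsilon> * \<bar>t\<bar>) * (K * metric_norm g x (P x v)))"
      using w K(1) by (intro mult_left_mono) auto
    finally show ?thesis by (simp add: mult_ac)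
  qed
  then show ?thesis using that[of "K * E * K"] K(1) E by simp
qed

theorem time_change_center_bunched:
  assumes "Stable \<noteq> {0}" "Unstable \<noteq> {0}"
  shows "\<exists>a b A B C. partially_hyperbolic_with N \<psi> a b A B C \<and> a + b < A \<and> a + b < B"
proof -
  obtain K where K: "K > 0" "\<And>x v. x \<in> X \<Longrightarrow> norm v \<le> K * metric_norm g x (P x v)"
    "\<And>x v. x \<in> X \<Longrightarrow> metric_norm g x (P x v) \<le> K * norm v"
    by (rule P_bounds) (rule that)
  obtain m where m: "m > 0" "\<And>x t. x \<in> X \<Longrightarrow> t \<ge> 0 \<Longrightarrow> m * t \<le> \<alpha> x t"
    by (rule \<alpha>_bounds) (rule that)
  obtain s1 C1 where s1: "s1 > 0" "C1 > 0"
    "\<And>v t. v \<in> Stable \<Longrightarrow> t \<ge> 0 \<Longrightarrow> norm (L t v) \<le> C1 * exp (- s1 * t) * norm v"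
    by (rule Stable_uniform) (rule that)
  obtain s2 C2 where s2: "s2 > 0" "C2 > 0"
    "\<And>v t. v \<in> Unstable \<Longrightarrow> t \<ge> 0 \<Longrightarrow> norm (L (- t) v) \<le> C2 * exp (- s2 * t) * norm v"
    by (rule Unstable_uniform) (rule that)
  \<comment> \<open>A new time \<open>t > 0\<close> corresponds to flow time at least
    \<open>m * t\<close>, which rescales the weaker of the two hyperbolic rates.\<close>
  define \<sigma> where "\<sigma> = min s1 s2 * m"
  have \<sigma>: "\<sigma> > 0" using s1 s2 m by (simp add: \<sigma>_def)
  \<comment> \<open>The central rate is free; a quarter leaves the sum of both central rates
    strictly below \<open>\<sigma>\<close>, as center bunching demands.\<close>
  define \<epsilon> where "\<epsilon> = \<sigma> / 4"
  have \<epsilon>: "\<epsilon> > 0" "\<epsilon> + \<epsilon> < \<sigma>" "\<epsilon> < \<sigma>" using \<sigma> by (auto simp: \<epsilon>_def)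
  obtain D where D: "D > 0" "\<And>x v t. x \<in> X \<Longrightarrow> v \<in> Center \<Longrightarrow>
    metric_norm g (\<psi> t x) (mderiv N N (\<psi> t) x (P x v)) \<le> D * exp (\<epsilon> * \<bar>t\<bar>) * metric_norm g x (P x v)"
    by (rule Center_growth[OF \<epsilon>(1)]) (rule that)
  define C where "C = K * C1 * K + K * C2 * K + D"
  have pos: "K * C1 * K > 0" "K * C2 * K > 0" using K s1 s2 by auto
  have C: "C > 0" "K * C1 * K \<le> C" "K * C2 * K \<le> C" "D \<le> C" using pos D(1) by (auto simp: C_def)
  have nn: "metric_norm g x (P x v) \<ge> 0" if "x \<in> X" for x v
    using K(2)[OF that, of v] K(1) by (meson norm_ge_zero order_trans zero_le_mult_iff not_less)
  have rate: "exp (- s * \<alpha> x t) \<le> exp (- \<sigma> * t)" if "x \<in> X" "t > 0" "s = s1 \<or> s = s2" for x t s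
  proof -
    have "\<sigma> * t = min s1 s2 * (m * t)" by (simp add: \<sigma>_def)
    also have "\<dots> \<le> s * (m * t)" using that m s1 s2 by (intro mult_right_mono) auto
    also have "\<dots> \<le> s * \<alpha> x t" using that m(2)[of x t] s1 s2 by (intro mult_left_mono) auto
    finally show ?thesis by simp
  qed
  have \<alpha>_nonneg: "\<alpha> x t \<ge> 0" if "x \<in> X" "t > 0" for x t
    using m(2)[OF that(1), of t] m(1) that(2) by (smt (verit) mult_nonneg_nonneg)
  have est: "hyperbolicity_estimates N \<psi> (\<lambda>x. P x ` Stable) (\<lambda>x. P x ` Center) (\<lambda>x. P x ` Unstable) g \<epsilon> \<epsilon> \<sigma> \<sigma> C"
    unfolding hyperbolicity_estimates_def
  proof (intro allI impI ballI conjI)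
    fix t :: real and x w assume t: "0 < t" and x: "x \<in> X"
    let ?a = "\<alpha> x t" and ?y = "\<psi> t x"
    have y: "?y \<in> X" using x by blast
    {
      assume "w \<in> P x ` Stable"
      then obtain v where v: "v \<in> Stable" "w = P x v" by blast
      have "metric_norm g ?y (mderiv N N (\<psi> t) x w) = metric_norm g ?y (P ?y (L ?a v))"
        using mderiv_\<psi>_P[OF x, of v t] v by simp
      also have "\<dots> \<le> K * norm (L ?a v)" by (rule K(3)[OF y])
      also have "\<dots> \<le> K * (C1 * exp (- s1 * ?a) * norm v)"
        using s1(3)[OF v(1) \<alpha>_nonneg[OF x t]] K(1) by (intro mult_left_mono) auto
      also have "\<dots> \<le> K * (C1 * exp (- \<sigma> * t) * (K * metric_norm g x (P x v)))"
        using K s1 rate[OF x t, of s1] K(2)[OF x, of v] by (intro mult_left_mono mult_mono) auto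
      also have "\<dots> = (K * C1 * K) * exp (- \<sigma> * t) * metric_norm g x w" by (simp add: v mult_ac)
      also have "\<dots> \<le> C * exp (- \<sigma> * t) * metric_norm g x w"
        using C nn[OF x] by (intro mult_right_mono) (auto simp: v)
      finally show "metric_norm g ?y (mderiv N N (\<psi> t) x w) \<le> C * exp (- \<sigma> * t) * metric_norm g x w" .
    }
    {
      assume "w \<in> P x ` Center"
      then obtain v where v: "v \<in> Center" "w = P x v" by blast
      have "metric_norm g ?y (mderiv N N (\<psi> t) x w) \<le> D * exp (\<epsilon> * t) * metric_norm g x w"
        using D(2)[OF x v(1), of t] t v(2) by simp
      also have "\<dots> \<le> C * exp (\<epsilon> * t) * metric_norm g x w"
        using C nn[OF x] by (intro mult_right_mono) (auto simp: v)
      finally show "metric_norm g ?y (mderiv N N (\<psi> t) x w) \<le> C * exp (\<epsilon> * t) * metric_norm g x w" .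
      \<comment> \<open>The lower central estimate is the upper one for time \<open>- t\<close>,
        applied to the image vector; this is why \<open>Center_growth\<close> covers both signs of
        \<open>t\<close>.\<close>
      have xy: "\<psi> (- t) ?y = x" using mderiv_\<psi>_inverse(1)[OF x, of "- t"] by simp
      obtain w' where w': "w' \<in> Center" "mderiv N N (\<psi> t) x w = P ?y w'"
        using mderiv_\<psi>_Center[OF x v(1), of t] v(2) by blast
      have ret: "mderiv N N (\<psi> (- t)) ?y (P ?y w') = w"
        using mderiv_\<psi>_inverse(2)[OF x, of "- t" w] w'(2) by simp
      have "metric_norm g x w \<le> D * exp (\<epsilon> * t) * metric_norm g ?y (P ?y w')"
        using D(2)[OF y w'(1), of "- t"] t unfolding xy ret by simp
      also have "\<dots> \<le> C * exp (\<epsilon> * t) * metric_norm g ?y (P ?y w')"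
        using C nn[OF y] by (intro mult_right_mono) auto
      finally have le: "metric_norm g x w \<le> C * exp (\<epsilon> * t) * metric_norm g ?y (P ?y w')" .
      have "inverse C * exp (- \<epsilon> * t) * metric_norm g x w
          \<le> inverse C * exp (- \<epsilon> * t) * (C * exp (\<epsilon> * t) * metric_norm g ?y (P ?y w'))"
        using le C by (intro mult_left_mono) auto
      also have "\<dots> = metric_norm g ?y (P ?y w')" using C(1) by (simp add: exp_minus field_simps)
      finally show "inverse C * exp (- \<epsilon> * t) * metric_norm g x w \<le> metric_norm g ?y (mderiv N N (\<psi> t) x w)"
        unfolding w'(2) .
    }
    {
      assume "w \<in> P x ` Unstable"
      then obtain v where v: "v \<in> Unstable" "w = P x v" by blast
      \<comment> \<open>Expansion is proved backwards: \<open>L (- ?a)\<close> contracts the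
        unstable vector \<open>L ?a v\<close> and returns \<open>v\<close>.\<close>
      have "norm v = norm (L (- ?a) (L ?a v))" by simp
      also have "\<dots> \<le> C2 * exp (- s2 * ?a) * norm (L ?a v)"
        by (rule s2(3)[OF Unstable_invariant[OF v(1)] \<alpha>_nonneg[OF x t]])
      also have "\<dots> \<le> C2 * exp (- \<sigma> * t) * (K * metric_norm g ?y (P ?y (L ?a v)))"
        using s2 rate[OF x t, of s2] K(2)[OF y, of "L ?a v"] by (intro mult_mono mult_left_mono) auto
      finally have nv: "norm v \<le> C2 * exp (- \<sigma> * t) * (K * metric_norm g ?y (P ?y (L ?a v)))" .
      have "metric_norm g x w \<le> K * norm v" using K(3)[OF x, of v] v(2) by simp
      also have "\<dots> \<le> K * (C2 * exp (- \<sigma> * t) * (K * metric_norm g ?y (P ?y (L ?a v))))"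
        using nv K(1) by (intro mult_left_mono) auto
      also have "\<dots> = (K * C2 * K) * exp (- \<sigma> * t) * metric_norm g ?y (P ?y (L ?a v))" by (simp add: mult_ac)
      also have "\<dots> \<le> C * exp (- \<sigma> * t) * metric_norm g ?y (P ?y (L ?a v))"
        using C nn[OF y] by (intro mult_right_mono) auto
      finally have le: "metric_norm g x w \<le> C * exp (- \<sigma> * t) * metric_norm g ?y (P ?y (L ?a v))" .
      have "inverse C * exp (\<sigma> * t) * metric_norm g x w
          \<le> inverse C * exp (\<sigma> * t) * (C * exp (- \<sigma> * t) * metric_norm g ?y (P ?y (L ?a v)))"
        using le C by (intro mult_left_mono) auto
      also have "\<dots> = metric_norm g ?y (P ?y (L ?a v))" using C(1) by (simp add: exp_minus field_simps)
      finally show "inverse C * exp (\<sigma> * t) * metric_norm g x w \<le> metric_norm g ?y (mderiv N N (\<psi> t) x w)"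
        using mderiv_\<psi>_P[OF x, of v t] v by simp
    }
  qed
  have nonzero: "P x ` V \<noteq> {0}" if x: "x \<in> X" and V: "V \<noteq> {0}" "0 \<in> V" for x V
  proof -
    obtain v where "v \<in> V" "v \<noteq> 0" using V by auto
    then have "P x v \<noteq> 0" using linear_injective_0[OF P_linear[OF x]] P_inj[OF x] by blast
    then show ?thesis using \<open>v \<in> V\<close> by auto
  qed
  have "partially_hyperbolic_with N \<psi> \<epsilon> \<epsilon> \<sigma> \<sigma> C"
    unfolding partially_hyperbolic_with_def
    using smooth compact \<psi>_smooth_flow \<epsilon> \<sigma> C(1) \<psi>_splitting est metric nonzero assms zero_in by blast
  then show ?thesis using \<epsilon>(2) by blast
qed

text \<open>A nonzero vector of the given stable or unstable bundle at a single point has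
  coordinates in the frame that are contracted by \<open>L\<close> forwards or backwards in time.
  The given splitting is thus used only to produce nonzero elements of the spectral
  subspaces.\<close>

lemma nontrivial_growth:
  assumes inv: "invariant_splitting N \<phi> Es Ec Eu"
    and nz: "\<And>x. x \<in> X \<Longrightarrow> Es x \<noteq> {0} \<and> Eu x \<noteq> {0}"
    and est: "hyperbolicity_estimates N \<phi> Es Ec Eu g a b A B C"
    and pos: "A > 0" "B > 0" "C > 0"
  shows "Stable \<noteq> {0}" "Unstable \<noteq> {0}"
proof -
  obtain x where x: "x \<in> X" using nonempty by blast
  obtain K where K: "K > 0" "\<And>x v. x \<in> X \<Longrightarrow> norm v \<le> K * metric_norm g x (\<theta> x v)"
    by (rule \<theta>_lower) (rule that)
  have bundle_elem: "\<exists>v. v \<noteq> 0 \<and> \<theta> x v \<in> E x" if E: "subbundle N E" "E x \<noteq> {0}" for E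
  proof -
    have "0 \<in> E x" using E(1) x unfolding subbundle_def by (metis span_zero)
    then obtain w where w: "w \<in> E x" "w \<noteq> 0" using E(2) by blast
    have "surj (\<theta> x)" by (rule linear_inj_imp_surj[OF \<theta>_linear[OF x] \<theta>_inj[OF x]])
    then obtain v where "w = \<theta> x v" by (metis surjD)
    then show ?thesis using w linear_0[OF \<theta>_linear[OF x]] by metis
  qed
  have nn: "metric_norm g x (\<theta> x v) \<ge> 0" for v
    using K(2)[OF x, of v] K(1) by (meson norm_ge_zero order_trans zero_le_mult_iff not_less)
  show "Stable \<noteq> {0}"
  proof -
    obtain v where v: "v \<noteq> 0" "\<theta> x v \<in> Es x"
      using bundle_elem[of Es] inv nz[OF x] unfolding invariant_splitting_def by blast
    \<comment> \<open>The hyperbolicity estimates concern \<open>t > 0\<close>; the constant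
      \<open>C + 1 \<ge> 1\<close> also covers \<open>t = 0\<close>.\<close>
    have "norm (L t v) \<le> (K * (C + 1) * metric_norm g x (\<theta> x v)) * exp (- B * t)" if "t \<ge> 0" for t
    proof (cases "t = 0")
      case True
      have "K * metric_norm g x (\<theta> x v) \<le> K * (C + 1) * metric_norm g x (\<theta> x v)"
        using K(1) pos(3) nn by (intro mult_right_mono) auto
      then show ?thesis using K(2)[OF x, of v] True by simp
    next
      case False
      have "norm (L t v) \<le> K * metric_norm g (\<phi> t x) (mderiv N N (\<phi> t) x (\<theta> x v))"
        using K(2)[OF \<phi>_in[OF x, of t], of "L t v"] unfolding \<theta>_equivariant[OF x] .
      also have "\<dots> \<le> K * (C * exp (- B * t) * metric_norm g x (\<theta> x v))"
        using est that False x v K(1) unfolding hyperbolicity_estimates_def by (intro mult_left_mono) auto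
      also have "\<dots> \<le> K * ((C + 1) * exp (- B * t) * metric_norm g x (\<theta> x v))"
        using K(1) nn by (intro mult_left_mono mult_right_mono) auto
      finally show ?thesis by (simp add: mult_ac)
    qed
    moreover have "- B < 0" using pos by simp
    ultimately have "v \<in> Stable" unfolding Stable_def by blast
    then show ?thesis using v(1) by blast
  qed
  show "Unstable \<noteq> {0}"
  proof -
    obtain v where v: "v \<noteq> 0" "\<theta> x v \<in> Eu x"
      using bundle_elem[of Eu] inv nz[OF x] unfolding invariant_splitting_def by blast
    have "norm (L t v) \<le> (K * (C + 1) * metric_norm g x (\<theta> x v)) * exp (A * t)" if "t \<le> 0" for t
    proof (cases "t = 0")
      case True
      have "K * metric_norm g x (\<theta> x v) \<le> K * (C + 1) * metric_norm g x (\<theta> x v)"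
        using K(1) pos(3) nn by (intro mult_right_mono) auto
      then show ?thesis using K(2)[OF x, of v] True by simp
    next
      case False
      \<comment> \<open>For negative \<open>t\<close>, the expansion estimate starts at
        \<open>\<phi> t x\<close> and leads over the positive time \<open>s\<close> back to
        \<open>x\<close>, which bounds the vector at \<open>\<phi> t x\<close> from above.\<close>
      define s where "s = - t"
      have s: "s > 0" "t = - s" using that False by (auto simp: s_def)
      let ?y = "\<phi> t x" and ?w = "mderiv N N (\<phi> t) x (\<theta> x v)"
      have y: "?y \<in> X" using x by blast
      have "?w \<in> Eu ?y" using inv x v(2) unfolding invariant_splitting_def by blast
      then have "inverse C * exp (A * s) * metric_norm g ?y ?w
          \<le> metric_norm g (\<phi> s ?y) (mderiv N N (\<phi> s) ?y ?w)"
        using est s(1) y unfolding hyperbolicity_estimates_def by blast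
      moreover have "\<phi> s ?y = x" using \<phi>_add[OF x, of s t] s x by simp
      moreover have "mderiv N N (\<phi> s) ?y ?w = \<theta> x v"
        using mderiv_\<phi>_add[OF x, of s t "\<theta> x v"] mderiv_\<phi>_0[OF x] s by simp
      ultimately have le: "inverse C * exp (A * s) * metric_norm g ?y ?w \<le> metric_norm g x (\<theta> x v)" by simp
      have "metric_norm g ?y ?w = C * exp (A * t) * (inverse C * exp (A * s) * metric_norm g ?y ?w)"
        using pos(3) s by (simp add: exp_minus field_simps)
      also have "\<dots> \<le> C * exp (A * t) * metric_norm g x (\<theta> x v)"
        using le pos(3) by (intro mult_left_mono) auto
      also have "\<dots> \<le> (C + 1) * exp (A * t) * metric_norm g x (\<theta> x v)"
        using nn by (intro mult_right_mono) auto
      finally have le': "metric_norm g ?y ?w \<le> (C + 1) * exp (A * t) * metric_norm g x (\<theta> x v)" .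
      have "norm (L t v) \<le> K * metric_norm g ?y ?w"
        using K(2)[OF y, of "L t v"] unfolding \<theta>_equivariant[OF x] .
      also have "\<dots> \<le> K * ((C + 1) * exp (A * t) * metric_norm g x (\<theta> x v))"
        using le' K(1) by (intro mult_left_mono) auto
      finally show ?thesis by (simp add: mult_ac)
    qed
    then have "v \<in> Unstable" unfolding Unstable_def using pos(1) by blast
    then show ?thesis using v(1) by blast
  qed
qed

end

section \<open>Homogeneous flows\<close>

text \<open>The set of times with \<open>f t = f 0\<close> is closed by the Hausdorff property and
  open because a curve with zero derivative is constant in a chart; the line is connected.\<close>

lemma has_mderiv_curve_const:
  fixes f :: "real \<Rightarrow> 'a"
  assumes M: "smooth_manifold (M :: ('a, 'e::euclidean_space) manifold)"
    and cont: "continuous_map euclidean (mtop M) f"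
    and der: "\<And>t. has_mderiv euclidean_manifold M f t (\<lambda>h. 0)"
  shows "f t = f 0"
proof -
  interpret M: smooth_mfd M by unfold_locales (rule M)
  have fX: "f t \<in> topspace (mtop M)" for t using continuous_map_funspace[OF cont] by auto
  let ?S = "{t. f t = f 0}"
  have "closed ?S"
  proof -
    have "Hausdorff_space (mtop M)" using M unfolding smooth_manifold_def by blast
    then have "closedin (mtop M) {f 0}" using closedin_Hausdorff_sing_eq fX by metis
    from closedin_continuous_map_preimage[OF cont this] show ?thesis by simp
  qed
  moreover have "open ?S"
    unfolding open_contains_ball
  proof
    fix t0 assume t0: "t0 \<in> ?S"
    define c where "c = chart_at M (f t0)"
    have c: "c \<in> atlas M" "f t0 \<in> fst c" unfolding c_def using M.chart_at[OF fX] by auto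
    have "openin euclidean {t \<in> topspace euclidean. f t \<in> fst c}"
      using openin_continuous_map_preimage[OF cont M.chart_openin[OF c(1)]] .
    then have "open {t. f t \<in> fst c}" by simp
    then obtain e where e: "e > 0" "ball t0 e \<subseteq> {t. f t \<in> fst c}"
      using c(2) unfolding open_contains_ball by blast
    have "(\<lambda>t. snd c (f t)) t = (\<lambda>t. snd c (f t)) t0" if t: "t \<in> ball t0 e" for t
    proof (rule has_derivative_zero_unique[OF convex_ball _ t])
      show "t0 \<in> ball t0 e" using e by simp
      fix s assume "s \<in> ball t0 e"
      then have s: "f s \<in> fst c" using e by auto
      have "has_cderiv (UNIV, id) c f s (\<lambda>v. coord_change (chart_at M (f s)) c (f s) 0)"
        using has_mderivD[where f = f, OF smooth_manifold_euclidean M der, of "(UNIV, id)" s c] c s by simp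
      moreover have "coord_change (chart_at M (f s)) c (f s) 0 = 0"
        using linear_0[OF M.linear_coord_change] M.chart_at[OF fX, of s] c s by blast
      ultimately have "((\<lambda>t. snd c (f t)) has_derivative (\<lambda>h. 0)) (at s)"
        unfolding has_cderiv_def by (simp add: comp_def)
      then show "((\<lambda>t. snd c (f t)) has_derivative (\<lambda>h. 0)) (at s within ball t0 e)"
        by (rule has_derivative_at_withinI)
    qed
    then have "f t = f t0" if "t \<in> ball t0 e" for t
      using inj_onD[OF M.chart_inj[OF c(1)], of "f t" "f t0"] that e(2) c(2) by blast
    then have "ball t0 e \<subseteq> ?S" using t0 by (metis (mono_tags, lifting) mem_Collect_eq subsetI)
    then show "\<exists>e>0. ball t0 e \<subseteq> ?S" using e(1) by blast
  qed
  ultimately have "?S = UNIV" using clopen[of ?S] by auto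
  then show ?thesis by auto
qed

locale lie_grp =
  fixes G :: "'g monoid" (structure) and M :: "('g, 'e::euclidean_space) manifold"
  assumes lie: "lie_group G M"

sublocale lie_grp \<subseteq> group G
  using lie unfolding lie_group_def by blast

sublocale lie_grp \<subseteq> M: smooth_mfd M
  using lie unfolding lie_group_def by unfold_locales blast

section \<open>Group multiplication in charts\<close>

context lie_grp
begin

lemma carrier_eq: "carrier G = topspace (mtop M)"
  using lie unfolding lie_group_def by blast

lemma mult_cont: "continuous_map (prod_topology (mtop M) (mtop M)) (mtop M) (\<lambda>(x, y). x \<otimes> y)"
  using lie unfolding lie_group_def smooth_map_def by (simp add: prod_manifold_def)

lemma continuous_map_mult:
  "continuous_map Y (mtop M) f \<Longrightarrow> continuous_map Y (mtop M) g \<Longrightarrow> continuous_map Y (mtop M) (\<lambda>y. f y \<otimes> g y)"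
  using continuous_map_compose[OF continuous_map_pairedI mult_cont, of Y f g] by (simp add: comp_def)

definition mult_dom where "mult_dom b c d = prod_dom b c d (\<lambda>(x, y). x \<otimes> y)"

definition multc where "multc b c d = (\<lambda>(u, v). snd d (chart_inv b u \<otimes> chart_inv c v))"

lemma multc_Ck:
  assumes "b \<in> atlas M" "c \<in> atlas M" "d \<in> atlas M"
  shows "Ck_on n (mult_dom b c d) (multc b c d)"
proof -
  have "smooth_map (prod_manifold M M) M (\<lambda>(x, y). x \<otimes> y)"
    using lie unfolding lie_group_def by blast
  from smooth_map_prod_Ck[OF M.smooth M.smooth M.smooth this assms]
  show ?thesis unfolding mult_dom_def multc_def by auto
qed

lemma mult_dom_iff:
  "b \<in> atlas M \<Longrightarrow> c \<in> atlas M \<Longrightarrow> x \<in> fst b \<Longrightarrow> y \<in> fst c \<Longrightarrow>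
    (snd b x, snd c y) \<in> mult_dom b c d \<longleftrightarrow> x \<otimes> y \<in> fst d"
  unfolding mult_dom_def prod_dom_def by auto

lemma multc_has_derivative:
  assumes "b \<in> atlas M" "c \<in> atlas M" "d \<in> atlas M" "x \<in> fst b" "y \<in> fst c" "x \<otimes> y \<in> fst d"
  shows "(multc b c d has_derivative frechet_derivative (multc b c d) (at (snd b x, snd c y))) (at (snd b x, snd c y))"
  by (rule Ck_on_Suc_has_derivative[OF multc_Ck]) (use assms in \<open>simp_all add: mult_dom_iff\<close>)

lemma mult_right_has_cderiv:
  assumes "b \<in> atlas M" "c \<in> atlas M" "d \<in> atlas M" "x \<in> fst b" "y \<in> fst c" "x \<otimes> y \<in> fst d"
  shows "has_cderiv b d (\<lambda>z. z \<otimes> y) x (\<lambda>v. frechet_derivative (multc b c d) (at (snd b x, snd c y)) (v, 0))"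
proof -
  have "((\<lambda>u. multc b c d (u, snd c y)) has_derivative
      (\<lambda>v. frechet_derivative (multc b c d) (at (snd b x, snd c y)) (v, 0))) (at (snd b x))"
    by (rule has_derivative_compose[of "\<lambda>u. (u, snd c y)" "\<lambda>v. (v, 0)"])
       (auto intro!: derivative_eq_intros multc_has_derivative assms)
  moreover have "(\<lambda>u. multc b c d (u, snd c y)) = snd d \<circ> (\<lambda>z. z \<otimes> y) \<circ> chart_inv b"
    using assms by (auto simp: multc_def)
  ultimately show ?thesis unfolding has_cderiv_def by simp
qed

lemma mult_left_has_cderiv:
  assumes "b \<in> atlas M" "c \<in> atlas M" "d \<in> atlas M" "x \<in> fst b" "y \<in> fst c" "x \<otimes> y \<in> fst d"
  shows "has_cderiv c d (\<lambda>z. x \<otimes> z) y (\<lambda>v. frechet_derivative (multc b c d) (at (snd b x, snd c y)) (0, v))"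
proof -
  have "((\<lambda>u. multc b c d (snd b x, u)) has_derivative
      (\<lambda>v. frechet_derivative (multc b c d) (at (snd b x, snd c y)) (0, v))) (at (snd c y))"
    by (rule has_derivative_compose[of "\<lambda>u. (snd b x, u)" "\<lambda>v. (0, v)"])
       (auto intro!: derivative_eq_intros multc_has_derivative assms)
  moreover have "(\<lambda>u. multc b c d (snd b x, u)) = snd d \<circ> (\<lambda>z. x \<otimes> z) \<circ> chart_inv c"
    using assms by (auto simp: multc_def)
  ultimately show ?thesis unfolding has_cderiv_def by simp
qed

lemma mult_right_cont: "y \<in> carrier G \<Longrightarrow> continuous_map (mtop M) (mtop M) (\<lambda>z. z \<otimes> y)"
  by (intro continuous_map_mult) (auto simp: carrier_eq)

lemma mult_left_cont: "y \<in> carrier G \<Longrightarrow> continuous_map (mtop M) (mtop M) (\<lambda>z. y \<otimes> z)"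
  by (intro continuous_map_mult) (auto simp: carrier_eq)

lemma mult_right_has_mderiv:
  assumes x: "x \<in> carrier G" and y: "y \<in> carrier G"
  obtains D where "has_mderiv M M (\<lambda>z. z \<otimes> y) x D"
proof -
  have xy: "x \<otimes> y \<in> carrier G" using x y by simp
  note c = M.chart_at[OF x[unfolded carrier_eq]] M.chart_at[OF y[unfolded carrier_eq]] M.chart_at[OF xy[unfolded carrier_eq]]
  show ?thesis
    by (rule that, rule has_mderivI[OF M.smooth M.smooth cont_at_continuous_map[OF mult_right_cont[OF y]] c(1,2,5,6)
          mult_right_has_cderiv[OF c(1,3,5,2,4,6)]])
       (use x in \<open>simp add: carrier_eq\<close>)
qed

lemma mult_left_has_mderiv:
  assumes x: "x \<in> carrier G" and y: "y \<in> carrier G"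
  obtains D where "has_mderiv M M (\<lambda>z. x \<otimes> z) y D"
proof -
  have xy: "x \<otimes> y \<in> carrier G" using x y by simp
  note c = M.chart_at[OF x[unfolded carrier_eq]] M.chart_at[OF y[unfolded carrier_eq]] M.chart_at[OF xy[unfolded carrier_eq]]
  show ?thesis
    by (rule that, rule has_mderivI[OF M.smooth M.smooth cont_at_continuous_map[OF mult_left_cont[OF x]] c(3,4,5,6)
          mult_left_has_cderiv[OF c(1,3,5,2,4,6)]])
       (use y in \<open>simp add: carrier_eq\<close>)
qed

lemma one_in: "\<one> \<in> topspace (mtop M)"
  using carrier_eq by auto

definition "chart1 = chart_at M \<one>"

lemma chart1: "chart1 \<in> atlas M" "\<one> \<in> fst chart1"
  unfolding chart1_def using M.chart_at[OF one_in] by auto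

text \<open>The partial derivatives at the unit are those of \<open>z \<otimes> \<one>\<close> and
  \<open>\<one> \<otimes> z\<close>, both of which are the identity map. This is the product rule
  for curves through the unit.\<close>

lemma multc_derivative_one:
  "frechet_derivative (multc chart1 chart1 chart1) (at (snd chart1 \<one>, snd chart1 \<one>)) (v, w) = v + w"
proof -
  let ?b = chart1 and ?D = "frechet_derivative (multc chart1 chart1 chart1) (at (snd chart1 \<one>, snd chart1 \<one>))"
  have m: "\<one> \<otimes> \<one> \<in> fst ?b" using chart1 by simp
  have id: "has_cderiv ?b ?b (\<lambda>x. x) \<one> (\<lambda>v. v)"
  proof -
    have "coord_change ?b ?b \<one> = (\<lambda>v. v)" using M.coord_change_self[OF chart1] by blast
    then show ?thesis using M.has_cderiv_coord_change[OF chart1(1) chart1(1) chart1(2) chart1(2)] by simp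
  qed
  have sub: "fst ?b \<subseteq> carrier G" using M.chart_subset[OF chart1(1)] carrier_eq by simp
  have "has_cderiv ?b ?b (\<lambda>z. z \<otimes> \<one>) \<one> (\<lambda>v. v)"
    by (rule has_cderiv_cong[OF M.smooth chart1 M.chart_openin[OF chart1(1)] chart1(2) _ id]) (use sub in auto)
  with mult_right_has_cderiv[OF chart1(1) chart1(1) chart1(1) chart1(2) chart1(2) m]
  have 1: "(\<lambda>v. ?D (v, 0)) = (\<lambda>v. v)" unfolding has_cderiv_def by (rule has_derivative_unique)
  have "has_cderiv ?b ?b (\<lambda>z. \<one> \<otimes> z) \<one> (\<lambda>v. v)"
    by (rule has_cderiv_cong[OF M.smooth chart1 M.chart_openin[OF chart1(1)] chart1(2) _ id]) (use sub in auto)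
  with mult_left_has_cderiv[OF chart1(1) chart1(1) chart1(1) chart1(2) chart1(2) m]
  have 2: "(\<lambda>v. ?D (0, v)) = (\<lambda>v. v)" unfolding has_cderiv_def by (rule has_derivative_unique)
  have "linear ?D"
    using has_derivative_linear[OF multc_has_derivative[OF chart1(1) chart1(1) chart1(1) chart1(2) chart1(2) m]] .
  from linear_add[OF this, of "(v, 0)" "(0, w)"] show ?thesis
    using fun_cong[OF 1, of v] fun_cong[OF 2, of w] by simp
qed

lemma mult_curves_has_mderiv:
  assumes \<alpha>: "has_mderiv euclidean_manifold M \<alpha> 0 A" "\<alpha> 0 = \<one>" "continuous_map euclidean (mtop M) \<alpha>"
    and \<beta>: "has_mderiv euclidean_manifold M \<beta> 0 B" "\<beta> 0 = \<one>" "continuous_map euclidean (mtop M) \<beta>"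
  shows "has_mderiv (euclidean_manifold :: (real, real) manifold) M (\<lambda>s. \<alpha> s \<otimes> \<beta> s) 0 (\<lambda>h. A h + B h)"
proof -
  let ?m = "multc chart1 chart1 chart1" and ?p = "(snd chart1 \<one>, snd chart1 \<one>)"
  have m: "\<one> \<otimes> \<one> \<in> fst chart1" using chart1 by simp
  have a: "((\<lambda>s. snd chart1 (\<alpha> s)) has_derivative A) (at 0)"
    using \<alpha>(1,2) unfolding has_mderiv_def has_cderiv_def by (simp add: comp_def chart1_def)
  have b: "((\<lambda>s. snd chart1 (\<beta> s)) has_derivative B) (at 0)"
    using \<beta>(1,2) unfolding has_mderiv_def has_cderiv_def by (simp add: comp_def chart1_def)
  have "(?m has_derivative frechet_derivative ?m (at ?p)) (at (snd chart1 (\<alpha> 0), snd chart1 (\<beta> 0)))"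
    unfolding \<alpha>(2) \<beta>(2) by (rule multc_has_derivative[OF chart1(1) chart1(1) chart1(1) chart1(2) chart1(2) m])
  from has_derivative_compose[OF has_derivative_Pair[OF a b] this]
  have "((\<lambda>s. ?m (snd chart1 (\<alpha> s), snd chart1 (\<beta> s))) has_derivative (\<lambda>h. A h + B h)) (at 0)"
    unfolding multc_derivative_one .
  moreover have "open ({s. \<alpha> s \<in> fst chart1} \<inter> {s. \<beta> s \<in> fst chart1})"
    using openin_continuous_map_preimage[OF \<alpha>(3) M.chart_openin[OF chart1(1)]]
      openin_continuous_map_preimage[OF \<beta>(3) M.chart_openin[OF chart1(1)]] by (simp add: open_Int)
  ultimately have "((\<lambda>s. snd chart1 (\<alpha> s \<otimes> \<beta> s)) has_derivative (\<lambda>h. A h + B h)) (at 0)"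
    by (rule has_derivative_transform_within_open) (use \<alpha>(2) \<beta>(2) chart1 in \<open>auto simp: multc_def\<close>)
  then have "has_cderiv (chart_at euclidean_manifold (0::real)) (chart_at M (\<alpha> 0 \<otimes> \<beta> 0)) (\<lambda>s. \<alpha> s \<otimes> \<beta> s) 0 (\<lambda>h. A h + B h)"
    unfolding has_cderiv_def \<alpha>(2) \<beta>(2) by (simp add: comp_def chart1_def[symmetric])
  moreover have "cont_at euclidean_manifold M (\<lambda>s. \<alpha> s \<otimes> \<beta> s) (0::real)"
    by (rule cont_at_continuous_map) (auto intro: continuous_map_mult \<alpha>(3) \<beta>(3))
  ultimately show ?thesis
    unfolding has_mderiv_def using \<alpha>(2) \<beta>(2) one_in by simp
qed

section \<open>One-parameter subgroups and the exponential map\<close>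

lemma one_parameter_subgroupD:
  assumes "one_parameter_subgroup G M X \<gamma>"
  shows "continuous_map euclidean (mtop M) \<gamma>" "\<gamma> t \<in> carrier G" "\<gamma> (s + t) = \<gamma> s \<otimes> \<gamma> t" "\<gamma> 0 = \<one>"
    "has_mderiv euclidean_manifold M \<gamma> 0 (\<lambda>h. h *\<^sub>R X)"
proof -
  show cont: "continuous_map euclidean (mtop M) \<gamma>"
    using assms unfolding one_parameter_subgroup_def smooth_map_def by simp
  show car: "\<gamma> t \<in> carrier G" for t using continuous_map_funspace[OF cont] carrier_eq by auto
  show add: "\<gamma> (s + t) = \<gamma> s \<otimes> \<gamma> t" for s t using assms unfolding one_parameter_subgroup_def by blast
  show "\<gamma> 0 = \<one>" using add[of 0 0] car[of 0] by simp
  have d: "has_mderiv euclidean_manifold M \<gamma> 0 (mderiv euclidean_manifold M \<gamma> 0)"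
    by (rule smooth_map_has_mderiv[OF smooth_manifold_euclidean M.smooth])
       (use assms in \<open>simp_all add: one_parameter_subgroup_def\<close>)
  have "mderiv euclidean_manifold M \<gamma> 0 = (\<lambda>h. h *\<^sub>R X)"
  proof
    fix h :: real
    show "mderiv euclidean_manifold M \<gamma> 0 h = h *\<^sub>R X"
      using linear_cmul[OF linear_has_mderiv[OF d], of h 1] assms unfolding one_parameter_subgroup_def by simp
  qed
  with d show "has_mderiv euclidean_manifold M \<gamma> 0 (\<lambda>h. h *\<^sub>R X)" by simp
qed

text \<open>
  The curve \<open>f = \<gamma>\<^sup>-\<^sup>1 \<delta>\<close> has derivative \<open>0\<close> at \<open>0\<close>, hence everywhere,
  because \<open>f s = \<gamma> t\<^sup>-\<^sup>1 f (s - t) \<delta> t\<close>.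
\<close>

lemma one_parameter_subgroup_unique:
  assumes \<gamma>: "one_parameter_subgroup G M X \<gamma>" and \<delta>: "one_parameter_subgroup G M X \<delta>"
  shows "\<gamma> = \<delta>"
proof
  fix t
  note c = one_parameter_subgroupD[OF \<gamma>] and d = one_parameter_subgroupD[OF \<delta>]
  define f where "f s = inv (\<gamma> s) \<otimes> \<delta> s" for s
  have inv_smooth: "smooth_map M M (\<lambda>x. inv x)" using lie unfolding lie_group_def by blast
  then have inv_cont: "continuous_map (mtop M) (mtop M) (\<lambda>x. inv x)" unfolding smooth_map_def by blast
  have icont: "continuous_map euclidean (mtop M) (\<lambda>s. inv (\<gamma> s))"
    using continuous_map_compose[OF c(1) inv_cont] by (simp add: comp_def)
  have fcont: "continuous_map euclidean (mtop M) f"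
    unfolding f_def by (intro continuous_map_mult icont d(1))
  have fcar: "f s \<in> carrier G" for s unfolding f_def using c(2) d(2) by simp
  have f0: "f 0 = \<one>" unfolding f_def using c(4) d(4) by simp
  have "has_mderiv euclidean_manifold M (\<lambda>s. inv (\<gamma> s)) 0 (\<lambda>h. mderiv M M (\<lambda>x. inv x) (\<gamma> 0) (h *\<^sub>R X))"
    by (rule has_mderiv_compose[OF smooth_manifold_euclidean M.smooth c(5)])
       (rule smooth_map_has_mderiv[OF M.smooth M.smooth inv_smooth], use c(4) one_in in simp)
  from mult_curves_has_mderiv[OF this _ icont d(5,4,1)] c(4)
  obtain D where D: "has_mderiv euclidean_manifold M f 0 D" unfolding f_def by auto
  \<comment> \<open>The product \<open>\<gamma> s \<otimes> f s\<close> is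
    \<open>\<delta> s\<close>, so the product rule gives
    \<open>h *\<^sub>R X + D h = h *\<^sub>R X\<close>. In this way \<open>D = 0\<close> follows
    without computing the derivative of inversion.\<close>
  have "has_mderiv euclidean_manifold M (\<lambda>s. \<gamma> s \<otimes> f s) 0 (\<lambda>h. h *\<^sub>R X + D h)"
    by (rule mult_curves_has_mderiv[OF c(5,4,1) D f0 fcont])
  moreover have "(\<lambda>s. \<gamma> s \<otimes> f s) = \<delta>"
    unfolding f_def using c(2) d(2) by (simp add: fun_eq_iff m_assoc[symmetric])
  ultimately have "(\<lambda>h. h *\<^sub>R X + D h) = (\<lambda>h. h *\<^sub>R X)"
    using d(5) has_mderiv_unique by metis
  then have D0: "D = (\<lambda>h. 0)" by (simp add: fun_eq_iff)
  have "has_mderiv euclidean_manifold M f t (\<lambda>h. 0)" for t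
  proof -
    let ?g = "inv (\<gamma> t)" and ?h = "\<delta> t"
    have g: "?g \<in> carrier G" "?h \<in> carrier G" using c(2) d(2) by auto
    have "has_mderiv euclidean_manifold euclidean_manifold (\<lambda>s. s - t) t (\<lambda>h. h)"
      unfolding has_mderiv_euclidean_iff has_cderiv_def
      by (auto intro!: cont_at_continuous_map continuous_intros derivative_eq_intros simp: comp_def)
    from has_mderiv_compose[OF smooth_manifold_euclidean smooth_manifold_euclidean this, of M f D] D
    have 1: "has_mderiv euclidean_manifold M (\<lambda>s. f (s - t)) t (\<lambda>h. 0)" by (simp add: D0)
    obtain D1 where D1: "has_mderiv M M (\<lambda>z. ?g \<otimes> z) \<one> D1" using mult_left_has_mderiv[OF g(1) one_closed] .
    obtain D2 where D2: "has_mderiv M M (\<lambda>z. z \<otimes> ?h) (?g \<otimes> \<one>) D2"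
      using mult_right_has_mderiv[of "?g \<otimes> \<one>" ?h] g by auto
    have 2: "has_mderiv euclidean_manifold M (\<lambda>s. ?g \<otimes> f (s - t)) t (\<lambda>h. D1 0)"
      using has_mderiv_compose[OF smooth_manifold_euclidean M.smooth 1, of M "\<lambda>z. ?g \<otimes> z" D1] D1 f0 by simp
    have "has_mderiv euclidean_manifold M (\<lambda>s. (?g \<otimes> f (s - t)) \<otimes> ?h) t (\<lambda>h. D2 (D1 0))"
      using has_mderiv_compose[OF smooth_manifold_euclidean M.smooth 2, of M "\<lambda>z. z \<otimes> ?h" D2] D2 f0 by simp
    moreover have "(?g \<otimes> f (s - t)) \<otimes> ?h = f s" for s
    proof -
      have "inv (\<gamma> s) = ?g \<otimes> inv (\<gamma> (s - t))"
        using c(3)[of "s - t" t] c(2) by (simp add: inv_mult_group)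
      moreover have "\<delta> s = \<delta> (s - t) \<otimes> ?h" using d(3)[of "s - t" t] by simp
      ultimately show ?thesis unfolding f_def using c(2) d(2) by (simp add: m_assoc)
    qed
    moreover have "D2 (D1 0) = 0"
      using linear_0[OF linear_has_mderiv[OF D1]] linear_0[OF linear_has_mderiv[OF D2]] by simp
    ultimately show ?thesis by simp
  qed
  from has_mderiv_curve_const[OF M.smooth fcont this]
  have "inv (\<gamma> t) \<otimes> \<delta> t = \<one>" using f0 unfolding f_def by metis
  then show "\<gamma> t = \<delta> t" using c(2)[of t] d(2)[of t] by (metis inv_equality inv_inv inv_closed)
qed

lemma one_parameter_subgroup_scale:
  assumes \<gamma>: "one_parameter_subgroup G M X \<gamma>"
  shows "one_parameter_subgroup G M (r *\<^sub>R X) (\<lambda>s. \<gamma> (r * s))"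
proof -
  note c = one_parameter_subgroupD[OF \<gamma>]
  have sm: "smooth_map euclidean_manifold M \<gamma>" using \<gamma> unfolding one_parameter_subgroup_def by blast
  have lin: "bounded_linear (\<lambda>s::real. r * s)" by (rule bounded_linear_mult_right)
  have cont: "continuous_map euclidean (mtop M) (\<lambda>s. \<gamma> (r * s))"
    using continuous_map_compose[of euclidean euclidean "\<lambda>s. r * s" "mtop M" \<gamma>] c(1)
    by (simp add: comp_def linear_continuous_on[OF lin])
  have "smooth_map euclidean_manifold M (\<lambda>s. \<gamma> (r * s))"
    unfolding smooth_map_def
  proof (intro conjI ballI)
    fix e :: "(real, real) chart" and d assume e: "e \<in> atlas euclidean_manifold" and d: "d \<in> atlas M"
    have o: "open {s. \<gamma> (r * s) \<in> fst d}"
      using openin_continuous_map_preimage[OF cont M.chart_openin[OF d]] by simp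
    have "Ck_on n {s. \<gamma> s \<in> fst d} (\<lambda>s. snd d (\<gamma> s))" for n
      using smooth_map_chart_Ck[OF sm, of "(UNIV, id)" d n] d
      by (simp add: comp_def)
    then have "Ck_on n {s. \<gamma> (r * s) \<in> fst d} (\<lambda>s. snd d (\<gamma> (r * s)))" for n
      by (rule Ck_on_compose[OF o _ Ck_on_bounded_linear[OF o lin]]) auto
    then show "smooth_on (snd e ` {x \<in> fst e. \<gamma> (r * x) \<in> fst d}) (snd d \<circ> (\<lambda>s. \<gamma> (r * s)) \<circ> chart_inv e)"
      using e unfolding smooth_on_def by (simp add: comp_def)
  qed (use cont in simp)
  moreover have "\<gamma> (r * (s + t)) = \<gamma> (r * s) \<otimes> \<gamma> (r * t)" for s t
    using c(3)[of "r * s" "r * t"] by (simp add: distrib_left)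
  moreover have "mderiv euclidean_manifold M (\<lambda>s. \<gamma> (r * s)) 0 1 = r *\<^sub>R X"
  proof -
    have "has_mderiv euclidean_manifold euclidean_manifold (\<lambda>s. r * s) 0 (\<lambda>h. r * h)"
      unfolding has_mderiv_euclidean_iff has_cderiv_def
      by (auto intro!: cont_at_continuous_map continuous_intros derivative_eq_intros simp: comp_def)
    from has_mderiv_compose[OF smooth_manifold_euclidean smooth_manifold_euclidean this, of M \<gamma>] c(5)
    have "has_mderiv euclidean_manifold M (\<lambda>s. \<gamma> (r * s)) 0 (\<lambda>h. (r * h) *\<^sub>R X)" by simp
    from mderiv_eq[OF this] show ?thesis by simp
  qed
  ultimately show ?thesis unfolding one_parameter_subgroup_def by blast
qed

lemma lie_exp_eq:
  assumes "one_parameter_subgroup G M X \<gamma>"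
  shows "lie_exp G M X = \<gamma> 1"
proof -
  have "(THE \<gamma>. one_parameter_subgroup G M X \<gamma>) = \<gamma>"
    by (rule the_equality) (use assms one_parameter_subgroup_unique in auto)
  then show ?thesis unfolding lie_exp_def by simp
qed

text \<open>By rescaling, either all nonzero multiples of \<open>X\<close> generate one-parameter
  subgroups or none does. In the second case the predicates under the description operator coincide,
  and so do its unspecified values.\<close>

lemma lie_exp_cases:
  "(\<forall>t. lie_exp G M (t *\<^sub>R X) \<in> carrier G) \<or>
   (\<forall>s t. s \<noteq> 0 \<longrightarrow> t \<noteq> 0 \<longrightarrow> lie_exp G M (s *\<^sub>R X) = lie_exp G M (t *\<^sub>R X))"
proof (cases "\<exists>\<gamma>. one_parameter_subgroup G M X \<gamma>")
  case True
  then obtain \<gamma> where \<gamma>: "one_parameter_subgroup G M X \<gamma>" by blast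
  have "lie_exp G M (t *\<^sub>R X) \<in> carrier G" for t
    using lie_exp_eq[OF one_parameter_subgroup_scale[OF \<gamma>, of t]] one_parameter_subgroupD(2)[OF \<gamma>] by simp
  then show ?thesis by blast
next
  case False
  have "one_parameter_subgroup G M (t *\<^sub>R X) = (\<lambda>_. False)" if "t \<noteq> 0" for t
  proof
    fix \<gamma>
    show "one_parameter_subgroup G M (t *\<^sub>R X) \<gamma> = False"
      using one_parameter_subgroup_scale[of "t *\<^sub>R X" \<gamma> "1 / t"] False that by auto
  qed
  then show ?thesis unfolding lie_exp_def by auto
qed

end

section \<open>The quotient and its frame of fundamental vector fields\<close>

locale lie_quotient = lie_grp G M for G :: "'g monoid" (structure) and M :: "('g, 'e::euclidean_space) manifold" +
  fixes \<Gamma> :: "'g set"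
  assumes \<Gamma>: "subgroup \<Gamma> G"
    and quotient_smooth: "smooth_manifold (quotient_manifold G M \<Gamma>)"
begin

abbreviation "N \<equiv> quotient_manifold G M \<Gamma>"

definition q :: "'g \<Rightarrow> 'g set" where "q x = x <# \<Gamma>"

sublocale N: smooth_mfd N by unfold_locales (rule quotient_smooth)

lemma mtop_N: "mtop N = quotient_topology (mtop M) q"
  unfolding quotient_manifold_def q_def Let_def by simp

lemma atlas_N: "atlas N = {(q ` V, snd c \<circ> inv_into V q) | c V.
    c \<in> atlas M \<and> V \<subseteq> fst c \<and> openin (mtop M) V \<and> inj_on q V}"
  unfolding quotient_manifold_def q_def Let_def by simp

lemma topspace_N: "topspace (mtop N) = q ` carrier G"
  unfolding mtop_N carrier_eq
  using quotient_imp_surjective_map[OF quotient_map_quotient_topology[of "mtop M" q]] by simp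

lemma q_cont: "continuous_map (mtop M) (mtop N) q"
  unfolding mtop_N by (rule quotient_imp_continuous_map[OF quotient_map_quotient_topology])

lemma \<Gamma>_subset: "\<Gamma> \<subseteq> carrier G"
  using subgroup.subset[OF \<Gamma>] .

lemma coset_subset: "x \<in> topspace (mtop N) \<Longrightarrow> x \<subseteq> carrier G"
  unfolding topspace_N q_def using l_coset_subset_G[OF \<Gamma>_subset] by blast

lemma act_assoc:
  "y \<in> carrier G \<Longrightarrow> z \<in> carrier G \<Longrightarrow> x \<in> topspace (mtop N) \<Longrightarrow> y <# (z <# x) = (y \<otimes> z) <# x"
  using lcos_m_assoc[OF coset_subset] by simp

lemma act_q: "y \<in> carrier G \<Longrightarrow> z \<in> carrier G \<Longrightarrow> y <# q z = q (y \<otimes> z)"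
  unfolding q_def using lcos_m_assoc[OF \<Gamma>_subset] by simp

lemma act_one: "x \<in> topspace (mtop N) \<Longrightarrow> \<one> <# x = x"
  using lcos_mult_one[OF coset_subset] .

lemma act_in: "y \<in> carrier G \<Longrightarrow> x \<in> topspace (mtop N) \<Longrightarrow> y <# x \<in> topspace (mtop N)"
  unfolding topspace_N using act_q by force

lemma orbit_cont:
  assumes x: "x \<in> topspace (mtop N)"
  shows "continuous_map (mtop M) (mtop N) (\<lambda>y. y <# x)"
proof -
  obtain g where g: "g \<in> carrier G" "x = q g" using x unfolding topspace_N by blast
  have "continuous_map (mtop M) (mtop N) (q \<circ> (\<lambda>y. y \<otimes> g))"
    by (rule continuous_map_compose[OF mult_right_cont[OF g(1)] q_cont])
  then show ?thesis
    by (rule continuous_map_eq) (use g act_q carrier_eq in auto)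
qed

text \<open>In a chart of the quotient the orbit map is a right translation of \<open>G\<close> in a chart of \<open>G\<close>.\<close>

lemma orbit_has_cderiv:
  assumes c: "c \<in> atlas M" and V: "V \<subseteq> fst c" "openin (mtop M) V" "inj_on q V"
    and g: "g \<in> V"
  shows "has_cderiv chart1 (q ` V, snd c \<circ> inv_into V q) (\<lambda>y. y <# q g) \<one>
    (\<lambda>v. frechet_derivative (multc chart1 c c) (at (snd chart1 \<one>, snd c g)) (v, 0))"
proof -
  let ?D = "\<lambda>v. frechet_derivative (multc chart1 c c) (at (snd chart1 \<one>, snd c g)) (v, 0)"
  have gc: "g \<in> fst c" using V g by blast
  have gG: "g \<in> carrier G" using M.chart_point[OF c gc] carrier_eq by simp
  have "\<one> \<otimes> g \<in> fst c" using gG gc by simp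
  from mult_right_has_cderiv[OF chart1(1) c c chart1(2) gc this]
  have "(snd c \<circ> (\<lambda>y. y \<otimes> g) \<circ> chart_inv chart1 has_derivative ?D) (at (snd chart1 \<one>))"
    unfolding has_cderiv_def .
  then have "(snd (q ` V, snd c \<circ> inv_into V q) \<circ> (\<lambda>y. y <# q g) \<circ> chart_inv chart1 has_derivative ?D) (at (snd chart1 \<one>))"
  proof (rule has_derivative_transform_within_open)
    let ?U = "{y \<in> topspace (mtop M). y \<otimes> g \<in> V} \<inter> fst chart1"
    have "openin (mtop M) ?U"
      by (intro openin_Int openin_continuous_map_preimage[OF mult_right_cont[OF gG] V(2)] M.chart_openin chart1)
    then show "open (snd chart1 ` ?U)" by (rule M.chart_open_image[OF chart1(1)]) simp
    show "snd chart1 \<one> \<in> snd chart1 ` ?U" using chart1 gG g one_in by auto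
    fix u assume "u \<in> snd chart1 ` ?U"
    then obtain y where y: "u = snd chart1 y" "y \<in> carrier G" "y \<otimes> g \<in> V" "y \<in> fst chart1"
      unfolding carrier_eq by auto
    then show "(snd c \<circ> (\<lambda>y. y \<otimes> g) \<circ> chart_inv chart1) u =
        (snd (q ` V, snd c \<circ> inv_into V q) \<circ> (\<lambda>y. y <# q g) \<circ> chart_inv chart1) u"
      using chart1 act_q[OF y(2) gG] inv_into_f_f[OF V(3) y(3)] by simp
  qed
  then show ?thesis unfolding has_cderiv_def .
qed

text \<open>Right translation by \<open>inv g\<close> undoes right translation by \<open>g\<close>,
  so the chain rule provides a left inverse of the derivative.\<close>

lemma translation_derivative_inj:
  assumes c: "c \<in> atlas M" "g \<in> fst c"
    and eq: "frechet_derivative (multc chart1 c c) (at (snd chart1 \<one>, snd c g)) (v, 0)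
      = frechet_derivative (multc chart1 c c) (at (snd chart1 \<one>, snd c g)) (w, 0)"
  shows "v = w"
proof -
  let ?D = "\<lambda>v. frechet_derivative (multc chart1 c c) (at (snd chart1 \<one>, snd c g)) (v, 0)"
  have g: "g \<in> carrier G" using M.chart_point[OF c] carrier_eq by simp
  have og: "\<one> \<otimes> g \<in> fst c" using g c by simp
  define d where "d = chart_at M (inv g)"
  have d: "d \<in> atlas M" "inv g \<in> fst d"
    unfolding d_def using M.chart_at[of "inv g"] inv_closed[OF g] carrier_eq by auto
  have gi: "g \<otimes> inv g \<in> fst chart1" using g chart1 by simp
  obtain D' where D': "has_cderiv c chart1 (\<lambda>z. z \<otimes> inv g) (\<one> \<otimes> g) D'"
    using mult_right_has_cderiv[OF c(1) d(1) chart1(1) c(2) d(2) gi] g by auto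
  have "has_cderiv chart1 chart1 (\<lambda>z. (z \<otimes> g) \<otimes> inv g) \<one> (\<lambda>v. D' (?D v))"
    by (rule has_cderiv_compose[where f = "\<lambda>z. z \<otimes> g", OF M.smooth M.smooth _ chart1 c(1) og
          mult_right_has_cderiv[OF chart1(1) c(1) c(1) chart1(2) c(2) og] D'])
       (rule cont_at_continuous_map[OF mult_right_cont[OF g] one_in])
  moreover have "has_cderiv chart1 chart1 (\<lambda>z. (z \<otimes> g) \<otimes> inv g) \<one> (coord_change chart1 chart1 \<one>)"
  proof (rule has_cderiv_cong[OF M.smooth chart1 openin_topspace one_in])
    show "has_cderiv chart1 chart1 (\<lambda>x. x) \<one> (coord_change chart1 chart1 \<one>)"
      by (rule M.has_cderiv_coord_change) (rule chart1)+
    fix y assume "y \<in> topspace (mtop M)"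
    then have "y \<in> carrier G" by (simp add: carrier_eq)
    then show "y = (y \<otimes> g) \<otimes> inv g" using g by (simp add: m_assoc)
  qed
  ultimately have "(\<lambda>v. D' (?D v)) = coord_change chart1 chart1 \<one>"
    unfolding has_cderiv_def by (rule has_derivative_unique)
  then have "D' (?D u) = u" for u using M.coord_change_self[OF chart1] by (simp add: fun_eq_iff)
  then show ?thesis using eq by metis
qed

text \<open>The value at \<open>x\<close> of the fundamental vector field of a Lie algebra element.
  Right-invariant fields on \<open>G\<close> descend to the space of left cosets, which makes this a
  global frame.\<close>

definition \<theta> :: "'g set \<Rightarrow> 'e \<Rightarrow> 'e" where
  "\<theta> x = mderiv M N (\<lambda>y. y <# x) \<one>"

lemma chart_N:
  assumes "C \<in> atlas N" "x \<in> fst C"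
  obtains c V g where "c \<in> atlas M" "V \<subseteq> fst c" "openin (mtop M) V" "inj_on q V" "g \<in> V" "x = q g"
    "C = (q ` V, snd c \<circ> inv_into V q)" "snd C x = snd c g"
proof -
  from assms(1) obtain c V where C: "c \<in> atlas M" "V \<subseteq> fst c" "openin (mtop M) V" "inj_on q V"
    "C = (q ` V, snd c \<circ> inv_into V q)" unfolding atlas_N by blast
  with assms(2) obtain g where g: "g \<in> V" "x = q g" by auto
  then have "snd C x = snd c g" using C by (simp add: inv_into_f_f)
  with C g show ?thesis using that by blast
qed

lemma orbit_has_mderiv:
  assumes x: "x \<in> topspace (mtop N)"
  shows "has_mderiv M N (\<lambda>y. y <# x) \<one> (\<theta> x)"
proof -
  obtain c V g where c: "c \<in> atlas M" "V \<subseteq> fst c" "openin (mtop M) V" "inj_on q V" "g \<in> V" "x = q g"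
    "chart_at N x = (q ` V, snd c \<circ> inv_into V q)" by (rule chart_N[OF N.chart_at[OF x]]) (rule that)
  have x1: "\<one> <# q g = q g" using act_one[OF x] c(6) by simp
  have "has_cderiv chart1 (chart_at N x) (\<lambda>y. y <# x) \<one>
      (\<lambda>v. frechet_derivative (multc chart1 c c) (at (snd chart1 \<one>, snd c g)) (v, 0))"
    unfolding c(6,7)[symmetric] using orbit_has_cderiv[OF c(1-5)] c(6,7) by simp
  then have "has_mderiv M N (\<lambda>y. y <# x) \<one>
      (\<lambda>v. frechet_derivative (multc chart1 c c) (at (snd chart1 \<one>, snd c g)) (v, 0))"
    unfolding has_mderiv_def chart1_def
    using cont_at_continuous_map[OF orbit_cont[OF x] one_in] act_one[OF x] x by simp
  then show ?thesis unfolding \<theta>_def using mderiv_eq by metis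
qed

text \<open>In a chart of the quotient the frame is the derivative of multiplication in its first
  variable, an expression continuous in \<open>g\<close>. Both \<open>\<theta>_inj\<close> and
  \<open>\<theta>_section\<close> rest on this formula.\<close>

lemma \<theta>_chart:
  assumes c: "c \<in> atlas M" "V \<subseteq> fst c" "openin (mtop M) V" "inj_on q V" and g: "g \<in> V"
  defines "C \<equiv> (q ` V, snd c \<circ> inv_into V q)"
  shows "coord_change (chart_at N (q g)) C (q g) (\<theta> (q g) v)
    = frechet_derivative (multc chart1 c c) (at (snd chart1 \<one>, snd c g)) (v, 0)"
proof -
  have "C \<in> atlas N" unfolding C_def atlas_N using c by blast
  moreover have "q g \<in> fst C" using g by (simp add: C_def)
  ultimately have C: "C \<in> atlas N" "q g \<in> fst C" .
  have x: "q g \<in> topspace (mtop N)" using N.chart_point[OF C] .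
  have o: "\<one> <# q g = q g" by (rule act_one[OF x])
  have "has_cderiv chart1 C (\<lambda>y. y <# q g) \<one>
    (\<lambda>v. coord_change (chart_at N (\<one> <# q g)) C (\<one> <# q g) (\<theta> (q g) (coord_change chart1 (chart_at M \<one>) \<one> v)))"
    by (rule has_mderivD[where f = "\<lambda>y. y <# q g", OF M.smooth N.smooth orbit_has_mderiv[OF x] chart1 C(1)])
       (use C o in simp)
  moreover have "has_cderiv chart1 C (\<lambda>y. y <# q g) \<one>
    (\<lambda>v. frechet_derivative (multc chart1 c c) (at (snd chart1 \<one>, snd c g)) (v, 0))"
    unfolding C_def by (rule orbit_has_cderiv[OF c g])
  ultimately have "(\<lambda>v. coord_change (chart_at N (\<one> <# q g)) C (\<one> <# q g) (\<theta> (q g) (coord_change chart1 (chart_at M \<one>) \<one> v)))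
    = (\<lambda>v. frechet_derivative (multc chart1 c c) (at (snd chart1 \<one>, snd c g)) (v, 0))"
    unfolding has_cderiv_def by (rule has_derivative_unique)
  from fun_cong[OF this, of v] show ?thesis
    using M.coord_change_self[OF chart1] o by (simp add: chart1_def)
qed

lemma \<theta>_linear: "x \<in> topspace (mtop N) \<Longrightarrow> linear (\<theta> x)"
  using linear_has_mderiv[OF orbit_has_mderiv] .

lemma \<theta>_inj:
  assumes x: "x \<in> topspace (mtop N)"
  shows "inj (\<theta> x)"
proof (rule injI)
  fix v w assume eq: "\<theta> x v = \<theta> x w"
  obtain c V g where c: "c \<in> atlas M" "V \<subseteq> fst c" "openin (mtop M) V" "inj_on q V" "g \<in> V" "x = q g"
    by (rule chart_N[OF N.chart_at[OF x]]) (rule that)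
  show "v = w"
    by (rule translation_derivative_inj[OF c(1)])
       (use c eq \<theta>_chart[OF c(1-5), of v] \<theta>_chart[OF c(1-5), of w] in auto)
qed

lemma \<theta>_section: "continuous_section N (topspace (mtop N)) (\<lambda>x. \<theta> x v)"
  unfolding continuous_section_def
proof
  fix C assume CN: "C \<in> atlas N"
  then obtain c V where c: "c \<in> atlas M" "V \<subseteq> fst c" "openin (mtop M) V" "inj_on q V"
    and C: "C = (q ` V, snd c \<circ> inv_into V q)" unfolding atlas_N by blast
  let ?h = "\<lambda>w. frechet_derivative (multc chart1 c c) (at (snd chart1 \<one>, w)) (v, 0)"
  have img: "snd C ` fst C = snd c ` V" unfolding C using c(4) by (force simp: image_iff)
  have "continuous_on (snd C ` fst C) ?h"
  proof (rule continuous_on_compose2[OF Ck_on_continuous_on[OF Ck_on_Suc_derivative[OF multc_Ck[OF chart1(1) c(1) c(1)]]]])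
    show "(\<lambda>w. (snd chart1 \<one>, w)) ` (snd C ` fst C) \<subseteq> mult_dom chart1 c c"
    proof
      fix p assume "p \<in> (\<lambda>w. (snd chart1 \<one>, w)) ` (snd C ` fst C)"
      then obtain g where g: "g \<in> V" "p = (snd chart1 \<one>, snd c g)" unfolding img by auto
      then have gc: "g \<in> fst c" using c by blast
      then have "\<one> \<otimes> g \<in> fst c" using M.chart_point[OF c(1)] carrier_eq by auto
      then show "p \<in> mult_dom chart1 c c"
        unfolding g(2) by (rule iffD2[OF mult_dom_iff[OF chart1(1) c(1) chart1(2) gc]])
    qed
  qed (intro continuous_intros)
  then have "continuous_map (top_of_set (snd C ` fst C)) euclidean ?h" by simp
  from continuous_map_compose[OF homeomorphic_imp_continuous_map[OF N.chart_homeo[OF CN]] this]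
  have "continuous_map (subtopology (mtop N) (fst C)) euclidean (?h \<circ> snd C)" .
  then have "continuous_map (subtopology (mtop N) (fst C)) euclidean (\<lambda>x. coord_change (chart_at N x) C x (\<theta> x v))"
  proof (rule continuous_map_eq)
    fix x assume "x \<in> topspace (subtopology (mtop N) (fst C))"
    then obtain g where g: "g \<in> V" "x = q g" unfolding C by auto
    then show "(?h \<circ> snd C) x = coord_change (chart_at N x) C x (\<theta> x v)"
      using \<theta>_chart[OF c g(1), of v] c(4) by (simp add: C inv_into_f_f)
  qed
  moreover have "topspace (mtop N) \<inter> fst C = fst C" using N.chart_subset[OF CN] by blast
  ultimately show "continuous_map (subtopology (mtop N) (topspace (mtop N) \<inter> fst C)) euclidean
      (\<lambda>x. coord_change (chart_at N x) C x (\<theta> x v))" by simp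
qed

lemma conjugation_has_mderiv:
  assumes h: "h \<in> carrier G"
  shows "has_mderiv M M (\<lambda>y. h \<otimes> y \<otimes> inv h) \<one> (Ad G M h)"
proof -
  obtain D1 where D1: "has_mderiv M M (\<lambda>z. h \<otimes> z) \<one> D1" using mult_left_has_mderiv[OF h one_closed] .
  obtain D2 where D2: "has_mderiv M M (\<lambda>z. z \<otimes> inv h) (h \<otimes> \<one>) D2"
    using mult_right_has_mderiv[of "h \<otimes> \<one>" "inv h"] h by auto
  from has_mderiv_compose[OF M.smooth M.smooth D1 D2]
  show ?thesis unfolding Ad_def using mderiv_eq by metis
qed

text \<open>Differentiate the identity
  \<open>h <# (y <# x) = (h \<otimes> y \<otimes> inv h) <# (h <# x)\<close> in \<open>y\<close> at
  the unit: the conjugation contributes \<open>Ad G M h\<close>, independently of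
  \<open>x\<close>.\<close>

lemma \<theta>_equivariant:
  assumes x: "x \<in> topspace (mtop N)" and h: "h \<in> carrier G"
    and f: "\<And>y. y \<in> topspace (mtop N) \<Longrightarrow> f y = h <# y"
    and D: "has_mderiv N N f x D"
  shows "D (\<theta> x v) = \<theta> (f x) (Ad G M h v)"
proof -
  have fx: "f x \<in> topspace (mtop N)" using f[OF x] act_in[OF h x] by simp
  have x1: "\<one> <# x = x" by (rule act_one[OF x])
  have h1: "h \<otimes> \<one> \<otimes> inv h = \<one>" using h by simp
  have "has_mderiv M N (\<lambda>y. f (y <# x)) \<one> (\<lambda>v. D (\<theta> x v))"
    by (rule has_mderiv_compose[where f = "\<lambda>y. y <# x", OF M.smooth N.smooth orbit_has_mderiv[OF x]]) (use D x1 in simp)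
  then have "has_mderiv M N (\<lambda>y. (h \<otimes> y \<otimes> inv h) <# f x) \<one> (\<lambda>v. D (\<theta> x v))"
  proof (rule has_mderiv_cong[OF M.smooth _ openin_topspace one_in])
    fix y assume "y \<in> topspace (mtop M)"
    then have y: "y \<in> carrier G" by (simp add: carrier_eq)
    have "(h \<otimes> y \<otimes> inv h) <# f x = (h \<otimes> y \<otimes> inv h \<otimes> h) <# x"
      using f[OF x] act_assoc[OF _ h x, of "h \<otimes> y \<otimes> inv h"] h y by simp
    also have "h \<otimes> y \<otimes> inv h \<otimes> h = h \<otimes> y" using h y by (simp add: m_assoc)
    also have "(h \<otimes> y) <# x = f (y <# x)" using f[OF act_in[OF y x]] act_assoc[OF h y x] by simp
    finally show "f (y <# x) = (h \<otimes> y \<otimes> inv h) <# f x" ..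
  qed
  moreover have "has_mderiv M N (\<lambda>y. (h \<otimes> y \<otimes> inv h) <# f x) \<one> (\<lambda>v. \<theta> (f x) (Ad G M h v))"
    by (rule has_mderiv_compose[where f = "\<lambda>y. h \<otimes> y \<otimes> inv h" and g = "\<lambda>y. y <# f x",
          OF M.smooth M.smooth conjugation_has_mderiv[OF h]])
       (use orbit_has_mderiv[OF fx] h1 in simp)
  ultimately have "(\<lambda>v. D (\<theta> x v)) = (\<lambda>v. \<theta> (f x) (Ad G M h v))" by (rule has_mderiv_unique)
  from fun_cong[OF this, of v] show ?thesis .
qed

text \<open>
  If \<open>X\<close> generates no one-parameter subgroup, then the description operator in \<open>lie_exp\<close> yields
  the same value for all nonzero multiples of \<open>X\<close>, and the group law of the flow forces it to be
  the identity.  This replaces the existence theorem for one-parameter subgroups.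
\<close>

lemma homogeneous_flow_translation:
  assumes flow: "smooth_flow N (homogeneous_flow G M X)"
  obtains h where "\<And>t. h t \<in> carrier G"
    "\<And>t x. x \<in> topspace (mtop N) \<Longrightarrow> homogeneous_flow G M X t x = h t <# x"
proof -
  let ?\<phi> = "homogeneous_flow G M X"
  have zero: "?\<phi> 0 x = x" and add: "?\<phi> (s + t) x = ?\<phi> s (?\<phi> t x)" if "x \<in> topspace (mtop N)" for s t x
    using flow that unfolding smooth_flow_def by blast+
  from lie_exp_cases[of X] show ?thesis
  proof
    assume "\<forall>t. lie_exp G M (t *\<^sub>R X) \<in> carrier G"
    then show ?thesis using that[of "\<lambda>t. lie_exp G M (t *\<^sub>R X)"] by (simp add: homogeneous_flow_def)
  next
    assume *: "\<forall>s t. s \<noteq> 0 \<longrightarrow> t \<noteq> 0 \<longrightarrow> lie_exp G M (s *\<^sub>R X) = lie_exp G M (t *\<^sub>R X)"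
    have eq: "?\<phi> s x = ?\<phi> t x" if "s \<noteq> 0" "t \<noteq> 0" for s t x
      using * that unfolding homogeneous_flow_def by metis
    have "?\<phi> t x = \<one> <# x" if x: "x \<in> topspace (mtop N)" for t x
    proof (cases "t = 0")
      case True
      then show ?thesis using zero[OF x] act_one[OF x] by simp
    next
      case False
      have "?\<phi> 1 x = ?\<phi> (2 + (- 1)) x" by simp
      also have "\<dots> = ?\<phi> 2 (?\<phi> (- 1) x)" by (rule add[OF x])
      also have "\<dots> = ?\<phi> 1 (?\<phi> (- 1) x)" by (rule eq) auto
      also have "\<dots> = ?\<phi> (1 + (- 1)) x" by (rule add[OF x, symmetric])
      also have "\<dots> = x" using zero[OF x] by simp
      finally show ?thesis using eq[OF False, of 1 x] act_one[OF x] by simp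
    qed
    then show ?thesis using that[of "\<lambda>t. \<one>"] by simp
  qed
qed

theorem time_change_homogeneous_flow:
  assumes ph: "partially_hyperbolic N (homogeneous_flow G M X)"
    and \<tau>: "smooth_map N euclidean_manifold \<tau>" "\<forall>x\<in>topspace (mtop N). \<tau> x > 0"
  shows "\<exists>a b A B C. partially_hyperbolic_with N (time_change (homogeneous_flow G M X) \<tau>) a b A B C \<and>
    a + b < A \<and> a + b < B"
proof -
  let ?\<phi> = "homogeneous_flow G M X"
  obtain a b A B C where "partially_hyperbolic_with N ?\<phi> a b A B C"
    using ph unfolding partially_hyperbolic_def by blast
  then obtain Es Ec Eu g where compact: "compact_space (mtop N)" and flow: "smooth_flow N ?\<phi>"
    and pos: "A > 0" "B > 0" "C > 0" and inv: "invariant_splitting N ?\<phi> Es Ec Eu"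
    and nz: "\<forall>x\<in>topspace (mtop N). Es x \<noteq> {0} \<and> Eu x \<noteq> {0}" and g: "riemannian_metric N g"
    and est: "hyperbolicity_estimates N ?\<phi> Es Ec Eu g a b A B C"
    unfolding partially_hyperbolic_with_def by blast
  obtain h where h: "\<And>t. h t \<in> carrier G"
    "\<And>t x. x \<in> topspace (mtop N) \<Longrightarrow> ?\<phi> t x = h t <# x"
    by (rule homogeneous_flow_translation[OF flow]) (rule that)
  interpret T: time_changed_flow N ?\<phi> \<tau>
    by unfold_locales (use compact flow \<tau> in auto)
  \<comment> \<open>The group law of \<open>Ad G M (h t)\<close> comes from that of the flow through
    the frame, so the two facts obtained about \<open>h\<close> are enough.\<close>
  interpret F: framed_flow N ?\<phi> \<tau> g \<theta> "\<lambda>t. Ad G M (h t)"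
  proof (intro framed_flow.intro[OF T.time_changed_flow_axioms] framed_flow_axioms.intro)
    show "mderiv N N (?\<phi> t) x (\<theta> x v) = \<theta> (?\<phi> t x) (Ad G M (h t) v)"
      if "x \<in> topspace (mtop N)" for x t v
      by (rule \<theta>_equivariant[OF that h T.\<phi>_has_mderiv[OF that]])
    show "topspace (mtop N) \<noteq> {}" unfolding topspace_N by blast
  qed (use g \<theta>_linear \<theta>_inj \<theta>_section in auto)
  have "F.Stable \<noteq> {0}" "F.Unstable \<noteq> {0}"
    using F.nontrivial_growth[OF inv _ est pos] nz by blast+
  from F.time_change_center_bunched[OF this] show ?thesis .
qed

end

theorem theorem1p2:
  fixes G :: "'g monoid" and M :: "('g, 'e::euclidean_space) manifold"
    and \<Gamma> :: "'g set" and X :: 'e and \<tau> :: "'g set \<Rightarrow> real"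
  assumes "real_semisimple_lie_group G M \<or> complex_semisimple_lie_group G M"
    and "cocompact_lattice G M \<Gamma>"
    and "partially_hyperbolic (quotient_manifold G M \<Gamma>) (homogeneous_flow G M X)"
    and "smooth_map (quotient_manifold G M \<Gamma>) euclidean_manifold \<tau>"
    and "\<forall>x\<in>topspace (mtop (quotient_manifold G M \<Gamma>)). \<tau> x > 0"
  shows "partially_hyperbolic (quotient_manifold G M \<Gamma>)
           (time_change (homogeneous_flow G M X) \<tau>)
       \<and> center_bunched (quotient_manifold G M \<Gamma>)
           (time_change (homogeneous_flow G M X) \<tau>)"
proof -
  have "lie_group G M"
    using assms(1) unfolding real_semisimple_lie_group_def complex_semisimple_lie_group_def complex_lie_group_def
    by blast
  moreover have "subgroup \<Gamma> G" using assms(2) unfolding cocompact_lattice_def by blast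
  \<comment> \<open>Smoothness of the quotient is part of \<open>partially_hyperbolic_with\<close>
    and is read off from there.\<close>
  moreover have "smooth_manifold (quotient_manifold G M \<Gamma>)"
    using assms(3) unfolding partially_hyperbolic_def partially_hyperbolic_with_def by blast
  ultimately interpret lie_quotient G M \<Gamma>
    by (intro lie_quotient.intro lie_grp.intro lie_quotient_axioms.intro)
  show ?thesis
    using time_change_homogeneous_flow[OF assms(3-5)]
    unfolding partially_hyperbolic_def center_bunched_def by blast
qed

end
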